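(* To prove the Jacobian conjecture over $\mathbb{C}$ for all $n>1$ it suffices to verify that there do not exist Keller maps $F\in\mathbb{Z}[X]^n$ of the quadratic-cubic linear form over $\mathbb{Z}$ such that the equation $F_1(X)^2+\dots+F_{n-1}(X)^2=0$ has no non-zero solutions in $\mathbb{Z}^n$. That is: if for every integer $n>1$ and every Keller map $F=(F_1,\dots,F_n)\in\mathbb{Z}[X]^n$ of the quadratic-cubic linear form over $\mathbb{Z}$ the equation $$F_1(X)^2+\dots+F_{n-1}(X)^2=0$$ has a non-zero solution in $\mathbb{Z}^n$, then $JC(\mathbb{C},n)$ is true for all $n>1$.
   Context: Let $k$ be a field of characteristic zero and $X=(X_1,\dots,X_n)$. A polynomial map $F=(F_1,\dots,F_n)\in k[X]^n$ is called a Keller map if $\det DF\equiv 1$; a Keller map in $\mathbb{Z}[X]^n$ is an $F\in\mathbb{Z}[X]^n$ with $\det DF\equiv 1$. The $n$-dimensional Jacobian conjecture $JC(k,n)$, $n>1$, is the assertion that every Keller map $F\in k[X]^n$ has an inverse polynomial map in $k[X]^n$. A map $F\in\mathbb{Z}[X]^n$ is of the quadratic-cubic linear form over $\mathbb{Z}$ if $F_i(X)=X_i+\langle a_i,X\rangle^{d_i}$ with $a_i\in\mathbb{Z}^n$ and $d_i\in\{2,3\}$ for $i=1,\dots,n$, where $\langle a,X\rangle:=a_1X_1+\dots+a_nX_n$ for $a=(a_1,\dots,a_n)$. *)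

theory Defs
  imports
    Complex_Main
    "HOL-Library.Poly_Mapping"
    "Jordan_Normal_Form.Determinant"
begin

(* A monomial is its finitely supported exponent function; Poly_Mapping makes the type below the
   ring of polynomials in countably many variables, with convolution as multiplication.
   The variables X_1, ..., X_n are numbered 0, ..., n - 1. *)

type_synonym 'a mpoly = "(nat \<Rightarrow>\<^sub>0 nat) \<Rightarrow>\<^sub>0 'a"

definition mconst :: "'a::comm_ring_1 \<Rightarrow> 'a mpoly" where
  "mconst c = Poly_Mapping.single 0 c"

definition mvar :: "nat \<Rightarrow> 'a::comm_ring_1 mpoly" where
  "mvar i = Poly_Mapping.single (Poly_Mapping.single i 1) 1"

definition polys :: "nat \<Rightarrow> 'a::comm_ring_1 mpoly set" where
  "polys n = {p. \<forall>m \<in> Poly_Mapping.keys p. Poly_Mapping.keys m \<subseteq> {..<n}}"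

(* The truncated subtraction of exponents is harmless: a monomial without the variable i gets
   the coefficient 0. *)
definition mpderiv :: "nat \<Rightarrow> 'a::comm_ring_1 mpoly \<Rightarrow> 'a mpoly" where
  "mpderiv i p = (\<Sum>m \<in> Poly_Mapping.keys p.
     Poly_Mapping.single (m - Poly_Mapping.single i 1)
       (of_nat (Poly_Mapping.lookup m i) * Poly_Mapping.lookup p m))"

definition mpoly_eval :: "(nat \<Rightarrow> 'a) \<Rightarrow> 'a::comm_ring_1 mpoly \<Rightarrow> 'a" where
  "mpoly_eval x p = (\<Sum>m \<in> Poly_Mapping.keys p.
     Poly_Mapping.lookup p m * (\<Prod>i \<in> Poly_Mapping.keys m. x i ^ Poly_Mapping.lookup m i))"

definition mpoly_subst :: "(nat \<Rightarrow> 'a mpoly) \<Rightarrow> 'a::comm_ring_1 mpoly \<Rightarrow> 'a mpoly" where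
  "mpoly_subst G p = (\<Sum>m \<in> Poly_Mapping.keys p.
     mconst (Poly_Mapping.lookup p m) * (\<Prod>i \<in> Poly_Mapping.keys m. G i ^ Poly_Mapping.lookup m i))"

definition poly_maps :: "nat \<Rightarrow> 'a::comm_ring_1 mpoly vec set" where
  "poly_maps n = {F \<in> carrier_vec n. \<forall>i<n. F $ i \<in> polys n}"

definition var_map :: "nat \<Rightarrow> 'a::comm_ring_1 mpoly vec" where
  "var_map n = vec n mvar"

definition compose_map ::
  "'a::comm_ring_1 mpoly vec \<Rightarrow> 'a mpoly vec \<Rightarrow> 'a mpoly vec" where
  "compose_map F G = map_vec (mpoly_subst (\<lambda>i. G $ i)) F"

definition jacobian_mat :: "nat \<Rightarrow> 'a::comm_ring_1 mpoly vec \<Rightarrow> 'a mpoly mat" where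
  "jacobian_mat n F = mat n n (\<lambda>(i, j). mpderiv j (F $ i))"

definition keller_map :: "nat \<Rightarrow> 'a::comm_ring_1 mpoly vec \<Rightarrow> bool" where
  "keller_map n F \<longleftrightarrow> F \<in> poly_maps n \<and> det (jacobian_mat n F) = 1"

definition has_poly_inverse :: "nat \<Rightarrow> 'a::comm_ring_1 mpoly vec \<Rightarrow> bool" where
  "has_poly_inverse n F \<longleftrightarrow>
     (\<exists>G \<in> poly_maps n. compose_map F G = var_map n \<and> compose_map G F = var_map n)"

definition jacobian_conjecture :: "'k::field_char_0 itself \<Rightarrow> nat \<Rightarrow> bool" where
  "jacobian_conjecture K n \<longleftrightarrow>
     (\<forall>F :: 'k mpoly vec. keller_map n F \<longrightarrow> has_poly_inverse n F)"

definition linear_form :: "'a::comm_ring_1 vec \<Rightarrow> 'a mpoly" where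
  "linear_form a = (\<Sum>j<dim_vec a. mconst (a $ j) * mvar j)"

definition quadratic_cubic_linear_form :: "nat \<Rightarrow> int mpoly vec \<Rightarrow> bool" where
  "quadratic_cubic_linear_form n F \<longleftrightarrow> F \<in> carrier_vec n \<and>
     (\<forall>i<n. \<exists>a \<in> carrier_vec n. \<exists>d \<in> {2, 3}. F $ i = mvar i + linear_form a ^ d)"

end

(* Start from a Keller map over the complex numbers without polynomial inverse. Its coefficients can be
   pushed down to the integers one generator at a time: a transcendental generator becomes a new
   variable, an algebraic one is removed by restriction of scalars, and denominators disappear by
   conjugating with a dilation. New variables then lower the degree to three.

   Let F = X + (higher terms) be the resulting integral map and c an integral vector. The curve
   F(w) = c y is etale over the y-line, and outside finitely many y it is proper. At an integral point
   of the curve the local branch w(y) is a power series with integer coefficients, since det DF = 1;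
   if y is large, the branch extends to a disc of radius larger than 1 by properness, so it is a
   polynomial. If w is moreover divisible by a large m, then this polynomial branch passes through the
   origin. A vector c for which the branch through the origin is not polynomial exists because F has
   no inverse, and then the curve has no nonzero integral point divisible by m.

   Finally F(mX)/m is, for 6 dividing m, the identity plus integral combinations of squares and cubes of
   integral linear forms, and the pairing of Druzkowski and Gorni-Zampieri turns it into a Keller map of
   quadratic-cubic linear form whose first coordinates vanish exactly along the curve above. *)

theory Submission
  imports "HOL-Complex_Analysis.Complex_Analysis" Defs
begin

text \<open>Over the integers a vanishing sum of squares forces every summand to vanish, so the
  hypothesis asks for a nonzero integral point on a curve: all components but the last are 0 and one
  coordinate stays free. A failure of the conjecture must therefore produce a curve without such
  points. Continuing a branch needs no covering theory or monodromy: on a bounded region the Taylor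
  coefficients of all branches obey one estimate, so the radius of convergence grows by a fixed
  amount as long as the values stay bounded. The direction c is found by density: the Taylor
  coefficients of the branch through the origin are polynomials in c, and algebraic relations
  between the coordinates and F bound the degree of all polynomial branches at once. The Jacobian
  condition is carried as an explicit inverse matrix because every reduction transforms that matrix
  by a formula. The determinant returns only at the end, where a unit among polynomials is a
  constant.\<close>

hide_const (open) Finite_Cartesian_Product.mat Finite_Cartesian_Product.vec Determinants.det
hide_type (open) Finite_Cartesian_Product.vec
unbundle no vec_syntax
no_notation fps_nth (infixl \<open>$\<close> 75)

abbreviation "lookup \<equiv> Poly_Mapping.lookup"
abbreviation "keys \<equiv> Poly_Mapping.keys"
abbreviation "single \<equiv> Poly_Mapping.single"

section \<open>Evaluation of polynomials\<close>

lemma poly_mapping_expand: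
  fixes p :: "'a \<Rightarrow>\<^sub>0 'b::comm_monoid_add"
  shows "p = (\<Sum>m\<in>keys p. single m (lookup p m))"
proof (rule poly_mapping_eqI)
  fix k
  show "lookup p k = lookup (\<Sum>m\<in>keys p. single m (lookup p m)) k"
    by (cases "k \<in> keys p")
      (auto simp: lookup_sum lookup_single when_def in_keys_iff sum.delta)
qed

lemma mpoly_single_induct [case_names single add]:
  fixes p :: "'a \<Rightarrow>\<^sub>0 'b::comm_monoid_add"
  assumes "\<And>m c. P (single m c)" and "\<And>p q. P p \<Longrightarrow> P q \<Longrightarrow> P (p + q)"
  shows "P p"
proof -
  have "P (\<Sum>m\<in>S. single m (lookup p m))" if "finite S" for S
    using that
  proof (induction S rule: finite_induct)
    case empty
    show ?case using assms(1)[of undefined 0] by simp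
  next
    case (insert x F)
    then show ?case using assms by simp
  qed
  then show ?thesis using poly_mapping_expand[of p] finite_keys by metis
qed

definition mmon :: "(nat \<Rightarrow> 'b) \<Rightarrow> (nat \<Rightarrow>\<^sub>0 nat) \<Rightarrow> 'b::comm_ring_1" where
  "mmon x m = (\<Prod>i\<in>keys m. x i ^ lookup m i)"

text \<open>The common form of evaluation, substitution, evaluation at power series or univariate
  polynomials, and change of coefficients, so that the homomorphism property is proved once.\<close>

definition mpoly_hom :: "('a::comm_ring_1 \<Rightarrow> 'b::comm_ring_1) \<Rightarrow> (nat \<Rightarrow> 'b) \<Rightarrow> 'a mpoly \<Rightarrow> 'b" where
  "mpoly_hom h x p = (\<Sum>m\<in>keys p. h (lookup p m) * mmon x m)"

lemma mpoly_eval_hom: "mpoly_eval x p = mpoly_hom (\<lambda>c. c) x p"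
  by (simp add: mpoly_eval_def mpoly_hom_def mmon_def)

lemma mpoly_subst_hom: "mpoly_subst G p = mpoly_hom mconst G p"
  by (simp add: mpoly_subst_def mpoly_hom_def mmon_def)

lemma mmon_superset:
  assumes "finite S" "keys m \<subseteq> S"
  shows "mmon x m = (\<Prod>i\<in>S. x i ^ lookup m i)"
  unfolding mmon_def using assms by (intro prod.mono_neutral_left) (auto simp: in_keys_iff)

lemma mmon_add: "mmon x (m + m') = mmon x m * mmon x m'"
proof -
  let ?S = "keys m \<union> keys m'"
  have "mmon x (m + m') = (\<Prod>i\<in>?S. x i ^ lookup (m + m') i)"
    by (rule mmon_superset) (use keys_add[of m m'] in auto)
  moreover have "mmon x m = (\<Prod>i\<in>?S. x i ^ lookup m i)"
    by (rule mmon_superset) auto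
  moreover have "mmon x m' = (\<Prod>i\<in>?S. x i ^ lookup m' i)"
    by (rule mmon_superset) auto
  ultimately show ?thesis
    by (simp add: lookup_add power_add prod.distrib)
qed

lemma mmon_zero [simp]: "mmon x 0 = 1"
  by (simp add: mmon_def)

lemma mmon_single [simp]: "mmon x (single i k) = x i ^ k"
  by (cases "k = 0") (simp_all add: mmon_def)

lemma mpoly_hom_superset:
  assumes "h 0 = 0" "finite S" "keys p \<subseteq> S"
  shows "mpoly_hom h x p = (\<Sum>m\<in>S. h (lookup p m) * mmon x m)"
  unfolding mpoly_hom_def using assms by (intro sum.mono_neutral_left) (auto simp: in_keys_iff)

lemma mpoly_hom_single:
  assumes "h 0 = 0" shows "mpoly_hom h x (single m c) = h c * mmon x m"
  by (cases "c = 0") (simp_all add: mpoly_hom_def assms)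

lemma comm_ring_hom_mpoly_hom:
  assumes "comm_ring_hom h"
  shows "comm_ring_hom (mpoly_hom h x)"
proof -
  interpret h: comm_ring_hom h by fact
  have madd: "mpoly_hom h x (p + q) = mpoly_hom h x p + mpoly_hom h x q" for p q
  proof -
    let ?S = "keys p \<union> keys q"
    have "mpoly_hom h x (p + q) = (\<Sum>m\<in>?S. h (lookup (p + q) m) * mmon x m)"
      by (rule mpoly_hom_superset) (use keys_add[of p q] in auto)
    moreover have "mpoly_hom h x p = (\<Sum>m\<in>?S. h (lookup p m) * mmon x m)"
      by (rule mpoly_hom_superset) auto
    moreover have "mpoly_hom h x q = (\<Sum>m\<in>?S. h (lookup q m) * mmon x m)"
      by (rule mpoly_hom_superset) auto
    ultimately show ?thesis
      by (simp add: lookup_add h.hom_add distrib_right sum.distrib)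
  qed
  have mult: "mpoly_hom h x (p * q) = mpoly_hom h x p * mpoly_hom h x q" for p q
  proof (induction p rule: mpoly_single_induct)
    case (single m c)
    show ?case
    proof (induction q rule: mpoly_single_induct)
      case (single m' c')
      show ?case
        by (simp add: mult_single mpoly_hom_single mmon_add h.hom_mult)
    next
      case (add p q)
      then show ?case by (simp add: distrib_left madd)
    qed
  next
    case (add p q)
    then show ?case by (simp add: distrib_right madd)
  qed
  have "mpoly_hom h x 1 = 1"
    using mpoly_hom_single[of h x 0 1] by simp
  moreover have "mpoly_hom h x 0 = 0" by (simp add: mpoly_hom_def)
  ultimately show ?thesis
    by unfold_locales (auto simp: madd mult)
qed

lemma mpoly_hom_mconst: "h 0 = 0 \<Longrightarrow> mpoly_hom h x (mconst c) = h c"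
  by (simp add: mconst_def mpoly_hom_single)

lemma mpoly_hom_mvar: "comm_ring_hom h \<Longrightarrow> mpoly_hom h x (mvar i) = x i"
proof -
  assume "comm_ring_hom h"
  then interpret comm_ring_hom h .
  show ?thesis by (simp add: mvar_def mpoly_hom_single)
qed

lemma mconst_hom: "comm_ring_hom mconst"
  by unfold_locales
    (auto simp: mconst_def single_add mult_single simp flip: single_one)

lemma id_ring_hom: "comm_ring_hom (\<lambda>c::'a::comm_ring_1. c)"
  by unfold_locales auto

global_interpretation mconst: comm_ring_hom mconst by (rule mconst_hom)

global_interpretation eval: comm_ring_hom "mpoly_eval x" for x
  using comm_ring_hom_mpoly_hom[OF id_ring_hom, of x] by (simp add: mpoly_eval_hom[abs_def])

global_interpretation subst: comm_ring_hom "mpoly_subst G" for G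
  using comm_ring_hom_mpoly_hom[OF mconst_hom, of G] by (simp add: mpoly_subst_hom[abs_def])

lemma eval_mconst [simp]: "mpoly_eval x (mconst c) = c"
  by (simp add: mpoly_eval_hom mpoly_hom_mconst)

lemma eval_mvar [simp]: "mpoly_eval x (mvar i) = x i"
  by (simp add: mpoly_eval_hom mpoly_hom_mvar id_ring_hom)

lemma subst_mconst [simp]: "mpoly_subst G (mconst c) = mconst c"
  by (simp add: mpoly_subst_hom mpoly_hom_mconst)

lemma subst_mvar [simp]: "mpoly_subst G (mvar i) = G i"
  by (simp add: mpoly_subst_hom mpoly_hom_mvar mconst_hom)

lemma mmon_mvar_single: "mconst c * mmon mvar m = single m c"
proof -
  have "mmon mvar m = (single m 1 :: 'a mpoly)"
  proof -
    have pw: "mvar i ^ k = (single (single i k) 1 :: 'a mpoly)" for i k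
    proof (induction k)
      case (Suc k)
      have "single i (Suc k) = single i 1 + single i k"
        by (simp flip: single_add)
      with Suc show ?case by (simp add: mvar_def mult_single)
    qed simp
    have pr: "(\<Prod>i\<in>S. single (f i) 1) = (single (sum f S) 1 :: 'a mpoly)"
      if "finite S" for S and f :: "nat \<Rightarrow> nat \<Rightarrow>\<^sub>0 nat"
      using that by (induction S rule: finite_induct) (auto simp: mult_single)
    show ?thesis
      unfolding mmon_def pw
      by (subst pr) (simp_all flip: poly_mapping_expand)
  qed
  then show ?thesis by (simp add: mconst_def mult_single)
qed

subsection \<open>Polynomials over a subring\<close>

text \<open>Coefficients are confined to a subset \<open>A\<close> rather than to a type, because
  \<open>A\<close> varies along a tower of subrings of the complex numbers. The inductive form
  supplies structural induction; \<open>poly_over_iff\<close> gives the coefficientwise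
  description.\<close>

inductive_set poly_over :: "'a::comm_ring_1 set \<Rightarrow> nat \<Rightarrow> 'a mpoly set" for A n where
  const: "c \<in> A \<Longrightarrow> mconst c \<in> poly_over A n"
| var: "i < n \<Longrightarrow> mvar i \<in> poly_over A n"
| add: "p \<in> poly_over A n \<Longrightarrow> q \<in> poly_over A n \<Longrightarrow> p + q \<in> poly_over A n"
| mult: "p \<in> poly_over A n \<Longrightarrow> q \<in> poly_over A n \<Longrightarrow> p * q \<in> poly_over A n"

locale subring =
  fixes A :: "'a::comm_ring_1 set"
  assumes one_closed: "1 \<in> A"
    and diff_closed: "x \<in> A \<Longrightarrow> y \<in> A \<Longrightarrow> x - y \<in> A"
    and mult_closed: "x \<in> A \<Longrightarrow> y \<in> A \<Longrightarrow> x * y \<in> A"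
begin

lemma zero_closed: "0 \<in> A"
  using diff_closed[OF one_closed one_closed] by simp

lemma uminus_closed: "x \<in> A \<Longrightarrow> - x \<in> A"
  using diff_closed[OF zero_closed] by simp

lemma add_closed: "x \<in> A \<Longrightarrow> y \<in> A \<Longrightarrow> x + y \<in> A"
  using diff_closed[OF _ uminus_closed] by fastforce

lemma sum_closed: "(\<And>i. i \<in> S \<Longrightarrow> f i \<in> A) \<Longrightarrow> sum f S \<in> A"
  by (induction S rule: infinite_finite_induct) (auto intro: zero_closed add_closed)

lemma prod_closed: "(\<And>i. i \<in> S \<Longrightarrow> f i \<in> A) \<Longrightarrow> prod f S \<in> A"
  by (induction S rule: infinite_finite_induct) (auto intro: one_closed mult_closed)

lemma power_closed: "x \<in> A \<Longrightarrow> x ^ k \<in> A"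
  by (induction k) (auto intro: one_closed mult_closed)

lemma of_nat_closed: "of_nat k \<in> A"
  by (induction k) (auto intro: zero_closed one_closed add_closed)

lemmas closed = zero_closed one_closed uminus_closed add_closed diff_closed mult_closed
  sum_closed prod_closed power_closed of_nat_closed

end

lemma (in subring) subring_poly_over: "subring (poly_over A n)"
proof
  show "1 \<in> poly_over A n"
    using poly_over.const[OF one_closed, of n] by simp
next
  fix x y assume "x \<in> poly_over A n" "y \<in> poly_over A n"
  moreover have "mconst (- 1) \<in> poly_over A n"
    by (intro poly_over.const closed)
  ultimately have "x + mconst (- 1) * y \<in> poly_over A n"
    by (intro poly_over.add poly_over.mult)
  then show "x - y \<in> poly_over A n" by (simp add: mconst.hom_uminus)
qed (rule poly_over.mult)

lemma subring_UNIV: "subring UNIV"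
  by unfold_locales auto

lemma subring_Ints: "subring \<int>"
  by unfold_locales auto

lemma poly_over_mono: "p \<in> poly_over A n \<Longrightarrow> A \<subseteq> B \<Longrightarrow> n \<le> k \<Longrightarrow> p \<in> poly_over B k"
  by (induction rule: poly_over.induct) (auto intro: poly_over.intros)

lemma poly_over_UNIV: "p \<in> poly_over A n \<Longrightarrow> p \<in> poly_over UNIV n"
  by (erule poly_over_mono) auto

lemma single_in_poly_over:
  assumes "subring A" "c \<in> A" "keys m \<subseteq> {..<n}"
  shows "single m c \<in> poly_over A n"
proof -
  interpret A: subring A by fact
  interpret P: subring "poly_over A n" by (rule A.subring_poly_over)
  have "mconst c * mmon mvar m \<in> poly_over A n"
    unfolding mmon_def using assms by (intro P.closed poly_over.intros) auto
  then show ?thesis by (simp add: mmon_mvar_single)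
qed

lemma poly_over_coeff:
  assumes "subring A" "p \<in> poly_over A n"
  shows "lookup p m \<in> A"
proof -
  interpret A: subring A by fact
  show ?thesis using assms(2)
  proof (induction arbitrary: m rule: poly_over.induct)
    case (mult p q)
    have "lookup (p * q) m = lookup
        (\<Sum>a\<in>keys p. \<Sum>b\<in>keys q.
          single (a + b) (lookup p a * lookup q b)) m"
      by (subst poly_mapping_expand[of p], subst poly_mapping_expand[of q])
        (simp only: sum_product mult_single)
    also have "\<dots> \<in> A"
      unfolding lookup_sum lookup_single when_def
      by (intro A.sum_closed) (auto intro: A.closed mult)
    finally show ?case .
  qed (auto simp: mconst_def mvar_def lookup_single lookup_add when_def intro: A.closed)
qed

lemma polys_intros:
  "mconst c \<in> polys n" "i < n \<Longrightarrow> mvar i \<in> polys n"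
  "p \<in> polys n \<Longrightarrow> q \<in> polys n \<Longrightarrow> p + q \<in> polys n"
  "p \<in> polys n \<Longrightarrow> q \<in> polys n \<Longrightarrow> p * q \<in> polys n"
proof -
  show "mconst c \<in> polys n" by (auto simp: polys_def mconst_def)
  show "i < n \<Longrightarrow> mvar i \<in> polys n" by (auto simp: polys_def mvar_def)
  show "p \<in> polys n \<Longrightarrow> q \<in> polys n \<Longrightarrow> p + q \<in> polys n"
    using keys_add[of p q] by (fastforce simp: polys_def)
  show "p \<in> polys n \<Longrightarrow> q \<in> polys n \<Longrightarrow> p * q \<in> polys n"
  proof (simp only: polys_def mem_Collect_eq, intro ballI)
    fix m assume *: "\<forall>m\<in>keys p. keys m \<subseteq> {..<n}"
      "\<forall>m\<in>keys q. keys m \<subseteq> {..<n}" "m \<in> keys (p * q)"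
    then obtain a b where "m = a + b" "a \<in> keys p" "b \<in> keys q"
      using keys_mult[of p q] by blast
    with * show "keys m \<subseteq> {..<n}"
      using keys_add[of a b] by blast
  qed
qed

lemma poly_over_iff:
  assumes "subring A"
  shows "p \<in> poly_over A n \<longleftrightarrow> p \<in> polys n \<and> (\<forall>m. lookup p m \<in> A)"
proof
  assume p: "p \<in> poly_over A n"
  have "p \<in> polys n" using p
    by (induction rule: poly_over.induct) (auto intro: polys_intros)
  then show "p \<in> polys n \<and> (\<forall>m. lookup p m \<in> A)"
    using poly_over_coeff[OF assms p] by blast
next
  assume p: "p \<in> polys n \<and> (\<forall>m. lookup p m \<in> A)"
  interpret A: subring A by fact
  interpret P: subring "poly_over A n" by (rule A.subring_poly_over)
  show "p \<in> poly_over A n"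
    using p by (subst poly_mapping_expand[of p])
      (auto intro!: P.sum_closed single_in_poly_over assms simp: polys_def)
qed

lemma polys_eq_poly_over: "polys n = poly_over UNIV n"
  using poly_over_iff[OF subring_UNIV] by blast

interpretation PU: subring "poly_over UNIV n" for n
  using subring.subring_poly_over[OF subring_UNIV] .

lemma mpoly_hom_cong:
  assumes "p \<in> poly_over A n" "\<And>i. i < n \<Longrightarrow> x i = y i" "comm_ring_hom h"
  shows "mpoly_hom h x p = mpoly_hom h y p"
proof -
  interpret h: comm_ring_hom h by fact
  interpret X: comm_ring_hom "mpoly_hom h x" by (rule comm_ring_hom_mpoly_hom) fact
  interpret Y: comm_ring_hom "mpoly_hom h y" by (rule comm_ring_hom_mpoly_hom) fact
  show ?thesis using assms(1)
    by (induction rule: poly_over.induct)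
      (auto simp: X.hom_add Y.hom_add X.hom_mult Y.hom_mult mpoly_hom_mconst mpoly_hom_mvar assms)
qed

lemma eval_cong:
  "p \<in> poly_over A n \<Longrightarrow> (\<And>i. i < n \<Longrightarrow> x i = y i) \<Longrightarrow> mpoly_eval x p = mpoly_eval y p"
  unfolding mpoly_eval_hom by (rule mpoly_hom_cong) (auto intro: id_ring_hom)

lemma subst_cong:
  "p \<in> poly_over A n \<Longrightarrow> (\<And>i. i < n \<Longrightarrow> x i = y i) \<Longrightarrow> mpoly_subst x p = mpoly_subst y p"
  unfolding mpoly_subst_hom by (rule mpoly_hom_cong) (auto intro: mconst_hom)

lemma subst_closed:
  assumes "p \<in> poly_over A n" "\<And>i. i < n \<Longrightarrow> G i \<in> poly_over A k"
  shows "mpoly_subst G p \<in> poly_over A k"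
  using assms(1) by (induction rule: poly_over.induct)
    (auto simp: subst.hom_add subst.hom_mult intro: poly_over.intros assms(2))

lemma eval_closed:
  assumes "subring A" "p \<in> poly_over A n" "\<And>i. i < n \<Longrightarrow> x i \<in> A"
  shows "mpoly_eval x p \<in> A"
proof -
  interpret subring A by fact
  show ?thesis using assms(2) by (induction rule: poly_over.induct)
    (auto simp: eval.hom_add eval.hom_mult intro: closed assms(3))
qed

lemma hom_eq_on_poly_over:
  assumes "comm_ring_hom f" "comm_ring_hom g" "p \<in> poly_over A n"
    and "\<And>c. c \<in> A \<Longrightarrow> f (mconst c) = g (mconst c)" "\<And>i. i < n \<Longrightarrow> f (mvar i) = g (mvar i)"
  shows "f p = g p"
proof -
  interpret f: comm_ring_hom f by fact
  interpret g: comm_ring_hom g by fact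
  show ?thesis using assms(3) by (induction rule: poly_over.induct)
    (auto simp: f.hom_add f.hom_mult g.hom_add g.hom_mult assms(4,5))
qed

lemma eval_subst:
  "mpoly_eval x (mpoly_subst G p) = mpoly_eval (\<lambda>i. mpoly_eval x (G i)) p"
  by (induction p rule: mpoly_single_induct)
    (simp_all add: eval.hom_add subst.hom_add mmon_def eval.hom_mult eval.hom_prod eval.hom_power
      subst.hom_mult subst.hom_prod subst.hom_power flip: mmon_mvar_single)

lemma subst_mvar_id:
  "p \<in> poly_over A n \<Longrightarrow> (\<And>i. i < n \<Longrightarrow> G i = mvar i) \<Longrightarrow> mpoly_subst G p = p"
  by (induction rule: poly_over.induct) (auto simp: subst.hom_add subst.hom_mult)

subsection \<open>Partial derivatives\<close>

lemma mpderiv_superset: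
  assumes "finite S" "keys p \<subseteq> S"
  shows "mpderiv i p = (\<Sum>m\<in>S. single (m - single i 1)
       (of_nat (lookup m i) * lookup p m))"
  unfolding mpderiv_def using assms by (intro sum.mono_neutral_left) (auto simp: in_keys_iff)

lemma mpderiv_single:
  "mpderiv i (single m c) =
    single (m - single i 1) (of_nat (lookup m i) * c)"
  by (subst mpderiv_superset[where S = "{m}"]) auto

lemma mpderiv_zero [simp]: "mpderiv i 0 = 0"
  by (simp add: mpderiv_def)

lemma mpderiv_mconst [simp]: "mpderiv i (mconst c) = 0"
  by (simp add: mconst_def mpderiv_single)

lemma mpderiv_mvar [simp]: "mpderiv i (mvar j) = (if i = j then 1 else 0)"
  by (auto simp: mvar_def mpderiv_single lookup_single when_def)

lemma mpderiv_one [simp]: "mpderiv i 1 = 0"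
  using mpderiv_mconst[of i 1] by simp

lemma mpderiv_add: "mpderiv i (p + q) = mpderiv i p + mpderiv i q"
proof -
  let ?S = "keys p \<union> keys q"
  have "keys (p + q) \<subseteq> ?S" by (rule keys_add)
  then show ?thesis
    by (subst (1 2 3) mpderiv_superset[where S = ?S])
      (auto simp: lookup_add distrib_left single_add sum.distrib)
qed

lemma single_minus_add:
  fixes m m' :: "nat \<Rightarrow>\<^sub>0 nat"
  assumes "lookup m i \<noteq> 0"
  shows "m + m' - single i 1 = (m - single i 1) + m'"
  using assms by (intro poly_mapping_eqI) (auto simp: lookup_add lookup_minus lookup_single when_def)

lemma mpderiv_mult: "mpderiv i (p * q) = mpderiv i p * q + p * mpderiv i q"
proof (induction p rule: mpoly_single_induct)
  case (single m c)
  show ?case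
  proof (induction q rule: mpoly_single_induct)
    case (single m' c')
    \<comment> \<open>\<open>single_minus_add\<close> needs a positive exponent. At exponent 0 the
      truncated subtraction spoils the monomial, but then both sides have coefficient 0.\<close>
    have 1: "single (m + m' - single i 1) (of_nat (lookup m i) * (c * c'))
      = single (m - single i 1 + m') (of_nat (lookup m i) * (c * c'))"
      using single_minus_add[of m i m'] by (cases "lookup m i = 0") auto
    have 2: "single (m + m' - single i 1) (of_nat (lookup m' i) * (c * c'))
      = single (m + (m' - single i 1)) (of_nat (lookup m' i) * (c * c'))"
      using single_minus_add[of m' i m] by (cases "lookup m' i = 0") (auto simp: add.commute)
    show ?case
      using 1 2 by (simp add: mult_single mpderiv_single lookup_add distrib_right single_add
          mult.assoc mult.left_commute[of c "of_nat (lookup m' i)"])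
  next
    case (add p q)
    then show ?case by (simp add: distrib_left mpderiv_add)
  qed
next
  case (add p q)
  then show ?case by (simp add: distrib_right mpderiv_add)
qed

lemma mpderiv_mconst_mult [simp]: "mpderiv i (mconst c * p) = mconst c * mpderiv i p"
  by (simp add: mpderiv_mult)

lemma mpderiv_uminus: "mpderiv i (- p) = - mpderiv i p"
  using mpderiv_add[of i p "- p"] by (simp add: eq_neg_iff_add_eq_0 add.commute)

lemma mpderiv_diff: "mpderiv i (p - q) = mpderiv i p - mpderiv i q"
  using mpderiv_add[of i p "- q"] by (simp add: mpderiv_uminus)

lemma mpderiv_sum: "mpderiv i (sum f S) = (\<Sum>s\<in>S. mpderiv i (f s))"
  by (induction S rule: infinite_finite_induct) (auto simp: mpderiv_add)

lemma mpderiv_power: "mpderiv i (p ^ Suc k) = of_nat (Suc k) * p ^ k * mpderiv i p"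
  by (induction k) (auto simp: mpderiv_mult algebra_simps)

lemma mpderiv_closed:
  assumes "subring A" "p \<in> poly_over A n"
  shows "mpderiv i p \<in> poly_over A n"
proof -
  interpret A: subring A by fact
  interpret P: subring "poly_over A n" by (rule A.subring_poly_over)
  show ?thesis using assms(2)
    by (induction rule: poly_over.induct) (auto simp: mpderiv_add mpderiv_mult intro: P.closed)
qed

lemma mpderiv_outside: "p \<in> poly_over A n \<Longrightarrow> n \<le> i \<Longrightarrow> mpderiv i p = 0"
  by (induction rule: poly_over.induct) (auto simp: mpderiv_add mpderiv_mult)

lemma mpderiv_subst:
  assumes "p \<in> poly_over A n"
  shows "mpderiv i (mpoly_subst G p) = (\<Sum>j<n. mpoly_subst G (mpderiv j p) * mpderiv i (G j))"
  using assms
proof (induction rule: poly_over.induct)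
  case (var k)
  have "(\<Sum>j<n. mpoly_subst G (mpderiv j (mvar k)) * mpderiv i (G j))
    = (\<Sum>j<n. if j = k then mpderiv i (G j) else 0)"
    by (intro sum.cong) auto
  with var show ?case by simp
qed (auto simp: mpderiv_add mpderiv_mult subst.hom_add subst.hom_mult sum.distrib
    sum_distrib_left sum_distrib_right algebra_simps)

subsection \<open>Zeros\<close>

lemma digits_unique:
  fixes a b :: "nat \<Rightarrow> nat"
  assumes "\<And>i. i < n \<Longrightarrow> a i < D" "\<And>i. i < n \<Longrightarrow> b i < D"
    and "(\<Sum>i<n. a i * D ^ i) = (\<Sum>i<n. b i * D ^ i)" "i < n"
  shows "a i = b i"
  using assms
proof (induction n arbitrary: a b i)
  case (Suc n)
  have D: "D > 0" using Suc.prems(1)[of 0] by simp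
  have split: "(\<Sum>i<Suc n. c i * D ^ i) = c 0 + D * (\<Sum>i<n. c (Suc i) * D ^ i)" for c :: "nat \<Rightarrow> nat"
    by (subst sum.lessThan_Suc_shift) (simp add: sum_distrib_left mult_ac)
  have eq: "a 0 + D * (\<Sum>i<n. a (Suc i) * D ^ i) = b 0 + D * (\<Sum>i<n. b (Suc i) * D ^ i)"
    using Suc.prems(3) by (simp only: split)
  have 0: "a 0 = b 0"
    using arg_cong[OF eq, of "\<lambda>x. x mod D"] Suc.prems(1,2)[of 0] by simp
  with eq D have "(\<Sum>i<n. a (Suc i) * D ^ i) = (\<Sum>i<n. b (Suc i) * D ^ i)" by simp
  then have "a (Suc k) = b (Suc k)" if "k < n" for k
    using Suc.IH[of "\<lambda>i. a (Suc i)" "\<lambda>i. b (Suc i)" k] Suc.prems(1,2) that by auto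
  with 0 Suc.prems(4) show ?case by (cases i) auto
qed simp

text \<open>Kronecker substitution: \<open>x\<^sub>i = t ^ (D ^ i)\<close> separates the monomials.\<close>

lemma mpoly_nonzero_eval:
  fixes p :: "complex mpoly"
  assumes "p \<in> poly_over UNIV n" "p \<noteq> 0"
  obtains x where "\<And>i. x i \<in> \<int>" "mpoly_eval x p \<noteq> 0"
proof -
  have kn: "keys m \<subseteq> {..<n}" if "m \<in> keys p" for m
    using assms(1) that poly_over_iff[OF subring_UNIV] by (auto simp: polys_def)
  have "finite ((\<lambda>(m, i). lookup m i) ` (keys p \<times> {..<n}))"
    by simp
  then obtain D where D: "\<And>m i. m \<in> keys p \<Longrightarrow> i < n \<Longrightarrow> lookup m i < D"
    unfolding finite_nat_set_iff_bounded by blast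
  define w where "w m = (\<Sum>i<n. lookup m i * D ^ i)" for m :: "nat \<Rightarrow>\<^sub>0 nat"
  have inj: "inj_on w (keys p)"
  proof (rule inj_onI, rule poly_mapping_eqI)
    fix m m' i assume *: "m \<in> keys p" "m' \<in> keys p" "w m = w m'"
    show "lookup m i = lookup m' i"
    proof (cases "i < n")
      case True
      then show ?thesis
        using digits_unique[of n "lookup m" D "lookup m'" i] D * by (auto simp: w_def)
    next
      case False
      then show ?thesis using kn[OF *(1)] kn[OF *(2)] by (metis in_keys_iff lessThan_iff subset_iff)
    qed
  qed
  \<comment> \<open>\<open>u\<close> is \<open>p\<close> after the substitution; by
    \<open>inj\<close> distinct monomials do not merge, so \<open>u\<close> is nonzero.\<close>
  define u where "u = (\<Sum>m\<in>keys p. monom (lookup p m) (w m))"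
  obtain m0 where m0: "m0 \<in> keys p" 
    using assms(2) poly_mapping_eqI[of p 0] by (auto simp: in_keys_iff)
  have "coeff u (w m0) = (\<Sum>m\<in>keys p. if m = m0 then lookup p m0 else 0)"
    unfolding u_def coeff_sum using inj m0 by (intro sum.cong) (auto simp: inj_on_def)
  also have "\<dots> \<noteq> 0" using m0 by (simp add: in_keys_iff)
  finally have "u \<noteq> 0" by auto
  then have "finite {z. poly u z = 0}" by (rule poly_roots_finite)
  \<comment> \<open>Some natural number is not a root of \<open>u\<close>, and a natural
    \<open>t\<close> makes all coordinates integral.\<close>
  moreover have "infinite (range (of_nat :: nat \<Rightarrow> complex))"
    by (simp add: range_inj_infinite inj_on_def)
  ultimately obtain t :: nat where t: "poly u (of_nat t) \<noteq> 0"
    by (metis (mono_tags, lifting) finite_subset image_subset_iff mem_Collect_eq)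
  define x :: "nat \<Rightarrow> complex" where "x i = of_nat t ^ (D ^ i)" for i
  have "mmon x m = of_nat t ^ w m" if "m \<in> keys p" for m
    unfolding w_def x_def
    by (subst mmon_superset[OF _ kn[OF that]])
      (simp_all add: power_sum mult.commute flip: power_mult)
  then have "mpoly_eval x p = poly u (of_nat t)"
    by (simp add: mpoly_eval_hom mpoly_hom_def u_def poly_sum poly_monom)
  moreover have "x i \<in> \<int>" for i by (simp add: x_def)
  ultimately show ?thesis using t that by metis
qed

text \<open>Integral points are Zariski dense. Restricting the test to them matters later, when only
  integral directions \<open>c\<close> are available.\<close>

lemma mpoly_eqI_eval:
  fixes p q :: "complex mpoly"
  assumes "p \<in> poly_over UNIV n" "q \<in> poly_over UNIV n"
    and "\<And>x. (\<And>i. x i \<in> \<int>) \<Longrightarrow> mpoly_eval x p = mpoly_eval x q"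
  shows "p = q"
proof (rule ccontr)
  assume "p \<noteq> q"
  then obtain x where "\<And>i. x i \<in> \<int>" "mpoly_eval x (p - q) \<noteq> 0"
    using mpoly_nonzero_eval[OF PU.diff_closed[OF assms(1,2)]] by auto
  with assms(3) show False by (simp add: eval.hom_minus)
qed


section \<open>Keller maps with an explicit inverse Jacobian\<close>

text \<open>An inverse \<open>N\<close> of the Jacobian matrix stands for the condition on its determinant, to which it
  is equivalent up to a constant.\<close>

definition keller_over :: "complex set \<Rightarrow> nat \<Rightarrow> (nat \<Rightarrow> complex mpoly) \<Rightarrow> (nat \<Rightarrow> nat \<Rightarrow> complex mpoly) \<Rightarrow> bool" where
  "keller_over A n F N \<longleftrightarrow> (\<forall>i<n. F i \<in> poly_over A n) \<and> (\<forall>j<n. \<forall>l<n. N j l \<in> poly_over A n) \<and>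
     (\<forall>i<n. \<forall>l<n. (\<Sum>j<n. mpderiv j (F i) * N j l) = (if i = l then 1 else 0))"

text \<open>A one-sided inverse, tested at points, is easy to transport through the reductions;
  \<open>right_invertible_left_inverse\<close> recovers the other side.\<close>

definition right_invertible :: "nat \<Rightarrow> (nat \<Rightarrow> complex mpoly) \<Rightarrow> bool" where
  "right_invertible n F \<longleftrightarrow> (\<exists>G. (\<forall>j<n. G j \<in> poly_over UNIV n) \<and>
     (\<forall>y. \<forall>i<n. mpoly_eval (\<lambda>j. mpoly_eval y (G j)) (F i) = y i))"

text \<open>The inverse excluded here may have complex coefficients whatever \<open>A\<close> is.\<close>

definition counterexample_over :: "complex set \<Rightarrow> bool" where
  "counterexample_over A \<longleftrightarrow> (\<exists>n F N. keller_over A n F N \<and> \<not> right_invertible n F)"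

definition normalized :: "nat \<Rightarrow> (nat \<Rightarrow> complex mpoly) \<Rightarrow> bool" where
  "normalized n F \<longleftrightarrow> (\<forall>i<n. mpoly_eval (\<lambda>_. 0) (F i) = 0 \<and>
     (\<forall>j<n. mpoly_eval (\<lambda>_. 0) (mpderiv j (F i)) = (if i = j then 1 else 0)))"

lemma keller_overD:
  assumes "keller_over A n F N"
  shows "i < n \<Longrightarrow> F i \<in> poly_over A n" "j < n \<Longrightarrow> l < n \<Longrightarrow> N j l \<in> poly_over A n"
    "i < n \<Longrightarrow> l < n \<Longrightarrow> (\<Sum>j<n. mpderiv j (F i) * N j l) = (if i = l then 1 else 0)"
  using assms by (auto simp: keller_over_def)

lemma left_inverse_sums:
  fixes a b :: "nat \<Rightarrow> nat \<Rightarrow> complex"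
  assumes "\<And>i l. i < n \<Longrightarrow> l < n \<Longrightarrow> (\<Sum>j<n. a i j * b j l) = (if i = l then 1 else 0)"
    and "i < n" "l < n"
  shows "(\<Sum>j<n. b i j * a j l) = (if i = l then 1 else 0)"
proof -
  define MA where "MA = mat n n (\<lambda>(i, j). a i j)"
  define MB where "MB = mat n n (\<lambda>(i, j). b i j)"
  have c: "MA \<in> carrier_mat n n" "MB \<in> carrier_mat n n" by (auto simp: MA_def MB_def)
  have "MA * MB = 1\<^sub>m n"
    by (rule eq_matI) (use assms(1) in \<open>auto simp: MA_def MB_def scalar_prod_def lessThan_atLeast0\<close>)
  then have "MB * MA = 1\<^sub>m n" by (rule mat_mult_left_right_inverse[OF c])
  then have "(MB * MA) $$ (i, l) = 1\<^sub>m n $$ (i, l)" by simp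
  with assms(2,3) show ?thesis
    by (simp add: MA_def MB_def scalar_prod_def lessThan_atLeast0)
qed

lemma eval_kronecker [simp]: "mpoly_eval w (if P then 1 else 0) = (if P then 1 else 0)"
  by simp

text \<open>At a point the Jacobian is a square matrix over a field, where a right inverse is also a
  left inverse; hence the formulation for values.\<close>

lemma keller_over_left_inverse:
  assumes "keller_over A n F N" "i < n" "l < n"
  shows "(\<Sum>j<n. mpoly_eval w (N i j) * mpoly_eval w (mpderiv l (F j))) = (if i = l then 1 else 0)"
proof (rule left_inverse_sums[where a = "\<lambda>i j. mpoly_eval w (mpderiv j (F i))"
      and b = "\<lambda>i j. mpoly_eval w (N i j)"])
  fix i l assume "i < n" "l < n"
  then show "(\<Sum>j<n. mpoly_eval w (mpderiv j (F i)) * mpoly_eval w (N j l)) = (if i = l then 1 else 0)"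
    using arg_cong[OF keller_overD(3)[OF assms(1), of i l], of "mpoly_eval w"]
    by (simp only: eval.hom_sum eval.hom_mult eval_kronecker lessThan_iff)
qed (use assms in auto)

lemma sum_delta_swap:
  fixes g :: "nat \<Rightarrow> 'a::comm_ring_1"
  assumes "l < n"
  shows "(\<Sum>p<n. (if i = p then 1 else 0) * g p) = (if i < n then g i else 0)"
    "(\<Sum>p<n. g p * (if p = l then 1 else 0)) = g l"
    "(\<Sum>p<n. g p * (if l = p then 1 else 0)) = g l"
    "(\<Sum>p<n. (if p = l then 1 else 0) * g p) = g l"
  using assms by (simp_all add: if_distrib if_distribR sum.delta cong: if_cong)

lemma sum_product_middle:
  fixes a :: "nat \<Rightarrow> 'a::comm_ring_1"
  shows "(\<Sum>j\<in>J. (\<Sum>q\<in>Q. a q * d q j) * (\<Sum>p\<in>R. b j p * c p))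
    = (\<Sum>q\<in>Q. \<Sum>p\<in>R. a q * (\<Sum>j\<in>J. d q j * b j p) * c p)"
proof -
  have "(\<Sum>j\<in>J. (\<Sum>q\<in>Q. a q * d q j) * (\<Sum>p\<in>R. b j p * c p))
    = (\<Sum>j\<in>J. \<Sum>q\<in>Q. \<Sum>p\<in>R. a q * d q j * (b j p * c p))"
    by (simp only: sum_product)
  also have "\<dots> = (\<Sum>q\<in>Q. \<Sum>j\<in>J. \<Sum>p\<in>R. a q * d q j * (b j p * c p))"
    by (rule sum.swap)
  also have "\<dots> = (\<Sum>q\<in>Q. \<Sum>p\<in>R. \<Sum>j\<in>J. a q * d q j * (b j p * c p))"
    by (intro sum.cong refl) (rule sum.swap)
  also have "\<dots> = (\<Sum>q\<in>Q. \<Sum>p\<in>R. a q * (\<Sum>j\<in>J. d q j * b j p) * c p)"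
    by (simp add: sum_distrib_left sum_distrib_right mult_ac)
  finally show ?thesis .
qed

section \<open>Total degree\<close>

definition tdeg_le :: "nat \<Rightarrow> 'a::comm_ring_1 mpoly \<Rightarrow> bool" where
  "tdeg_le d p \<longleftrightarrow> (\<forall>m\<in>keys p. sum (lookup m) (keys m) \<le> d)"

abbreviation mdeg :: "(nat \<Rightarrow>\<^sub>0 nat) \<Rightarrow> nat" where
  "mdeg m \<equiv> sum (lookup m) (keys m)"

lemma mdeg_superset: "finite S \<Longrightarrow> keys m \<subseteq> S \<Longrightarrow> mdeg m = sum (lookup m) S"
  by (intro sum.mono_neutral_left) (auto simp: in_keys_iff)

lemma mdeg_add: "mdeg (m + m') = mdeg m + mdeg m'"
proof -
  let ?S = "keys m \<union> keys m'"
  have "mdeg (m + m') = sum (lookup (m + m')) ?S"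
    by (rule mdeg_superset) (use keys_add[of m m'] in auto)
  moreover have "mdeg m = sum (lookup m) ?S" "mdeg m' = sum (lookup m') ?S"
    by (rule mdeg_superset; auto)+
  ultimately show ?thesis by (simp add: lookup_add sum.distrib)
qed

lemma mdeg_single [simp]: "mdeg (single i k) = k"
  by (cases "k = 0") auto

lemma tdeg_le_mono: "tdeg_le d p \<Longrightarrow> d \<le> e \<Longrightarrow> tdeg_le e p"
  by (auto simp: tdeg_le_def)

lemma tdeg_le_exists: "\<exists>d. tdeg_le d p"
proof -
  have "finite (mdeg ` keys p)" by simp
  then show ?thesis unfolding finite_nat_set_iff_bounded_le tdeg_le_def by blast
qed

lemma tdeg_le_add: "tdeg_le d p \<Longrightarrow> tdeg_le d q \<Longrightarrow> tdeg_le d (p + q)"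
  using keys_add[of p q] by (auto simp: tdeg_le_def)

lemma tdeg_le_mult: "tdeg_le d p \<Longrightarrow> tdeg_le e q \<Longrightarrow> tdeg_le (d + e) (p * q)"
  unfolding tdeg_le_def
proof
  fix m assume *: "\<forall>m\<in>keys p. mdeg m \<le> d" "\<forall>m\<in>keys q. mdeg m \<le> e"
    "m \<in> keys (p * q)"
  then obtain a b where "m = a + b" "a \<in> keys p" "b \<in> keys q"
    using keys_mult[of p q] by blast
  with * show "mdeg m \<le> d + e" by (auto simp: mdeg_add intro: add_mono)
qed

lemma tdeg_le_uminus: "tdeg_le d p \<Longrightarrow> tdeg_le d (- p)"
  by (simp add: tdeg_le_def in_keys_iff)

lemma tdeg_le_diff: "tdeg_le d p \<Longrightarrow> tdeg_le d q \<Longrightarrow> tdeg_le d (p - q)"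
  using tdeg_le_add[of d p "- q"] tdeg_le_uminus by auto

lemma tdeg_le_mconst [simp]: "tdeg_le d (mconst c)"
  by (auto simp: tdeg_le_def mconst_def)

lemma tdeg_le_cmult: "tdeg_le d p \<Longrightarrow> tdeg_le d (mconst c * p)"
  using tdeg_le_mult[of 0 "mconst c" d p] by simp

lemma tdeg_le_zero [simp]: "tdeg_le d 0"
  by (auto simp: tdeg_le_def)

lemma tdeg_le_mvar: "1 \<le> d \<Longrightarrow> tdeg_le d (mvar i)"
  by (auto simp: tdeg_le_def mvar_def)

lemma tdeg_le_sum: "(\<And>i. i \<in> S \<Longrightarrow> tdeg_le d (f i)) \<Longrightarrow> tdeg_le d (sum f S)"
  by (induction S rule: infinite_finite_induct) (auto intro: tdeg_le_add)

text \<open>Replacing \<open>F\<close> by \<open>N(0) (F - F(0))\<close> normalises the \<open>1\<close>-jet at the origin.\<close>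

lemma keller_over_normalize:
  assumes "subring A" "keller_over A n F N" "\<not> right_invertible n F" "\<And>i. i < n \<Longrightarrow> tdeg_le d (F i)"
  obtains F' N' where "keller_over A n F' N'" "\<not> right_invertible n F'" "normalized n F'" "\<And>i. i < n \<Longrightarrow> tdeg_le d (F' i)"
proof -
  interpret A: subring A by fact
  interpret P: subring "poly_over A n" by (rule A.subring_poly_over)
  let ?e = "mpoly_eval (\<lambda>_. 0)"
  define F' where "F' i = (\<Sum>l<n. mconst (?e (N i l)) * (F l - mconst (?e (F l))))" for i
  \<comment> \<open>Since DF' = N(0) DF, the inverse Jacobian of F' is N DF(0).\<close>
  define N' where "N' j l = (\<Sum>p<n. N j p * mconst (?e (mpderiv l (F p))))" for j l
  have ecl: "?e p \<in> A" if "p \<in> poly_over A n" for p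
    using eval_closed[OF assms(1) that] A.zero_closed by auto
  have dF': "mpderiv j (F' i) = (\<Sum>l<n. mconst (?e (N i l)) * mpderiv j (F l))" for i j
    by (simp add: F'_def mpderiv_sum mpderiv_diff)
  have "keller_over A n F' N'"
    unfolding keller_over_def
  proof (intro conjI allI impI)
    fix i l assume il: "i < n" "l < n"
    show "F' i \<in> poly_over A n" unfolding F'_def
      using il keller_overD[OF assms(2)] by (intro P.closed poly_over.const ecl) auto
    show "N' i l \<in> poly_over A n" unfolding N'_def
      using il keller_overD[OF assms(2)] by (intro P.closed poly_over.const ecl mpderiv_closed assms(1)) auto
    have "(\<Sum>j<n. mpderiv j (F' i) * N' j l) =
      (\<Sum>q<n. \<Sum>p<n. mconst (?e (N i q)) * (\<Sum>j<n. mpderiv j (F q) * N j p) * mconst (?e (mpderiv l (F p))))"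
      unfolding dF' N'_def by (rule sum_product_middle)
    also have "\<dots> = (\<Sum>q<n. \<Sum>p<n. mconst (?e (N i q)) * (if q = p then 1 else 0) * mconst (?e (mpderiv l (F p))))"
      using keller_overD(3)[OF assms(2)] by (intro sum.cong) auto
    also have "\<dots> = (\<Sum>q<n. mconst (?e (N i q)) * mconst (?e (mpderiv l (F q))))"
      by (intro sum.cong) (auto simp: mult.assoc sum_delta_swap(1) simp flip: sum_distrib_left)
    also have "\<dots> = mconst (\<Sum>q<n. ?e (N i q) * ?e (mpderiv l (F q)))"
      by (simp add: mconst.hom_sum mconst.hom_mult)
    also have "\<dots> = (if i = l then 1 else 0)"
      using keller_over_left_inverse[OF assms(2) il] by simp
    finally show "(\<Sum>j<n. mpderiv j (F' i) * N' j l) = (if i = l then 1 else 0)" .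
  qed
  moreover have "normalized n F'"
    unfolding normalized_def
  proof (intro allI impI conjI)
    fix i j assume ij: "i < n" "j < n"
    show "?e (mpderiv j (F' i)) = (if i = j then 1 else 0)"
      using keller_over_left_inverse[OF assms(2) ij] by (simp add: dF' eval.hom_sum eval.hom_mult)
  qed (simp add: F'_def eval.hom_sum eval.hom_mult eval.hom_minus)
  moreover have "tdeg_le d (F' i)" if "i < n" for i
    unfolding F'_def
    using assms(4) by (intro tdeg_le_sum tdeg_le_cmult tdeg_le_diff) auto
  moreover have "right_invertible n F" if "right_invertible n F'"
  proof -
    from that obtain G where G: "\<And>j. j < n \<Longrightarrow> G j \<in> poly_over UNIV n"
      "\<And>y i. i < n \<Longrightarrow> mpoly_eval (\<lambda>j. mpoly_eval y (G j)) (F' i) = y i"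
      unfolding right_invertible_def by blast
    \<comment> \<open>\<open>T\<close> is the affine map y \<mapsto> N(0) (y - F(0)). As F' = T o F,
      an inverse G of F' yields the inverse G o T of F.\<close>
    define T where "T i = (\<Sum>l<n. mconst (?e (N i l)) * (mvar l - mconst (?e (F l))))" for i
    show ?thesis
      unfolding right_invertible_def
    proof (intro exI[of _ "\<lambda>j. mpoly_subst T (G j)"] conjI allI impI)
      fix j assume "j < n"
      then show "mpoly_subst T (G j) \<in> poly_over UNIV n"
        using G(1) unfolding T_def
        by (intro subst_closed[of _ UNIV n]) (auto intro!: PU.closed poly_over.intros)
    next
      fix y i assume i: "i < n"
      define z where "z = (\<lambda>j. mpoly_eval (\<lambda>k. mpoly_eval y (T k)) (G j))"
      have 1: "(\<Sum>l<n. ?e (N i l) * (mpoly_eval z (F l) - ?e (F l))) =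
        (\<Sum>l<n. ?e (N i l) * (y l - ?e (F l)))" if "i < n" for i
        using G(2)[OF that, of "\<lambda>k. mpoly_eval y (T k)"] that
        by (simp add: F'_def T_def z_def eval.hom_sum eval.hom_mult eval.hom_minus)
      \<comment> \<open>By \<open>1\<close> the defect F(z) - y is annihilated by N(0); multiplying
        by DF(0) shows that it is 0.\<close>
      define v where "v l = mpoly_eval z (F l) - y l" for l
      have 2: "(\<Sum>l<n. ?e (N i l) * v l) = 0" if "i < n" for i
        using 1[OF that] by (simp add: v_def right_diff_distrib sum_subtractf)
      have "(\<Sum>q<n. ?e (mpderiv q (F i)) * (\<Sum>l<n. ?e (N q l) * v l))
        = (\<Sum>l<n. (\<Sum>q<n. ?e (mpderiv q (F i)) * ?e (N q l)) * v l)"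
        unfolding sum_distrib_left sum_distrib_right by (subst sum.swap) (simp add: mult_ac)
      also have "\<dots> = (\<Sum>l<n. (if i = l then 1 else 0) * v l)"
      proof (intro sum.cong refl)
        fix l assume "l \<in> {..<n}"
        then show "(\<Sum>q<n. ?e (mpderiv q (F i)) * ?e (N q l)) * v l = (if i = l then 1 else 0) * v l"
          using arg_cong[OF keller_overD(3)[OF assms(2) i, of l], of ?e]
          by (simp only: eval.hom_sum eval.hom_mult eval_kronecker lessThan_iff)
      qed
      also have "\<dots> = v i" using i by (simp add: sum_delta_swap)
      finally have "v i = 0" using 2 by simp
      then show "mpoly_eval (\<lambda>j. mpoly_eval y (mpoly_subst T (G j))) (F i) = y i"
        by (simp add: eval_subst v_def z_def)
    qed
  qed
  ultimately show ?thesis using that assms(3) by blast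
qed

text \<open>A triangular new coordinate X_n + p keeps the Jacobian block triangular with 1 in the
  corner; \<open>N'\<close> is the block triangular inverse.\<close>

lemma keller_over_extend:
  assumes "subring A" "keller_over A n F N" "p \<in> poly_over A n"
  obtains N' where "keller_over A (Suc n) (\<lambda>i. if i < n then F i else mvar n + p) N'"
proof -
  interpret A: subring A by fact
  interpret P: subring "poly_over A n" by (rule A.subring_poly_over)
  interpret P': subring "poly_over A (Suc n)" by (rule A.subring_poly_over)
  have up: "q \<in> poly_over A (Suc n)" if "q \<in> poly_over A n" for q
    by (rule poly_over_mono[OF that]) auto
  define N' where "N' j l = (if j < n then if l < n then N j l else 0
    else if l < n then - (\<Sum>j<n. mpderiv j p * N j l) else 1)" for j l
  let ?F = "\<lambda>i. if i < n then F i else mvar n + p"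
  have "keller_over A (Suc n) ?F N'"
    unfolding keller_over_def
  proof (intro conjI allI impI)
    fix i l assume il: "i < Suc n" "l < Suc n"
    show "?F i \<in> poly_over A (Suc n)"
      using keller_overD(1)[OF assms(2)] up assms(3) P'.add_closed[OF poly_over.var[of n "Suc n" A]] by auto
    show "N' i l \<in> poly_over A (Suc n)"
      using keller_overD(2)[OF assms(2)] assms(3) il mpderiv_closed[OF assms(1,3)] unfolding N'_def
      by (auto intro!: P'.uminus_closed P'.zero_closed P'.one_closed up[OF P.sum_closed] P.mult_closed intro: up)
    show "(\<Sum>j<Suc n. mpderiv j (?F i) * N' j l) = (if i = l then 1 else 0)"
    proof (cases "i < n")
      case True
      then show ?thesis
        using keller_overD(3)[OF assms(2) True, of l] mpderiv_outside[OF keller_overD(1)[OF assms(2) True], of n]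
        by (cases "l < n") (auto simp: N'_def)
    next
      case False
      with il mpderiv_outside[OF assms(3), of n] show ?thesis
        by (auto simp: N'_def mpderiv_add)
    qed
  qed
  then show ?thesis by (rule that)
qed

text \<open>F is followed by the elementary automorphism that adds s(y) to y_i0. As ds vanishes on
  the unit vector e_i0, the inverse of I + e_i0 ds is I - e_i0 ds, and \<open>N'\<close> is N times
  this matrix taken at F.\<close>

lemma keller_over_shear:
  assumes "subring A" "keller_over A n F N" "s \<in> poly_over A n" "i0 < n" "mpderiv i0 s = 0"
  obtains N' where "keller_over A n (\<lambda>i. if i = i0 then F i + mpoly_subst F s else F i) N'"
proof -
  interpret A: subring A by fact
  interpret P: subring "poly_over A n" by (rule A.subring_poly_over)
  define N' where "N' j l = N j l - N j i0 * mpoly_subst F (mpderiv l s)" for j l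
  let ?F = "\<lambda>i. if i = i0 then F i + mpoly_subst F s else F i"
  have scl: "mpoly_subst F q \<in> poly_over A n" if "q \<in> poly_over A n" for q
    using keller_overD(1)[OF assms(2)] by (intro subst_closed[OF that])
  have base: "(\<Sum>j<n. mpderiv j (F i) * N' j l) =
      (if i = l then 1 else 0) - (if i = i0 then 1 else 0) * mpoly_subst F (mpderiv l s)"
    if "i < n" "l < n" for i l
    using that assms(4) keller_overD(3)[OF assms(2)]
    by (simp add: N'_def right_diff_distrib sum_subtractf flip: mult.assoc sum_distrib_right)
  have "keller_over A n ?F N'"
    unfolding keller_over_def
  proof (intro conjI allI impI)
    fix i l assume il: "i < n" "l < n"
    show "?F i \<in> poly_over A n"
      using keller_overD[OF assms(2)] il scl[OF assms(3)] by (auto intro!: P.closed)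
    show "N' i l \<in> poly_over A n"
      using keller_overD[OF assms(2)] assms(3,4) il unfolding N'_def
      by (intro P.closed scl mpderiv_closed assms(1)) auto
    have "(\<Sum>j<n. mpderiv j (mpoly_subst F s) * N' j l)
      = (\<Sum>q<n. mpoly_subst F (mpderiv q s) * (\<Sum>j<n. mpderiv j (F q) * N' j l))"
      unfolding mpderiv_subst[OF assms(3)] sum_distrib_left sum_distrib_right
      by (subst sum.swap) (simp add: mult_ac)
    also have "\<dots> = (\<Sum>q<n. mpoly_subst F (mpderiv q s) * (if q = l then 1 else 0)
        - mpoly_subst F (mpderiv q s) * (if q = i0 then 1 else 0) * mpoly_subst F (mpderiv l s))"
      using il by (intro sum.cong) (simp_all add: base right_diff_distrib mult.assoc)
    also have "\<dots> = mpoly_subst F (mpderiv l s)"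
      using assms(4,5) il by (simp add: sum_subtractf sum_delta_swap flip: sum_distrib_right)
    finally show "(\<Sum>j<n. mpderiv j (?F i) * N' j l) = (if i = l then 1 else 0)"
      using base[OF il] by (auto simp: mpderiv_add distrib_right sum.distrib)
  qed
  then show ?thesis by (rule that)
qed

section \<open>From complex to integral coefficients\<close>

definition adjoin :: "complex set \<Rightarrow> complex \<Rightarrow> complex set" where
  "adjoin A a = {poly p a |p. \<forall>k. coeff p k \<in> A}"

lemma subring_coeffs:
  assumes "subring A"
  shows "subring {p :: 'a::comm_ring_1 poly. \<forall>k. coeff p k \<in> A}"
proof -
  interpret subring A by fact
  show ?thesis
    by unfold_locales (auto simp: coeff_mult coeff_pCons' one_pCons intro: closed)
qed

lemma subring_adjoin: "subring A \<Longrightarrow> subring (adjoin A a)"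
proof -
  assume "subring A"
  then interpret C: subring "{p. \<forall>k. coeff p k \<in> A}" by (rule subring_coeffs)
  show "subring (adjoin A a)"
  proof
    show "1 \<in> adjoin A a" unfolding adjoin_def using C.one_closed by (auto intro!: exI[of _ 1])
  next
    fix x y assume "x \<in> adjoin A a" "y \<in> adjoin A a"
    then obtain p q where *: "p \<in> {p. \<forall>k. coeff p k \<in> A}" "q \<in> {p. \<forall>k. coeff p k \<in> A}"
      "x = poly p a" "y = poly q a" unfolding adjoin_def by blast
    show "x - y \<in> adjoin A a" unfolding adjoin_def using C.diff_closed[OF *(1,2)] *(3,4)
      by (auto intro!: exI[of _ "p - q"])
    show "x * y \<in> adjoin A a" unfolding adjoin_def using C.mult_closed[OF *(1,2)] *(3,4)
      by (auto intro!: exI[of _ "p * q"])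
  qed
qed

lemma adjoin_base: "subring A \<Longrightarrow> c \<in> A \<Longrightarrow> c \<in> adjoin A a"
  unfolding adjoin_def by (auto intro!: exI[of _ "[:c:]"] simp: coeff_pCons' intro: subring.zero_closed)

lemma adjoin_gen: "subring A \<Longrightarrow> a \<in> adjoin A a"
  unfolding adjoin_def
  by (auto intro!: exI[of _ "[:0, 1:]"] simp: coeff_pCons' intro: subring.zero_closed subring.one_closed)

lemma lookup_mconst_mult: "lookup (mconst c * p) m = c * lookup p m"
proof (induction p rule: mpoly_single_induct)
  case (single m' c')
  show ?case by (simp add: mconst_def mult_single lookup_single when_def)
qed (simp add: distrib_left lookup_add)

lemma poly_over_split_last:
  assumes "subring A" "p \<in> poly_over A (Suc n)"
  shows "\<exists>q. (\<forall>k. coeff q k \<in> poly_over A n) \<and> p = poly q (mvar n)"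
proof -
  interpret A: subring A by fact
  interpret P: subring "poly_over A n" by (rule A.subring_poly_over)
  interpret C: subring "{q. \<forall>k. coeff q k \<in> poly_over A n}"
    by (rule subring_coeffs) (rule A.subring_poly_over)
  have cst: "[:q:] \<in> {q. \<forall>k. coeff q k \<in> poly_over A n}" if "q \<in> poly_over A n" for q
    using that P.zero_closed by (auto simp: coeff_pCons')
  have "\<exists>q. q \<in> {q. \<forall>k. coeff q k \<in> poly_over A n} \<and> p = poly q (mvar n)"
    using assms(2)
  proof (induction rule: poly_over.induct)
    case (const c)
    have "[:mconst c:] \<in> {q. \<forall>k. coeff q k \<in> poly_over A n}"
      by (intro cst poly_over.const const)
    then show ?case by (intro exI[of _ "[:mconst c:]"]) simp
  next
    case (var i)
    show ?case
    proof (cases "i = n")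
      case True
      have "[:0, 1:] \<in> {q. \<forall>k. coeff q k \<in> poly_over A n}"
        using P.zero_closed P.one_closed by (auto simp: coeff_pCons')
      then show ?thesis using True by (intro exI[of _ "[:0, 1:]"]) simp
    next
      case False
      then have "mvar i \<in> poly_over A n" using var by (auto intro: poly_over.var)
      from cst[OF this] show ?thesis by (intro exI[of _ "[:mvar i:]"]) simp
    qed
  next
    case (add p q)
    then obtain p' q' where *: "p' \<in> {q. \<forall>k. coeff q k \<in> poly_over A n}" "p = poly p' (mvar n)"
      "q' \<in> {q. \<forall>k. coeff q k \<in> poly_over A n}" "q = poly q' (mvar n)" by blast
    show ?case using C.add_closed[OF *(1,3)] *(2,4) by (intro exI[of _ "p' + q'"]) simp
  next
    case (mult p q)
    then obtain p' q' where *: "p' \<in> {q. \<forall>k. coeff q k \<in> poly_over A n}" "p = poly p' (mvar n)"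
      "q' \<in> {q. \<forall>k. coeff q k \<in> poly_over A n}" "q = poly q' (mvar n)" by blast
    show ?case using C.mult_closed[OF *(1,3)] *(2,4) by (intro exI[of _ "p' * q'"]) simp
  qed
  then show ?thesis by auto
qed

text \<open>Independence over \<open>A\<close> passes to polynomials over \<open>A\<close> by
  comparing the coefficients of each monomial.\<close>

lemma mpoly_independent:
  assumes "subring A"
    and indep: "\<And>c. (\<And>l. l \<in> L \<Longrightarrow> c l \<in> A) \<Longrightarrow> (\<Sum>l\<in>L. c l * e l) = 0 \<Longrightarrow> (\<forall>l\<in>L. c l = 0)"
    and "\<And>l. l \<in> L \<Longrightarrow> p l \<in> poly_over A n"
    and "(\<Sum>l\<in>L. mconst (e l) * p l) = 0" "l \<in> L"
  shows "p l = (0 :: complex mpoly)"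
proof (rule poly_mapping_eqI)
  fix m
  have "(\<Sum>l\<in>L. lookup (p l) m * e l) = 0"
    using arg_cong[OF assms(4), of "\<lambda>q. lookup q m"]
    by (simp only: lookup_sum lookup_mconst_mult lookup_zero mult.commute[of "e _"])
  then have "\<forall>l\<in>L. lookup (p l) m = 0"
    by (intro indep poly_over_coeff[OF assms(1) assms(3)])
  then show "lookup (p l) m = lookup 0 m"
    using assms(5) by simp
qed

text \<open>A generator that is transcendental over \<open>A\<close> is replaced by a new variable.\<close>

lemma counterexample_adjoin_transcendental:
  assumes A: "subring A" and tr: "\<And>p. (\<forall>k. coeff p k \<in> A) \<Longrightarrow> poly p a = 0 \<Longrightarrow> p = 0"
    and "counterexample_over (adjoin A a)"
  shows "counterexample_over A"
proof -
  interpret A: subring A by fact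
  from assms(3) obtain n F N where km: "keller_over (adjoin A a) n F N" and nr: "\<not> right_invertible n F"
    by (auto simp: counterexample_over_def)
  interpret P: subring "poly_over A (Suc n)" by (rule A.subring_poly_over)
  interpret B: subring "adjoin A a" by (rule subring_adjoin) fact
  \<comment> \<open>\<open>\<sigma>\<close> specialises the new variable to \<open>a\<close>.
    Transcendence makes it injective on polynomials over \<open>A\<close>, so identities valid after
    specialisation hold before it.\<close>
  define \<sigma> :: "complex mpoly \<Rightarrow> complex mpoly" where
    "\<sigma> = mpoly_subst (\<lambda>i. if i = n then mconst a else mvar i)"
  interpret \<sigma>: comm_ring_hom \<sigma> unfolding \<sigma>_def by unfold_locales
  have \<sigma>_fix: "\<sigma> p = p" if "p \<in> poly_over C n" for p C
    unfolding \<sigma>_def by (rule subst_mvar_id[OF that]) auto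
  have \<sigma>_inj: "p = 0" if p: "p \<in> poly_over A (Suc n)" "\<sigma> p = 0" for p
  proof -
    obtain q where q: "\<And>k. coeff q k \<in> poly_over A n" "p = poly q (mvar n)"
      using poly_over_split_last[OF A p(1)] by blast
    have "\<sigma> p = (\<Sum>k\<le>degree q. mconst (a ^ k) * coeff q k)"
      unfolding q(2) poly_altdef
      by (simp add: \<sigma>.hom_sum \<sigma>.hom_mult \<sigma>.hom_power \<sigma>_fix[OF q(1)])
        (simp add: \<sigma>_def mconst.hom_power mult.commute)
    then have 0: "(\<Sum>k\<le>degree q. mconst (a ^ k) * coeff q k) = 0" using p(2) by simp
    have "coeff q k = 0" if "k \<le> degree q" for k
    proof (rule mpoly_independent[OF A, where L = "{..degree q}" and e = "\<lambda>k. a ^ k"])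
      fix c assume c: "\<And>l. l \<in> {..degree q} \<Longrightarrow> c l \<in> A" "(\<Sum>l\<le>degree q. c l * a ^ l) = 0"
      let ?p = "\<Sum>l\<le>degree q. monom (c l) l"
      have cf: "coeff ?p k = (if k \<le> degree q then c k else 0)" for k
        by (simp add: coeff_sum)
      have "?p = 0" using c by (intro tr) (auto simp: cf poly_sum poly_monom A.zero_closed)
      then show "\<forall>l\<in>{..degree q}. c l = 0" using cf by (metis atMost_iff coeff_0)
    qed (use q(1) 0 that in auto)
    then have "q = 0" by (metis coeff_0 leading_coeff_0_iff order_refl)
    then show ?thesis using q(2) by simp
  qed
  have lift: "\<exists>q\<in>poly_over A (Suc n). \<sigma> q = p" if "p \<in> poly_over (adjoin A a) n" for p
    using that
  proof (induction rule: poly_over.induct)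
    case (const c)
    then obtain q where q: "\<forall>k. coeff q k \<in> A" "c = poly q a" by (auto simp: adjoin_def)
    let ?q = "\<Sum>k\<le>degree q. mconst (coeff q k) * mvar n ^ k"
    have "\<sigma> ?q = mconst c"
      by (simp add: \<sigma>.hom_sum \<sigma>.hom_mult \<sigma>.hom_power q(2) poly_altdef mconst.hom_sum mconst.hom_mult mconst.hom_power)
        (simp add: \<sigma>_def)
    moreover have "?q \<in> poly_over A (Suc n)"
      using q(1) by (intro P.closed poly_over.const poly_over.var) auto
    ultimately show ?case by blast
  next
    case (var i)
    then show ?case by (intro bexI[of _ "mvar i"]) (auto simp: \<sigma>_def intro: poly_over.var)
  next
    case (add p q)
    then show ?case by (metis \<sigma>.hom_add P.add_closed)
  next
    case (mult p q)
    then show ?case by (metis \<sigma>.hom_mult P.mult_closed)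
  qed
  obtain L where L: "\<And>p. p \<in> poly_over (adjoin A a) n \<Longrightarrow> L p \<in> poly_over A (Suc n) \<and> \<sigma> (L p) = p"
    using lift by metis
  define F' where "F' i = (if i < n then L (F i) else mvar n)" for i
  \<comment> \<open>The last component of F' is the new variable, so its Jacobian is block upper
    triangular. The last column of \<open>N'\<close> corrects for the derivatives of the lifts in
    that variable.\<close>
  define N' where "N' j l = (if j < n then if l < n then L (N j l)
      else - (\<Sum>k<n. L (N j k) * mpderiv n (F' k))
    else if l < n then 0 else 1)" for j l
  have LF: "L (F i) \<in> poly_over A (Suc n)" "\<sigma> (L (F i)) = F i" if "i < n" for i
    using L keller_overD(1)[OF km that] by auto
  have LN: "L (N i j) \<in> poly_over A (Suc n)" "\<sigma> (L (N i j)) = N i j" if "i < n" "j < n" for i j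
    using L keller_overD(2)[OF km that] by auto
  have d\<sigma>: "mpderiv j (\<sigma> q) = \<sigma> (mpderiv j q)" if "q \<in> poly_over A (Suc n)" "j < n" for j q
  proof -
    have "mpderiv j (\<sigma> q) = (\<Sum>k<Suc n. if k = j then \<sigma> (mpderiv k q) else 0)"
      unfolding \<sigma>_def mpderiv_subst[OF that(1)] using that(2) by (intro sum.cong) auto
    then show ?thesis using that(2) by simp
  qed
  have id: "(\<Sum>j<n. mpderiv j (F' i) * L (N j l)) = (if i = l then 1 else 0)" if "i < n" "l < n" for i l
  proof -
    let ?q = "(\<Sum>j<n. mpderiv j (F' i) * L (N j l)) - (if i = l then 1 else 0)"
    have "?q \<in> poly_over A (Suc n)"
      using that LF LN by (auto simp: F'_def intro!: P.diff_closed P.sum_closed P.mult_closed mpderiv_closed A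
          P.one_closed P.zero_closed)
    moreover have "\<sigma> ?q = (\<Sum>j<n. mpderiv j (F i) * N j l) - (if i = l then 1 else 0)"
      using that LF LN by (auto simp: F'_def \<sigma>.hom_sum \<sigma>.hom_mult \<sigma>.hom_minus simp flip: d\<sigma>)
    ultimately show ?thesis using \<sigma>_inj[of ?q] keller_overD(3)[OF km that] by simp
  qed
  have "keller_over A (Suc n) F' N'"
    unfolding keller_over_def
  proof (intro conjI allI impI)
    fix i l assume il: "i < Suc n" "l < Suc n"
    show F'i: "F' i \<in> poly_over A (Suc n)" for i
      using LF by (auto simp: F'_def intro: poly_over.var)
    show "N' i l \<in> poly_over A (Suc n)"
      using LN mpderiv_closed[OF A F'i] unfolding N'_def
      by (auto intro!: P.uminus_closed P.sum_closed P.mult_closed P.one_closed P.zero_closed)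
    show "(\<Sum>j<Suc n. mpderiv j (F' i) * N' j l) = (if i = l then 1 else 0)"
    proof (cases "i < n")
      case i: True
      show ?thesis
      proof (cases "l < n")
        case True
        then show ?thesis using id[OF i True] by (simp add: N'_def)
      next
        case False
        have "(\<Sum>j<n. mpderiv j (F' i) * (\<Sum>k<n. L (N j k) * mpderiv n (F' k)))
          = (\<Sum>k<n. (\<Sum>j<n. mpderiv j (F' i) * L (N j k)) * mpderiv n (F' k))"
          unfolding sum_distrib_left sum_distrib_right by (subst sum.swap) (simp add: mult_ac)
        also have "\<dots> = (\<Sum>k<n. (if i = k then 1 else 0) * mpderiv n (F' k))"
          using id[OF i] by (intro sum.cong) auto
        also have "\<dots> = mpderiv n (F' i)" using i by (simp add: sum_delta_swap(1)[OF i])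
        finally show ?thesis using False i il by (simp add: N'_def sum_negf)
      qed
    next
      case False
      then show ?thesis using il by (auto simp: F'_def N'_def)
    qed
  qed
  moreover have "right_invertible n F" if "right_invertible (Suc n) F'"
  proof -
    from that obtain G where G: "\<And>j. j < Suc n \<Longrightarrow> G j \<in> poly_over UNIV (Suc n)"
      "\<And>y i. i < Suc n \<Longrightarrow> mpoly_eval (\<lambda>j. mpoly_eval y (G j)) (F' i) = y i"
      unfolding right_invertible_def by blast
    show ?thesis
      unfolding right_invertible_def
    proof (intro exI[of _ "\<lambda>j. \<sigma> (G j)"] conjI allI impI)
      fix j assume "j < n"
      then show "\<sigma> (G j) \<in> poly_over UNIV n"
        using G(1)[of j] unfolding \<sigma>_def
        by (intro subst_closed[of _ UNIV "Suc n"]) (auto intro: poly_over.intros)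
    next
      fix y i assume i: "i < n"
      \<comment> \<open>With \<open>a\<close> in the last slot, the last component of F' forces G_n
        to be \<open>a\<close> at this point, so there each lift takes the same value as its
        specialisation.\<close>
      define z where "z = (\<lambda>k. if k = n then a else y k)"
      have e\<sigma>: "mpoly_eval y (\<sigma> q) = mpoly_eval z q" for q
        unfolding \<sigma>_def z_def eval_subst by (intro arg_cong2[where f = mpoly_eval]) auto
      have "mpoly_eval z (G n) = a"
        using G(2)[of n z] by (simp add: F'_def z_def)
      have "y i = z i" using i by (simp add: z_def)
      also have "\<dots> = mpoly_eval (\<lambda>j. mpoly_eval z (G j)) (L (F i))"
        using G(2)[of i z] i by (simp add: F'_def)
      also have "\<dots> = mpoly_eval (\<lambda>j. mpoly_eval (\<lambda>j. mpoly_eval z (G j)) (if j = n then mconst a else mvar j)) (L (F i))"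
        using \<open>mpoly_eval z (G n) = a\<close> by (intro arg_cong2[where f = mpoly_eval]) auto
      also have "\<dots> = mpoly_eval (\<lambda>j. mpoly_eval z (G j)) (F i)"
        using eval_subst[of "\<lambda>j. mpoly_eval z (G j)" "\<lambda>j. if j = n then mconst a else mvar j" "L (F i)"]
          LF(2)[OF i] by (simp add: \<sigma>_def)
      finally show "mpoly_eval (\<lambda>j. mpoly_eval y (\<sigma> (G j))) (F i) = y i"
        by (simp add: e\<sigma>)
    qed
  qed
  ultimately show ?thesis using nr by (auto simp: counterexample_over_def)
qed

section \<open>Coefficients of low degree and dilations\<close>

lemma mmon_0: "mmon (\<lambda>_. 0 :: 'a::comm_ring_1) m = (if m = 0 then 1 else 0)"
proof (cases "m = 0")
  case False
  then obtain i where i: "i \<in> keys m"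
    using poly_mapping_eqI[of m 0] by (auto simp: in_keys_iff)
  have "mmon (\<lambda>_. 0 :: 'a) m = 0"
    unfolding mmon_def
    by (rule prod_zero) (use i in \<open>auto simp: in_keys_iff zero_power intro!: bexI[of _ i]\<close>)
  then show ?thesis using False by simp
qed simp

lemma eval_0: "mpoly_eval (\<lambda>_. 0) p = lookup p 0"
proof (induction p rule: mpoly_single_induct)
  case (single m c)
  show ?case by (simp add: mpoly_eval_hom mpoly_hom_single mmon_0 lookup_single when_def)
qed (simp add: eval.hom_add lookup_add)

lemma eval_0_mpderiv: "mpoly_eval (\<lambda>_. 0) (mpderiv j p) = lookup p (single j 1)"
proof (induction p rule: mpoly_single_induct)
  case (single m c)
  have "m = single j 1" if "m - single j 1 = 0" "lookup m j \<noteq> 0"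
  proof (rule poly_mapping_eqI)
    fix k
    show "lookup m k = lookup (single j 1) k"
      using arg_cong[OF that(1), of "\<lambda>q. lookup q k"] that(2)
      by (cases "k = j") (auto simp: lookup_minus lookup_single when_def)
  qed
  then show ?case
    by (cases "m = single j 1"; cases "lookup m j = 0")
      (auto simp: eval_0 mpderiv_single lookup_single when_def)
qed (simp add: mpderiv_add eval.hom_add lookup_add)

lemma mdeg_0_imp: "mdeg m = 0 \<Longrightarrow> m = 0"
  by (rule poly_mapping_eqI) (auto simp: in_keys_iff)

lemma mdeg_1_imp:
  assumes "mdeg m = 1"
  obtains j where "m = single j 1"
proof -
  obtain j where j: "j \<in> keys m" using assms by (metis sum.empty zero_neq_one all_not_in_conv)
  have *: "mdeg m = lookup m j + sum (lookup m) (keys m - {j})"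
    using j by (intro sum.remove) auto
  have "lookup m j \<noteq> 0" using j by (simp add: in_keys_iff)
  with * assms have 1: "lookup m j = 1"
    and 2: "sum (lookup m) (keys m - {j}) = 0" by linarith+
  from 2 have "\<forall>k\<in>keys m - {j}. lookup m k = 0"
    by (subst (asm) sum_eq_0_iff) auto
  then have "lookup m k = 0" if "k \<noteq> j" for k
    using that by (metis DiffI in_keys_iff singletonD)
  with 1 have "m = single j 1"
    by (intro poly_mapping_eqI) (auto simp: lookup_single when_def)
  then show ?thesis by (rule that)
qed

definition dilation :: "complex \<Rightarrow> complex mpoly \<Rightarrow> complex mpoly" where
  "dilation s = mpoly_subst (\<lambda>i. mconst s * mvar i)"

global_interpretation dilation: comm_ring_hom "dilation s" for s
  unfolding dilation_def by unfold_locales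

lemma lookup_dilation: "lookup (dilation s p) m = s ^ mdeg m * lookup p m"
proof (induction p rule: mpoly_single_induct)
  case (single m' c)
  have "dilation s (single m' c) = mconst (c * s ^ mdeg m') * mmon mvar m'"
    by (simp add: dilation_def mpoly_subst_hom mpoly_hom_single mmon_def power_mult_distrib prod.distrib
        mconst.hom_mult mconst.hom_power flip: power_sum)
  then show ?case by (simp add: mmon_mvar_single lookup_single when_def)
qed (simp add: dilation.hom_add lookup_add distrib_left)

lemma mpderiv_dilation:
  assumes "p \<in> poly_over A n" "j < n"
  shows "mpderiv j (dilation s p) = mconst s * dilation s (mpderiv j p)"
proof -
  have "mpderiv j (dilation s p) = (\<Sum>k<n. if k = j then mconst s * dilation s (mpderiv k p) else 0)"
    unfolding dilation_def mpderiv_subst[OF assms(1)] by (intro sum.cong) auto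
  with assms(2) show ?thesis by simp
qed

lemma dilation_UNIV: "p \<in> poly_over UNIV n \<Longrightarrow> dilation s p \<in> poly_over UNIV n"
  unfolding dilation_def by (rule subst_closed) (auto intro: poly_over.intros)

lemma eval_dilation: "mpoly_eval x (dilation s p) = mpoly_eval (\<lambda>i. s * x i) p"
  by (simp add: dilation_def eval_subst eval.hom_mult)

text \<open>Conjugation by the dilation \<open>s\<close> multiplies the part of degree \<open>d\<close> by \<open>s ^ (d - 1)\<close>,
  so for a normalised map it clears denominators.\<close>

lemma keller_over_dilate:
  assumes A: "subring A" and km: "keller_over B n F N" and nf: "normalized n F" and s: "s \<noteq> 0" "s \<in> A"
    and F: "\<And>i m. i < n \<Longrightarrow> s * lookup (F i) m \<in> A"
    and N: "\<And>j l m. j < n \<Longrightarrow> l < n \<Longrightarrow> s * lookup (N j l) m \<in> A"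
  shows "keller_over A n (\<lambda>i. mconst (inverse s) * dilation s (F i)) (\<lambda>j l. dilation s (N j l))"
    and "right_invertible n (\<lambda>i. mconst (inverse s) * dilation s (F i)) \<Longrightarrow> right_invertible n F"
proof -
  interpret A: subring A by fact
  have FU: "F i \<in> poly_over UNIV n" if "i < n" for i
    using keller_overD(1)[OF km that] by (rule poly_over_UNIV)
  have NU: "N j l \<in> poly_over UNIV n" if "j < n" "l < n" for j l
    using keller_overD(2)[OF km that] by (rule poly_over_UNIV)
  let ?F = "\<lambda>i. mconst (inverse s) * dilation s (F i)"
  show "keller_over A n ?F (\<lambda>j l. dilation s (N j l))"
    unfolding keller_over_def
  proof (intro conjI allI impI)
    fix i l assume il: "i < n" "l < n"
    have "lookup (?F i) m \<in> A" for m
    proof -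
      have eq: "lookup (?F i) m = inverse s * (s ^ mdeg m * lookup (F i) m)"
        by (simp add: lookup_mconst_mult lookup_dilation)
      \<comment> \<open>By normalisation the coefficient in degree 0 is 0 and those in degree 1 are
        0 or 1; from degree 2 on at least one factor \<open>s\<close> is left over to clear the
        denominator.\<close>
      consider "mdeg m = 0" | "mdeg m = 1" | k where "mdeg m = Suc (Suc k)"
        by (metis One_nat_def not0_implies_Suc)
      then show ?thesis
      proof cases
        case 1
        then have "m = 0" by (rule mdeg_0_imp)
        then show ?thesis unfolding eq using nf il by (simp add: normalized_def eval_0 A.zero_closed)
      next
        case 2
        then obtain j where m: "m = single j 1" by (rule mdeg_1_imp)
        have "lookup (F i) m \<in> A"
        proof (cases "j < n")
          case True
          then show ?thesis using nf il by (auto simp: normalized_def eval_0_mpderiv m A.zero_closed A.one_closed)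
        next
          case False
          then have "m \<notin> keys (F i)"
            using FU[OF il(1)] by (auto simp: m polys_def simp flip: polys_eq_poly_over)
          then show ?thesis by (simp add: in_keys_iff A.zero_closed)
        qed
        then show ?thesis unfolding eq using s 2 by (simp flip: mult.assoc)
      next
        case 3
        then have "lookup (?F i) m = s ^ k * (s * lookup (F i) m)"
          using s by (simp add: eq)
        then show ?thesis using F[OF il(1)] s by (auto intro: A.closed)
      qed
    qed
    then show "?F i \<in> poly_over A n"
      using dilation_UNIV[OF FU[OF il(1)], of s] PU.mult_closed[OF poly_over.const]
      by (auto simp: poly_over_iff[OF A] polys_eq_poly_over)
    have "lookup (dilation s (N i l)) m \<in> A" for m
    proof (cases "mdeg m")
      case 0
      then have m: "m = 0" by (rule mdeg_0_imp)
      \<comment> \<open>The dilation does not scale constant terms, but N(0) is the identity because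
        DF(0) is.\<close>
      have "lookup (N i l) 0 = (\<Sum>j<n. mpoly_eval (\<lambda>_. 0) (N i j) * (if j = l then 1 else 0))"
        using il by (simp add: sum_delta_swap eval_0)
      also have "\<dots> = (\<Sum>j<n. mpoly_eval (\<lambda>_. 0) (N i j) * mpoly_eval (\<lambda>_. 0) (mpderiv l (F j)))"
        using nf il by (intro sum.cong) (auto simp: normalized_def)
      also have "\<dots> = (if i = l then 1 else 0)" by (rule keller_over_left_inverse[OF km il])
      finally show ?thesis by (simp add: lookup_dilation m A.zero_closed A.one_closed)
    next
      case (Suc k)
      then have "lookup (dilation s (N i l)) m = s ^ k * (s * lookup (N i l) m)"
        by (simp add: lookup_dilation)
      then show ?thesis using N[OF il] s by (auto intro: A.closed)
    qed
    then show "dilation s (N i l) \<in> poly_over A n"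
      using dilation_UNIV[OF NU[OF il], of s] by (simp add: poly_over_iff[OF A] polys_eq_poly_over)
    have "(\<Sum>j<n. mpderiv j (?F i) * dilation s (N j l)) = dilation s (\<Sum>j<n. mpderiv j (F i) * N j l)"
      unfolding dilation.hom_sum dilation.hom_mult
    proof (intro sum.cong refl)
      fix j assume "j \<in> {..<n}"
      then show "mpderiv j (?F i) * dilation s (N j l) = dilation s (mpderiv j (F i)) * dilation s (N j l)"
        using s by (simp add: mpderiv_dilation[OF FU[OF il(1)]] flip: mult.assoc mconst.hom_mult)
    qed
    then show "(\<Sum>j<n. mpderiv j (?F i) * dilation s (N j l)) = (if i = l then 1 else 0)"
      using keller_overD(3)[OF km il] by simp
  qed
  assume "right_invertible n ?F"
  then obtain G where G: "\<And>j. j < n \<Longrightarrow> G j \<in> poly_over UNIV n"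
    "\<And>y i. i < n \<Longrightarrow> mpoly_eval (\<lambda>j. mpoly_eval y (G j)) (?F i) = y i"
    unfolding right_invertible_def by blast
  show "right_invertible n F"
    unfolding right_invertible_def
  proof (intro exI[of _ "\<lambda>j. mconst s * dilation (inverse s) (G j)"] conjI allI impI)
    fix j assume "j < n"
    then show "mconst s * dilation (inverse s) (G j) \<in> poly_over UNIV n"
      using G(1) by (intro PU.mult_closed dilation_UNIV poly_over.const) auto
  next
    fix y i assume i: "i < n"
    then show "mpoly_eval (\<lambda>j. mpoly_eval y (mconst s * dilation (inverse s) (G j))) (F i) = y i"
      using G(2)[OF i, of "\<lambda>i. inverse s * y i"] s
      by (simp add: eval.hom_mult eval_dilation field_simps)
  qed
qed

lemma sum_blocks: "(\<Sum>k<n * m. f k) = (\<Sum>j<n. \<Sum>l<m. f (j * m + l :: nat))"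
proof -
  have "(\<Sum>k<n * m. f k) = (\<Sum>j<n. sum f {j * m..<j * m + m})"
    by (rule sum.nat_group[symmetric])
  also have "\<dots> = (\<Sum>j<n. \<Sum>l<m. f (j * m + l))"
  proof (rule sum.cong[OF refl])
    fix j
    show "sum f {j * m..<j * m + m} = (\<Sum>l<m. f (j * m + l))"
      using sum.shift_bounds_nat_ivl[of f 0 "j * m" m] by (simp add: add.commute lessThan_atLeast0)
  qed
  finally show ?thesis .
qed

text \<open>Restriction of scalars along the free extension of \<open>A\<close> with basis \<open>b ^ l\<close>, \<open>l < m\<close>: the
  variable \<open>X\<^sub>j\<close> is replaced by \<open>\<Sum>l<m. b ^ l * X\<^sub>j\<^sub>m\<^sub>+\<^sub>l\<close>.\<close>

lemma counterexample_adjoin_free: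
  assumes A: "subring A" and m: "m > 0"
    and rel: "\<And>l. l < m \<Longrightarrow> \<gamma> l \<in> A" "b ^ m = (\<Sum>l<m. \<gamma> l * b ^ l)"
    and indep: "\<And>c. (\<And>l. l < m \<Longrightarrow> c l \<in> A) \<Longrightarrow> (\<Sum>l<m. c l * b ^ l) = 0 \<Longrightarrow> (\<forall>l<m. c l = 0)"
    and "counterexample_over (adjoin A b)"
  shows "counterexample_over A"
proof -
  interpret A: subring A by fact
  from assms(6) obtain n F N where km: "keller_over (adjoin A b) n F N" and nr: "\<not> right_invertible n F"
    by (auto simp: counterexample_over_def)
  define n' where "n' = n * m"
  interpret P: subring "poly_over A n'" by (rule A.subring_poly_over)
  \<comment> \<open>The module spanned over the polynomials with coefficients in \<open>A\<close> by
    the powers of \<open>b\<close>. The relation \<open>rel\<close> makes it a ring, so it contains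
    every substituted polynomial.\<close>
  define M where "M = {p. \<exists>q. (\<forall>l<m. q l \<in> poly_over A n') \<and> p = (\<Sum>l<m. mconst (b ^ l) * q l)}"
  have MI: "(\<Sum>l<m. mconst (b ^ l) * q l) \<in> M" if "\<And>l. l < m \<Longrightarrow> q l \<in> poly_over A n'" for q
    using that unfolding M_def by blast
  have M_add: "p + p' \<in> M" if pp: "p \<in> M" "p' \<in> M" for p p'
  proof -
    from pp obtain q q' where q: "\<forall>l<m. q l \<in> poly_over A n'" "p = (\<Sum>l<m. mconst (b ^ l) * q l)"
      "\<forall>l<m. q' l \<in> poly_over A n'" "p' = (\<Sum>l<m. mconst (b ^ l) * q' l)" unfolding M_def by blast
    show ?thesis
      using q MI[of "\<lambda>l. q l + q' l"] by (simp add: distrib_left sum.distrib P.add_closed)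
  qed
  have M_smult: "r * p \<in> M" if pr: "p \<in> M" "r \<in> poly_over A n'" for p r
  proof -
    from pr obtain q where q: "\<forall>l<m. q l \<in> poly_over A n'" "p = (\<Sum>l<m. mconst (b ^ l) * q l)"
      unfolding M_def by blast
    show ?thesis
      using q MI[of "\<lambda>l. r * q l"] pr by (simp add: sum_distrib_left mult_ac P.mult_closed)
  qed
  have M_0: "0 \<in> M" using MI[of "\<lambda>_. 0"] by (simp add: P.zero_closed)
  have M_sum: "sum f S \<in> M" if "\<And>i. i \<in> S \<Longrightarrow> f i \<in> M" for f :: "nat \<Rightarrow> complex mpoly" and S
    using that by (induction S rule: infinite_finite_induct) (auto intro: M_0 M_add)
  have M_b: "mconst b * p \<in> M" if pM: "p \<in> M" for p
  proof -
    from pM obtain q where q: "\<And>l. l < m \<Longrightarrow> q l \<in> poly_over A n'" "p = (\<Sum>l<m. mconst (b ^ l) * q l)"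
      unfolding M_def by blast
    obtain m' where m': "m = Suc m'" using m gr0_implies_Suc by blast
    \<comment> \<open>Multiplication by \<open>b\<close> shifts the coefficients, and the top power
      \<open>b ^ m\<close> is rewritten by \<open>rel\<close>.\<close>
    have top: "mconst (b ^ m) = (\<Sum>l<m. mconst (b ^ l) * mconst (\<gamma> l))"
      using rel(2) by (simp add: mconst.hom_sum mconst.hom_mult mult.commute)
    have "mconst b * p = (\<Sum>l<Suc m'. mconst (b ^ Suc l) * q l)"
      by (simp add: q(2) m' sum_distrib_left distrib_left mconst.hom_mult mult_ac)
    also have "\<dots> = (\<Sum>l<m'. mconst (b ^ Suc l) * q l) + mconst (b ^ m) * q m'"
      by (simp add: m')
    also have "(\<Sum>l<m'. mconst (b ^ Suc l) * q l) = (\<Sum>l<m. mconst (b ^ l) * (if l = 0 then 0 else q (l - 1)))"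
      unfolding m' by (subst sum.lessThan_Suc_shift) simp
    also have "mconst (b ^ m) * q m' = (\<Sum>l<m. mconst (b ^ l) * (mconst (\<gamma> l) * q m'))"
      by (simp add: top sum_distrib_right mult.assoc)
    finally show ?thesis
    proof (rule ssubst, intro M_add MI)
      fix l assume l: "l < m"
      show "(if l = 0 then 0 else q (l - 1)) \<in> poly_over A n'"
        using q(1)[of "l - 1"] l P.zero_closed by auto
      show "mconst (\<gamma> l) * q m' \<in> poly_over A n'"
        using q(1)[of m'] rel(1)[OF l] by (auto simp: m' intro: poly_over.intros)
    qed
  qed
  have M_bk: "mconst (b ^ k) * p \<in> M" if "p \<in> M" for p k
  proof (induction k)
    case (Suc k)
    then show ?case using M_b[of "mconst (b ^ k) * p"] by (simp add: mconst.hom_mult mult.assoc)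
  qed (use that in simp)
  have M_mult: "p * p' \<in> M" if pp: "p \<in> M" "p' \<in> M" for p p'
  proof -
    from pp obtain q where q: "\<And>l. l < m \<Longrightarrow> q l \<in> poly_over A n'" "p = (\<Sum>l<m. mconst (b ^ l) * q l)"
      unfolding M_def by blast
    have "p * p' = (\<Sum>l<m. mconst (b ^ l) * (q l * p'))"
      by (simp add: q(2) sum_distrib_right mult.assoc)
    also have "\<dots> \<in> M" using q(1) pp(2) by (intro M_sum M_bk M_smult) auto
    finally show ?thesis .
  qed
  have M_base: "p \<in> M" if pA: "p \<in> poly_over A n'" for p
  proof -
    have "(\<Sum>l<m. mconst (b ^ l) * (if l = 0 then p else 0)) = p"
      using m by (subst sum.remove[of _ 0]) auto
    then show ?thesis using MI[of "\<lambda>l. if l = 0 then p else 0"] pA P.zero_closed by auto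
  qed
  define \<xi> where "\<xi> j = (\<Sum>l<m. mconst (b ^ l) * mvar (j * m + l) :: complex mpoly)" for j
  have idx: "j * m + l < n'" if "j < n" "l < m" for j l
  proof -
    have "j * m + l < (j + 1) * m" using that by simp
    also have "\<dots> \<le> n * m" using that by (intro mult_le_mono1) simp
    finally show ?thesis by (simp add: n'_def)
  qed
  have in_M: "mpoly_subst \<xi> p \<in> M" if "p \<in> poly_over (adjoin A b) n" for p
    using that
  proof (induction rule: poly_over.induct)
    case (const c)
    then obtain q where q: "\<forall>k. coeff q k \<in> A" "c = poly q b" by (auto simp: adjoin_def)
    have "mconst c = (\<Sum>k\<le>degree q. mconst (b ^ k) * mconst (coeff q k))"
      by (simp add: q(2) poly_altdef mconst.hom_sum mconst.hom_mult mult.commute)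
    also have "\<dots> \<in> M" using q(1) by (intro M_sum M_bk M_base poly_over.const) auto
    finally show ?case by simp
  next
    case (var j)
    then show ?case using idx by (auto simp: \<xi>_def intro!: MI poly_over.var)
  qed (auto simp: subst.hom_add subst.hom_mult intro: M_add M_mult)
  define R where "R p q \<longleftrightarrow> (\<forall>l<m. q l \<in> poly_over A n') \<and> p = (\<Sum>l<m. mconst (b ^ l) * q l)" for p q
  define q where "q p = (SOME q. R p q)" for p
  have "R p (q p)" if "p \<in> M" for p
    unfolding q_def by (rule someI_ex[of "R p"]) (use that in \<open>simp add: M_def R_def\<close>)
  then have q: "(\<forall>l<m. q p l \<in> poly_over A n') \<and> p = (\<Sum>l<m. mconst (b ^ l) * q p l)" if "p \<in> M" for p
    using that unfolding R_def by simp
  define f where "f i = q (mpoly_subst \<xi> (F i))" for i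
  note f = q[OF in_M[OF keller_overD(1)[OF km]], THEN conjunct1, rule_format, folded f_def]
    q[OF in_M[OF keller_overD(1)[OF km]], THEN conjunct2, folded f_def]
  \<comment> \<open>The block of \<open>N'\<close> at (j, i) is the matrix of multiplication by the
    substituted N_ji in the basis of powers of \<open>b\<close>: its column \<open>l\<close> expands
    \<open>b ^ l\<close> times that entry.\<close>
  define \<nu> where "\<nu> j i l = q (mconst (b ^ l) * mpoly_subst \<xi> (N j i))" for j i l
  note \<nu> = q[OF M_bk[OF in_M[OF keller_overD(2)[OF km]]], THEN conjunct1, rule_format, folded \<nu>_def]
    q[OF M_bk[OF in_M[OF keller_overD(2)[OF km]]], THEN conjunct2, folded \<nu>_def]
  define F' where "F' k = f (k div m) (k mod m)" for k
  define N' where "N' k k' = \<nu> (k div m) (k' div m) (k' mod m) (k mod m)" for k k'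
  have split: "k div m < n" "k mod m < m" "k = (k div m) * m + k mod m" if "k < n'" for k
    using that m by (auto simp: n'_def less_mult_imp_div_less)
  have d\<xi>: "mpderiv (j * m + s) (\<xi> k) = (if k = j then mconst (b ^ s) else 0)" if "s < m" for j s k
  proof -
    have eq: "j * m + s = k * m + l \<longleftrightarrow> k = j \<and> l = s" if "l < m" for l
      using that \<open>s < m\<close> by (metis div_mult_self3 div_less add_0_right mod_less mod_mult_self3 m not_gr_zero)
    have "mpderiv (j * m + s) (\<xi> k) = (\<Sum>l<m. if l = s then (if k = j then mconst (b ^ s) else 0) else 0)"
      unfolding \<xi>_def mpderiv_sum by (intro sum.cong refl) (auto simp: eq)
    then show ?thesis using that by simp
  qed
  have id: "(\<Sum>j<n. \<Sum>s<m. mpderiv (j * m + s) (f i l) * \<nu> j i' l' s) = (if i = i' \<and> l = l' then 1 else 0)"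
    if il: "i < n" "l < m" and il': "i' < n" "l' < m" for i i' l l'
  proof -
    \<comment> \<open>\<open>W\<close> collects the errors in the rows over \<open>i\<close>.
      Weighted by the powers of \<open>b\<close> they add up to the identity for F and N multiplied
      by \<open>b ^ l'\<close>, so each vanishes by independence.\<close>
    define W where "W l = (\<Sum>j<n. \<Sum>s<m. mpderiv (j * m + s) (f i l) * \<nu> j i' l' s)
      - (if i = i' \<and> l = l' then 1 else 0)" for l
    have WA: "W l \<in> poly_over A n'" if "l < m" for l
      using that il il' f(1) \<nu>(1) unfolding W_def
      by (intro P.diff_closed P.sum_closed P.mult_closed mpderiv_closed A) (auto intro: P.closed)
    have "(\<Sum>l<m. mconst (b ^ l) * (\<Sum>j<n. \<Sum>s<m. mpderiv (j * m + s) (f i l) * \<nu> j i' l' s))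
      = (\<Sum>j<n. \<Sum>s<m. (\<Sum>l<m. mconst (b ^ l) * mpderiv (j * m + s) (f i l)) * \<nu> j i' l' s)"
      unfolding sum_distrib_left sum_distrib_right
      by (subst sum.swap, rule sum.cong[OF refl], subst sum.swap, simp add: mult.assoc)
    also have "\<dots> = (\<Sum>j<n. \<Sum>s<m. (mpoly_subst \<xi> (mpderiv j (F i)) * mconst (b ^ s)) * \<nu> j i' l' s)"
    proof (intro sum.cong refl, goal_cases)
      case (1 j s)
      have "(\<Sum>l<m. mconst (b ^ l) * mpderiv (j * m + s) (f i l)) = mpderiv (j * m + s) (mpoly_subst \<xi> (F i))"
        by (simp add: f(2)[OF il(1)] mpderiv_sum)
      also have "\<dots> = (\<Sum>k<n. mpoly_subst \<xi> (mpderiv k (F i)) * (if k = j then mconst (b ^ s) else 0))"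
        using 1 by (simp add: mpderiv_subst[OF keller_overD(1)[OF km il(1)]] d\<xi>)
      also have "\<dots> = mpoly_subst \<xi> (mpderiv j (F i)) * mconst (b ^ s)"
        using 1 by (simp add: if_distrib cong: if_cong)
      finally show ?case by simp
    qed
    also have "\<dots> = (\<Sum>j<n. mpoly_subst \<xi> (mpderiv j (F i)) * (\<Sum>s<m. mconst (b ^ s) * \<nu> j i' l' s))"
      by (simp add: sum_distrib_left mult.assoc)
    also have "\<dots> = (\<Sum>j<n. mpoly_subst \<xi> (mpderiv j (F i)) * (mconst (b ^ l') * mpoly_subst \<xi> (N j i')))"
      using \<nu>(2) il' by (intro sum.cong) auto
    also have "\<dots> = mconst (b ^ l') * mpoly_subst \<xi> (\<Sum>j<n. mpderiv j (F i) * N j i')"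
      by (simp add: subst.hom_sum subst.hom_mult sum_distrib_left mult_ac)
    also have "\<dots> = (if i = i' then mconst (b ^ l') else 0)"
      using keller_overD(3)[OF km il(1) il'(1)] by simp
    also have "\<dots> = (\<Sum>l<m. mconst (b ^ l) * (if i = i' \<and> l = l' then 1 else 0))"
      using il' by (simp add: if_distrib cong: if_cong)
    finally have "(\<Sum>l<m. mconst (b ^ l) * W l) = 0"
      by (simp add: W_def right_diff_distrib sum_subtractf)
    then have "W l = 0"
      by (intro mpoly_independent[OF A, where L = "{..<m}" and e = "\<lambda>l. b ^ l" and p = W])
        (use indep il WA in auto)
    then show ?thesis by (simp add: W_def)
  qed
  have "keller_over A n' F' N'"
    unfolding keller_over_def
  proof (intro conjI allI impI)
    fix k k' assume k: "k < n'" "k' < n'"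
    show "F' k \<in> poly_over A n'" using f(1) split k by (simp add: F'_def)
    show "N' k k' \<in> poly_over A n'" using \<nu>(1) split k by (simp add: N'_def)
    have "(\<Sum>j<n'. mpderiv j (F' k) * N' j k') = (\<Sum>j<n. \<Sum>s<m.
        mpderiv (j * m + s) (f (k div m) (k mod m)) * \<nu> j (k' div m) (k' mod m) s)"
      unfolding n'_def sum_blocks by (intro sum.cong refl) (auto simp: F'_def N'_def)
    also have "\<dots> = (if k div m = k' div m \<and> k mod m = k' mod m then 1 else 0)"
      using id split k by simp
    also have "\<dots> = (if k = k' then 1 else 0)"
      using split(3)[OF k(1)] split(3)[OF k(2)] by metis
    finally show "(\<Sum>j<n'. mpderiv j (F' k) * N' j k') = (if k = k' then 1 else 0)" .
  qed
  moreover have "right_invertible n F" if "right_invertible n' F'"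
  proof -
    from that obtain G where G: "\<And>j. j < n' \<Longrightarrow> G j \<in> poly_over UNIV n'"
      "\<And>y i. i < n' \<Longrightarrow> mpoly_eval (\<lambda>j. mpoly_eval y (G j)) (F' i) = y i"
      unfolding right_invertible_def by blast
    \<comment> \<open>Each y_j is placed in component 0 of its block, whose basis element is
      1.\<close>
    define \<eta> where "\<eta> k = (if k mod m = 0 then mvar (k div m) else 0 :: complex mpoly)" for k
    show ?thesis
      unfolding right_invertible_def
    proof (intro exI[of _ "\<lambda>j. \<Sum>s<m. mconst (b ^ s) * mpoly_subst \<eta> (G (j * m + s))"] conjI allI impI)
      fix j assume "j < n"
      then show "(\<Sum>s<m. mconst (b ^ s) * mpoly_subst \<eta> (G (j * m + s))) \<in> poly_over UNIV n"
        using G(1) idx split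
        by (intro PU.sum_closed PU.mult_closed poly_over.const subst_closed[of _ UNIV n'])
          (auto simp: \<eta>_def intro: poly_over.var PU.zero_closed)
    next
      fix y :: "nat \<Rightarrow> complex" and i assume i: "i < n"
      define y' where "y' k = (if k mod m = 0 then y (k div m) else 0)" for k
      define z where "z k = mpoly_eval y' (G k)" for k
      have e: "mpoly_eval y (mpoly_subst \<eta> p) = mpoly_eval y' p" for p
        unfolding eval_subst by (intro arg_cong2[where f = mpoly_eval]) (auto simp: \<eta>_def y'_def)
      have "mpoly_eval (\<lambda>j. mpoly_eval y (\<Sum>s<m. mconst (b ^ s) * mpoly_subst \<eta> (G (j * m + s)))) (F i)
        = mpoly_eval z (mpoly_subst \<xi> (F i))"
        by (simp add: eval_subst[of z] \<xi>_def eval.hom_sum eval.hom_mult e z_def)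
      also have "\<dots> = (\<Sum>l<m. b ^ l * mpoly_eval z (f i l))"
        by (simp add: f(2)[OF i] eval.hom_sum eval.hom_mult)
      also have "\<dots> = (\<Sum>l<m. b ^ l * y' (i * m + l))"
      proof (intro sum.cong refl)
        fix l assume "l \<in> {..<m}"
        then show "b ^ l * mpoly_eval z (f i l) = b ^ l * y' (i * m + l)"
          using G(2)[OF idx[OF i], of l y'] by (simp add: F'_def z_def[abs_def])
      qed
      also have "\<dots> = (\<Sum>l<m. if l = 0 then y i else 0)"
        by (intro sum.cong) (auto simp: y'_def)
      also have "\<dots> = y i" using m by simp
      finally show "mpoly_eval (\<lambda>j. mpoly_eval y (\<Sum>s<m. mconst (b ^ s) * mpoly_subst \<eta> (G (j * m + s)))) (F i) = y i" .
    qed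
  qed
  ultimately show ?thesis using nr by (auto simp: counterexample_over_def)
qed

subsection \<open>Adjoining finitely many generators\<close>

text \<open>An algebraic \<open>a\<close> need not be integral over \<open>A\<close>, so
  \<open>adjoin A a\<close> need not be free. With \<open>s\<close> the leading coefficient of a
  polynomial of least degree killing \<open>a\<close>, the multiple \<open>b = s * a\<close> is
  integral and its lower powers are independent by minimality. A power of \<open>s\<close> carries
  any given element of \<open>adjoin A a\<close> into \<open>adjoin A b\<close>, and the dilation by
  such a power removes the denominators.\<close>

lemma counterexample_adjoin:
  assumes A: "subring A" and "counterexample_over (adjoin A a)"
  shows "counterexample_over A"
proof (cases "\<forall>p. (\<forall>k. coeff p k \<in> A) \<longrightarrow> poly p a = 0 \<longrightarrow> p = 0")
  case True
  then show ?thesis using counterexample_adjoin_transcendental[OF A _ assms(2)] by blast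
next
  case False
  interpret A: subring A by fact
  define Q where "Q m \<longleftrightarrow> (\<exists>p. (\<forall>k. coeff p k \<in> A) \<and> poly p a = 0 \<and> p \<noteq> 0 \<and> degree p = m)" for m
  define m where "m = (LEAST m. Q m)"
  have "\<exists>m. Q m" using False unfolding Q_def by blast
  then have "Q m" unfolding m_def by (rule LeastI_ex)
  then obtain p where p: "\<forall>k. coeff p k \<in> A" "poly p a = 0" "p \<noteq> 0" "degree p = m"
    unfolding Q_def by blast
  have least: "q = 0" if "\<forall>k. coeff q k \<in> A" "poly q a = 0" "degree q < m" for q
    using not_less_Least[of "degree q" Q] that unfolding Q_def m_def by blast
  have m: "m > 0"
  proof (rule ccontr)
    assume "\<not> m > 0"
    then obtain c where "p = [:c:]" using p(4) degree_eq_zeroE by blast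
    with p show False by simp
  qed
  define s where "s = coeff p m"
  have s: "s \<in> A" "s \<noteq> 0" using p by (auto simp: s_def)
  define b where "b = s * a"
  obtain m' where m': "m = Suc m'" using m gr0_implies_Suc by blast
  \<comment> \<open>Multiplying the relation of \<open>a\<close> by \<open>s ^ (m - 1)\<close> turns
    it into a monic relation for \<open>b\<close>.\<close>
  have "0 = s ^ m' * poly p a" using p by simp
  also have "\<dots> = (\<Sum>k\<le>m. s ^ m' * (coeff p k * a ^ k))"
    by (simp add: poly_altdef p(4) sum_distrib_left)
  also have "\<dots> = s ^ m' * (s * a ^ m) + (\<Sum>k<m. s ^ m' * (coeff p k * a ^ k))"
    by (simp add: s_def flip: lessThan_Suc_atMost)
  also have "s ^ m' * (s * a ^ m) = b ^ m"
    by (simp add: b_def m' power_mult_distrib)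
  also have "(\<Sum>k<m. s ^ m' * (coeff p k * a ^ k)) = (\<Sum>k<m. coeff p k * s ^ (m' - k) * b ^ k)"
  proof (intro sum.cong refl)
    fix k assume "k \<in> {..<m}"
    then have "s ^ m' = s ^ (m' - k) * s ^ k" by (simp add: m' flip: power_add)
    then show "s ^ m' * (coeff p k * a ^ k) = coeff p k * s ^ (m' - k) * b ^ k"
      by (simp add: b_def power_mult_distrib)
  qed
  finally have "b ^ m = - (\<Sum>k<m. coeff p k * s ^ (m' - k) * b ^ k)"
    by (simp add: eq_neg_iff_add_eq_0)
  then have rel: "b ^ m = (\<Sum>k<m. - (coeff p k * s ^ (m' - k)) * b ^ k)"
    by (simp add: sum_negf)
  have indep: "\<forall>l<m. c l = 0" if c: "\<And>l. l < m \<Longrightarrow> c l \<in> A" "(\<Sum>l<m. c l * b ^ l) = 0" for c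
  proof -
    let ?q = "\<Sum>l<m. monom (c l * s ^ l) l"
    have cf: "coeff ?q k = (if k < m then c k * s ^ k else 0)" for k
      by (simp add: coeff_sum)
    have "degree ?q < m"
      using m by (intro le_less_trans[OF degree_sum_le[of "{..<m}" _ m']])
        (auto simp: m' intro!: order.trans[OF degree_monom_le])
    moreover have "poly ?q a = 0"
      using c(2) by (simp add: poly_sum poly_monom b_def power_mult_distrib mult.assoc)
    moreover have "coeff ?q k \<in> A" for k
      using c(1) s by (auto simp: cf intro: A.closed)
    ultimately have "?q = 0" by (intro least) auto
    then have "\<forall>l<m. c l * s ^ l = 0" using cf by (metis coeff_0)
    then show ?thesis using s by simp
  qed
  have B: "subring (adjoin A a)" "subring (adjoin A b)" by (intro subring_adjoin A)+
  interpret B: subring "adjoin A b" by (rule B)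
  have clear: "\<exists>L0. \<forall>L\<ge>L0. s ^ L * z \<in> adjoin A b" if z: "z \<in> adjoin A a" for z
  proof -
    from z obtain q where q: "\<forall>k. coeff q k \<in> A" "z = poly q a" unfolding adjoin_def by blast
    have "s ^ L * z \<in> adjoin A b" if L: "degree q \<le> L" for L
    proof -
      have "s ^ L * z = (\<Sum>k\<le>degree q. coeff q k * s ^ (L - k) * b ^ k)"
        unfolding q(2) poly_altdef sum_distrib_left
      proof (intro sum.cong refl)
        fix k assume "k \<in> {..degree q}"
        then have "s ^ L = s ^ (L - k) * s ^ k" using L by (simp flip: power_add)
        then show "s ^ L * (coeff q k * a ^ k) = coeff q k * s ^ (L - k) * b ^ k"
          by (simp add: b_def power_mult_distrib)
      qed
      also have "\<dots> \<in> adjoin A b"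
        using q(1) s(1) adjoin_base[OF A] adjoin_gen[OF A] by (intro B.closed) auto
      finally show ?thesis .
    qed
    then show ?thesis by blast
  qed
  from assms(2) obtain n F0 N0 where km0: "keller_over (adjoin A a) n F0 N0" and nr0: "\<not> right_invertible n F0"
    by (auto simp: counterexample_over_def)
  obtain F N where km: "keller_over (adjoin A a) n F N" and nr: "\<not> right_invertible n F" and nf: "normalized n F"
  proof -
    have "\<forall>i. \<exists>d. tdeg_le d (F0 i)" using tdeg_le_exists by blast
    then obtain dd where dd: "\<And>i. tdeg_le (dd i) (F0 i)" by metis
    have "tdeg_le (\<Sum>i<n. dd i) (F0 i)" if "i < n" for i
      by (rule tdeg_le_mono[OF dd]) (use that in \<open>auto intro: member_le_sum\<close>)
    from keller_over_normalize[OF B(1) km0 nr0 this] that show ?thesis by blast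
  qed
  define Z where "Z = (\<Union>i<n. lookup (F i) ` keys (F i)) \<union>
    (\<Union>i<n. \<Union>j<n. lookup (N i j) ` keys (N i j))"
  have ZF: "i < n \<Longrightarrow> k \<in> keys (F i) \<Longrightarrow> lookup (F i) k \<in> Z" for i k
    unfolding Z_def by blast
  have ZN: "i < n \<Longrightarrow> j < n \<Longrightarrow> k \<in> keys (N i j) \<Longrightarrow> lookup (N i j) k \<in> Z" for i j k
    unfolding Z_def by blast
  have "finite Z" by (auto simp: Z_def)
  moreover have "Z \<subseteq> adjoin A a"
    using poly_over_coeff[OF B(1) keller_overD(1)[OF km]] poly_over_coeff[OF B(1) keller_overD(2)[OF km]] by (auto simp: Z_def)
  ultimately have "\<exists>L0. \<forall>z\<in>Z. \<forall>L\<ge>L0. s ^ L * z \<in> adjoin A b"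
  proof (induction Z rule: finite_induct)
    case (insert z Z)
    then obtain L1 L2 where "\<forall>z\<in>Z. \<forall>L\<ge>L1. s ^ L * z \<in> adjoin A b" "\<forall>L\<ge>L2. s ^ L * z \<in> adjoin A b"
      using clear[of z] by auto
    then show ?case by (intro exI[of _ "max L1 L2"]) auto
  qed auto
  then obtain L where L: "\<And>z. z \<in> Z \<Longrightarrow> s ^ L * z \<in> adjoin A b" by blast
  have "s ^ L * lookup (F i) k \<in> adjoin A b" if "i < n" for i k
    using L[OF ZF[OF that]] B.zero_closed
    by (cases "k \<in> keys (F i)") (auto simp: in_keys_iff)
  moreover have "s ^ L * lookup (N i j) k \<in> adjoin A b" if "i < n" "j < n" for i j k
    using L[OF ZN[OF that]] B.zero_closed
    by (cases "k \<in> keys (N i j)") (auto simp: in_keys_iff)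
  moreover have "s ^ L \<noteq> 0" "s ^ L \<in> adjoin A b"
    using s adjoin_base[OF A] by (auto intro: A.power_closed)
  ultimately have ceb: "counterexample_over (adjoin A b)"
    using keller_over_dilate[OF B(2) km nf, of "s ^ L"] nr unfolding counterexample_over_def by blast
  show ?thesis
    by (rule counterexample_adjoin_free[OF A m _ rel indep ceb]) (use p(1) s in \<open>auto intro: A.closed\<close>)
qed

fun adjoin_list :: "complex set \<Rightarrow> complex list \<Rightarrow> complex set" where
  "adjoin_list A [] = A"
| "adjoin_list A (a # as) = adjoin_list (adjoin A a) as"

lemma counterexample_adjoin_list: "subring A \<Longrightarrow> counterexample_over (adjoin_list A as) \<Longrightarrow> counterexample_over A"
  by (induction as arbitrary: A) (auto intro: counterexample_adjoin subring_adjoin)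

lemma subring_adjoin_list: "subring A \<Longrightarrow> subring (adjoin_list A as)"
  by (induction as arbitrary: A) (auto intro: subring_adjoin)

lemma adjoin_list_base: "subring A \<Longrightarrow> c \<in> A \<Longrightarrow> c \<in> adjoin_list A as"
  by (induction as arbitrary: A) (auto intro: subring_adjoin adjoin_base)

lemma adjoin_list_gen: "subring A \<Longrightarrow> a \<in> set as \<Longrightarrow> a \<in> adjoin_list A as"
  by (induction as arbitrary: A) (auto intro: subring_adjoin adjoin_gen adjoin_list_base)

theorem counterexample_UNIV_imp_Ints:
  assumes "counterexample_over UNIV"
  shows "counterexample_over \<int>"
proof -
  from assms obtain n F N where km: "keller_over UNIV n F N" and nr: "\<not> right_invertible n F"
    by (auto simp: counterexample_over_def)
  define Z where "Z = (\<Union>i<n. lookup (F i) ` keys (F i)) \<union>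
    (\<Union>i<n. \<Union>j<n. lookup (N i j) ` keys (N i j))"
  have ZF: "i < n \<Longrightarrow> k \<in> keys (F i) \<Longrightarrow> lookup (F i) k \<in> Z" for i k
    unfolding Z_def by blast
  have ZN: "i < n \<Longrightarrow> j < n \<Longrightarrow> k \<in> keys (N i j) \<Longrightarrow> lookup (N i j) k \<in> Z" for i j k
    unfolding Z_def by blast
  have "finite Z" by (auto simp: Z_def)
  then obtain as where as: "set as = Z" using finite_list by blast
  have R: "subring (adjoin_list \<int> as)" by (intro subring_adjoin_list subring_Ints)
  interpret R: subring "adjoin_list \<int> as" by (rule R)
  have Z: "z \<in> adjoin_list \<int> as" if "z \<in> Z" for z
    using adjoin_list_gen[OF subring_Ints] that as by blast
  have "F i \<in> poly_over (adjoin_list \<int> as) n" if "i < n" for i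
  proof -
    have "lookup (F i) m \<in> adjoin_list \<int> as" for m
      using Z[OF ZF[OF that]] R.zero_closed
      by (cases "m \<in> keys (F i)") (auto simp: in_keys_iff)
    then show ?thesis using keller_overD(1)[OF km that] by (simp add: poly_over_iff[OF R] polys_eq_poly_over)
  qed
  moreover have "N i j \<in> poly_over (adjoin_list \<int> as) n" if "i < n" "j < n" for i j
  proof -
    have "lookup (N i j) m \<in> adjoin_list \<int> as" for m
      using Z[OF ZN[OF that]] R.zero_closed
      by (cases "m \<in> keys (N i j)") (auto simp: in_keys_iff)
    then show ?thesis using keller_overD(2)[OF km that] by (simp add: poly_over_iff[OF R] polys_eq_poly_over)
  qed
  ultimately have "keller_over (adjoin_list \<int> as) n F N" using km unfolding keller_over_def by blast
  then have "counterexample_over (adjoin_list \<int> as)" using nr by (auto simp: counterexample_over_def)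
  then show ?thesis by (rule counterexample_adjoin_list[OF subring_Ints])
qed

section \<open>Reduction to degree three\<close>

text \<open>Each step replaces \<open>(\<dots>, F\<^sub>i, \<dots>)\<close> by
  \<open>(\<dots>, F\<^sub>i - (u + P) (v + Q), \<dots>, u + P, v + Q)\<close> with two new variables \<open>u\<close>, \<open>v\<close>,
  which removes the product \<open>P Q\<close> from \<open>F\<^sub>i\<close>.\<close>

lemma keller_over_remove_products:
  assumes A: "subring A" and d: "3 \<le> d"
  shows "keller_over A n F N \<Longrightarrow> \<not> right_invertible n F \<Longrightarrow>
    (\<And>i. i < n \<Longrightarrow> F i = C i + (\<Sum>(j, P, Q)\<leftarrow>L. if j = i then P * Q else 0)) \<Longrightarrow>
    (\<And>i. i < n \<Longrightarrow> tdeg_le d (C i)) \<Longrightarrow>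
    (\<And>j P Q. (j, P, Q) \<in> set L \<Longrightarrow> j < n \<and> P \<in> poly_over A n \<and> Q \<in> poly_over A n \<and>
      tdeg_le (d - 1) P \<and> tdeg_le (d - 1) Q) \<Longrightarrow>
    \<exists>n' F' N'. keller_over A n' F' N' \<and> \<not> right_invertible n' F' \<and> (\<forall>i<n'. tdeg_le d (F' i))"
proof (induction L arbitrary: n F N C)
  case Nil
  then show ?case by (intro exI[of _ n] exI[of _ F] exI[of _ N]) auto
next
  case (Cons t L)
  interpret A: subring A by fact
  interpret P2: subring "poly_over A (Suc (Suc n))" by (rule A.subring_poly_over)
  obtain i0 P Q where t: "t = (i0, P, Q)" by (cases t) auto
  have PQ: "i0 < n" "P \<in> poly_over A n" "Q \<in> poly_over A n" "tdeg_le (d - 1) P" "tdeg_le (d - 1) Q"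
    using Cons.prems(5)[of i0 P Q] by (auto simp: t)
  have up: "q \<in> poly_over A (Suc (Suc n))" if "q \<in> poly_over A n" for q
    by (rule poly_over_mono[OF that]) auto
  have up1: "q \<in> poly_over A (Suc n)" if "q \<in> poly_over A n" for q
    by (rule poly_over_mono[OF that]) auto
  let ?u = "mvar n :: complex mpoly" and ?v = "mvar (Suc n) :: complex mpoly"
  define F1 where "F1 = (\<lambda>i. if i < n then F i else ?u + P)"
  obtain N1 where km1: "keller_over A (Suc n) F1 N1"
    using keller_over_extend[OF A Cons.prems(1) PQ(2)] unfolding F1_def by blast
  define F2 where "F2 = (\<lambda>i. if i < Suc n then F1 i else ?v + Q)"
  obtain N2 where km2: "keller_over A (Suc (Suc n)) F2 N2"
    using keller_over_extend[OF A km1 up1[OF PQ(3)]] unfolding F2_def by blast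
  \<comment> \<open>The shear is written in target coordinates; pulled back by \<open>F2\<close>
    they become u + P and v + Q.\<close>
  define s where "s = - (?u * ?v)"
  define F3 where "F3 = (\<lambda>i. if i = i0 then F2 i + mpoly_subst F2 s else F2 i)"
  have "s \<in> poly_over A (Suc (Suc n))"
    unfolding s_def by (intro P2.closed poly_over.var) auto
  moreover have "mpderiv i0 s = 0"
    using PQ(1) by (simp add: s_def mpderiv_uminus mpderiv_mult)
  ultimately obtain N3 where km3: "keller_over A (Suc (Suc n)) F3 N3"
    using keller_over_shear[OF A km2, of s i0] PQ(1) unfolding F3_def by auto
  have F2s: "mpoly_subst F2 s = - ((?u + P) * (?v + Q))"
    by (simp add: s_def F2_def F1_def subst.hom_uminus subst.hom_mult)
  \<comment> \<open>The product P Q cancels in row \<open>i0\<close>; the leftover terms u v, u Q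
    and v P have degree at most \<open>d\<close>.\<close>
  define C3 where "C3 i = (if i < n then C i - (if i = i0 then ?u * ?v + ?u * Q + ?v * P else 0)
    else if i = n then ?u + P else ?v + Q)" for i
  have "\<not> right_invertible (Suc (Suc n)) F3"
  proof
    assume "right_invertible (Suc (Suc n)) F3"
    then obtain G where G: "\<And>j. j < Suc (Suc n) \<Longrightarrow> G j \<in> poly_over UNIV (Suc (Suc n))"
      "\<And>y i. i < Suc (Suc n) \<Longrightarrow> mpoly_eval (\<lambda>j. mpoly_eval y (G j)) (F3 i) = y i"
      unfolding right_invertible_def by blast
    define \<tau> where "\<tau> i = (if i < n then mvar i else 0 :: complex mpoly)" for i
    have "right_invertible n F"
      unfolding right_invertible_def
    proof (intro exI[of _ "\<lambda>j. mpoly_subst \<tau> (G j)"] conjI allI impI)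
      fix j assume "j < n"
      then show "mpoly_subst \<tau> (G j) \<in> poly_over UNIV n"
        using G(1)[of j] by (intro subst_closed[of _ UNIV "Suc (Suc n)"])
          (auto simp: \<tau>_def intro: poly_over.var PU.zero_closed)
    next
      fix y :: "nat \<Rightarrow> complex" and i assume i: "i < n"
      define y' where "y' i = (if i < n then y i else 0)" for i
      define z where "z j = mpoly_eval y' (G j)" for j
      have e: "mpoly_eval y (mpoly_subst \<tau> p) = mpoly_eval y' p" for p
        unfolding eval_subst by (intro arg_cong2[where f = mpoly_eval]) (auto simp: \<tau>_def y'_def)
      \<comment> \<open>With the new target coordinates set to 0, u + P vanishes at
        \<open>z\<close>, so the shear has no effect there.\<close>
      have "mpoly_eval z (?u + P) = 0"
        using G(2)[of n y'] PQ(1) by (simp add: F3_def F2_def F1_def y'_def z_def[abs_def])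
      then have "mpoly_eval z (F3 i) = mpoly_eval z (F i)"
        using i by (simp add: F3_def F2s eval.hom_add eval.hom_minus eval.hom_uminus eval.hom_mult)
          (simp add: F2_def F1_def eval.hom_add)
      then show "mpoly_eval (\<lambda>j. mpoly_eval y (mpoly_subst \<tau> (G j))) (F i) = y i"
        using G(2)[of i y'] i by (simp add: e y'_def z_def[abs_def])
    qed
    with Cons.prems(2) show False by simp
  qed
  moreover have "F3 i = C3 i + (\<Sum>(j, P, Q)\<leftarrow>L. if j = i then P * Q else 0)" if i: "i < Suc (Suc n)" for i
  proof (cases "i < n")
    case True
    then show ?thesis
      using Cons.prems(3)[OF True] F2s by (auto simp: F3_def C3_def F2_def F1_def t algebra_simps)
  next
    case False
    have "(\<Sum>(j, P, Q)\<leftarrow>L. if j = i then P * Q else 0) = (\<Sum>x\<leftarrow>L. 0)"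
      using Cons.prems(5) False by (intro arg_cong[where f = sum_list] map_cong) fastforce+
    then show ?thesis
      using False i PQ(1) by (auto simp: F3_def C3_def F2_def F1_def)
  qed
  moreover have "tdeg_le d (C3 i)" if "i < Suc (Suc n)" for i
  proof -
    have up: "tdeg_le d P" "tdeg_le d Q" "tdeg_le d ?u" "tdeg_le d ?v"
      using PQ d by (auto intro: tdeg_le_mono tdeg_le_mvar)
    have "tdeg_le (1 + 1) (?u * ?v)" "tdeg_le (1 + (d - 1)) (?u * Q)" "tdeg_le (1 + (d - 1)) (?v * P)"
      using PQ by (intro tdeg_le_mult tdeg_le_mvar; simp)+
    then have "tdeg_le d (?u * ?v)" "tdeg_le d (?u * Q)" "tdeg_le d (?v * P)"
      using d by (auto elim: tdeg_le_mono)
    then show ?thesis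
      using up Cons.prems(4)[of i] by (auto simp: C3_def intro!: tdeg_le_add tdeg_le_diff)
  qed
  moreover have "j < Suc (Suc n) \<and> P \<in> poly_over A (Suc (Suc n)) \<and> Q \<in> poly_over A (Suc (Suc n)) \<and>
      tdeg_le (d - 1) P \<and> tdeg_le (d - 1) Q" if "(j, P, Q) \<in> set L" for j P Q
    using Cons.prems(5)[of j P Q] that up by auto
  ultimately show ?case
    by (rule Cons.IH[OF km3])
qed

lemma monomial_split:
  assumes "k \<le> mdeg m"
  shows "\<exists>a b. m = a + b \<and> mdeg a = k"
  using assms
proof (induction k)
  case 0
  show ?case by (intro exI[of _ 0] exI[of _ m]) simp
next
  case (Suc k)
  then obtain a b where ab: "m = a + b" "mdeg a = k" by auto
  have "mdeg m = mdeg a + mdeg b" unfolding ab(1) by (rule mdeg_add)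
  then have "mdeg b \<noteq> 0" using Suc.prems ab(2) by linarith
  then obtain i where i: "i \<in> keys b" by (metis sum.empty all_not_in_conv)
  have "b = single i 1 + (b - single i 1)"
    using i by (intro poly_mapping_eqI) (auto simp: lookup_add lookup_minus lookup_single when_def in_keys_iff)
  then have "m = (a + single i 1) + (b - single i 1)"
    using ab(1) by (simp add: add.assoc)
  moreover have "mdeg (a + single i 1) = Suc k"
    using ab(2) by (simp only: mdeg_add mdeg_single)
  ultimately show ?case by blast
qed

lemma keller_over_reduce_degree:
  assumes A: "subring A" and d: "3 \<le> d" and km: "keller_over A n F N" and nr: "\<not> right_invertible n F"
    and deg: "\<And>i. i < n \<Longrightarrow> tdeg_le (Suc d) (F i)"
  shows "\<exists>n' F' N'. keller_over A n' F' N' \<and> \<not> right_invertible n' F' \<and> (\<forall>i<n'. tdeg_le d (F' i))"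
proof -
  interpret A: subring A by fact
  \<comment> \<open>Degree d + 1 splits as 2 + (d - 1), and both parts are at most d - 1 just when d
    is at least 3; hence the reduction ends in degree three.\<close>
  have "\<exists>a b. mdeg m = Suc d \<longrightarrow> m = a + b \<and> mdeg a = 2" for m
    using monomial_split[of 2 m] d by auto
  then obtain \<beta> \<gamma> where \<beta>\<gamma>: "\<And>m. mdeg m = Suc d \<Longrightarrow> m = \<beta> m + \<gamma> m \<and> mdeg (\<beta> m) = 2" by metis
  have \<gamma>: "mdeg (\<gamma> m) = d - 1" if "mdeg m = Suc d" for m
    using \<beta>\<gamma>[OF that] that mdeg_add[of "\<beta> m" "\<gamma> m"] by simp
  define T where "T i = {m \<in> keys (F i). mdeg m = Suc d}" for i
  define C where "C i = (\<Sum>m\<in>keys (F i) - T i. single m (lookup (F i) m))" for i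
  define S where "S = Sigma {..<n} T"
  have finT: "finite (T i)" for i by (simp add: T_def)
  have "finite S" by (simp add: S_def finT)
  then obtain xs where xs: "set xs = S" "distinct xs" using finite_distinct_list by blast
  define h where "h = (\<lambda>(i, m). (i, single (\<beta> m) (lookup (F i) m), single (\<gamma> m) 1 :: complex mpoly))"
  show ?thesis
  proof (rule keller_over_remove_products[OF A d km nr, where C = C and L = "map h xs"])
    fix i assume i: "i < n"
    have "(\<Sum>(j, P, Q)\<leftarrow>map h xs. if j = i then P * Q else 0)
      = (\<Sum>(j, m)\<leftarrow>xs. if j = i then single m (lookup (F j) m) else 0)"
    proof (simp only: map_map, intro arg_cong[where f = sum_list] map_cong refl)
      fix x assume "x \<in> set xs"
      then have "\<beta> (snd x) + \<gamma> (snd x) = snd x" using \<beta>\<gamma>[of "snd x"] xs(1) by (auto simp: S_def T_def)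
      then show "((\<lambda>(j, P, Q). if j = i then P * Q else 0) \<circ> h) x =
          (case x of (j, m) \<Rightarrow> if j = i then single m (lookup (F j) m) else 0)"
        by (cases x) (simp add: h_def mult_single)
    qed
    also have "\<dots> = (\<Sum>(j, m)\<in>S. if j = i then single m (lookup (F j) m) else 0)"
      by (simp only: sum_list_distinct_conv_sum_set[OF xs(2)] xs(1))
    also have "\<dots> = (\<Sum>j<n. \<Sum>m\<in>T j. if j = i then single m (lookup (F j) m) else 0)"
      unfolding S_def by (rule sum.Sigma[symmetric]) (auto simp: finT)
    also have "\<dots> = (\<Sum>j<n. if j = i then (\<Sum>m\<in>T i. single m (lookup (F i) m)) else 0)"
      by (intro sum.cong) auto
    also have "\<dots> = (\<Sum>m\<in>T i. single m (lookup (F i) m))"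
      using i by simp
    finally have e: "(\<Sum>(j, P, Q)\<leftarrow>map h xs. if j = i then P * Q else 0)
      = (\<Sum>m\<in>T i. single m (lookup (F i) m))" .
    show "F i = C i + (\<Sum>(j, P, Q)\<leftarrow>map h xs. if j = i then P * Q else 0)"
      unfolding e C_def by (subst sum.subset_diff[symmetric])
        (auto simp: T_def intro: poly_mapping_expand)
    show "tdeg_le d (C i)"
      unfolding C_def
    proof (rule tdeg_le_sum)
      fix m assume "m \<in> keys (F i) - T i"
      then have "mdeg m \<le> d" using deg[OF i] by (auto simp: tdeg_le_def T_def le_Suc_eq)
      then show "tdeg_le d (single m (lookup (F i) m))" by (auto simp: tdeg_le_def)
    qed
  next
    fix j P Q assume "(j, P, Q) \<in> set (map h xs)"
    then obtain m where m: "j < n" "m \<in> T j" "P = single (\<beta> m) (lookup (F j) m)"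
      "Q = single (\<gamma> m) 1"
      using xs(1) by (auto simp: S_def h_def)
    then have md: "mdeg m = Suc d" "keys m \<subseteq> {..<n}"
      using keller_overD(1)[OF km m(1)] by (auto simp: T_def poly_over_iff[OF A] polys_def)
    have "keys (\<beta> m) \<subseteq> keys m" "keys (\<gamma> m) \<subseteq> keys m"
      using \<beta>\<gamma>[OF md(1)] by (metis lookup_add add_is_0 in_keys_iff subsetI)+
    then show "j < n \<and> P \<in> poly_over A n \<and> Q \<in> poly_over A n \<and> tdeg_le (d - 1) P \<and> tdeg_le (d - 1) Q"
      using m(1,3,4) md \<beta>\<gamma>[OF md(1)] \<gamma>[OF md(1)] d poly_over_coeff[OF A keller_overD(1)[OF km m(1)]] A.one_closed
        subring.zero_closed[OF A.subring_poly_over, of n]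
      by (auto simp: tdeg_le_def intro!: single_in_poly_over[OF A])
  qed
qed

lemma counterexample_cubic:
  assumes A: "subring A" and "counterexample_over A"
  shows "\<exists>n F N. keller_over A n F N \<and> \<not> right_invertible n F \<and> normalized n F \<and> (\<forall>i<n. tdeg_le 3 (F i))"
proof -
  from assms(2) obtain n F N where km: "keller_over A n F N" and nr: "\<not> right_invertible n F"
    by (auto simp: counterexample_over_def)
  have "\<forall>i. \<exists>d. tdeg_le d (F i)" using tdeg_le_exists by blast
  then obtain dd where dd: "\<And>i. tdeg_le (dd i) (F i)" by metis
  have deg: "tdeg_le (3 + (\<Sum>i<n. dd i)) (F i)" if "i < n" for i
    by (rule tdeg_le_mono[OF dd]) (use that in \<open>auto intro: member_le_sum trans_le_add2\<close>)
  have "\<exists>n F N. keller_over A n F N \<and> \<not> right_invertible n F \<and> (\<forall>i<n. tdeg_le 3 (F i))"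
    if "keller_over A n F N" "\<not> right_invertible n F" "\<forall>i<n. tdeg_le (3 + k) (F i)" for n F N k
    using that
  proof (induction k arbitrary: n F N)
    case 0
    then show ?case by auto
  next
    case (Suc k)
    then obtain n' F' N' where "keller_over A n' F' N'" "\<not> right_invertible n' F'" "\<forall>i<n'. tdeg_le (3 + k) (F' i)"
      using keller_over_reduce_degree[OF A, of "3 + k" n F N] by auto
    then show ?case by (rule Suc.IH)
  qed
  from this[OF km nr] deg obtain n' F' N' where "keller_over A n' F' N'" "\<not> right_invertible n' F'" "\<forall>i<n'. tdeg_le 3 (F' i)"
    by blast
  then show ?thesis using keller_over_normalize[OF A, of n' F' N' 3] by metis
qed

section \<open>Power series solutions\<close>

lemma fps_const_hom: "comm_ring_hom (fps_const :: 'a::comm_ring_1 \<Rightarrow> 'a fps)"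
  by unfold_locales (auto simp: simp flip: fps_const_add fps_const_mult)

lemma pconst_hom: "comm_ring_hom (\<lambda>c::'a::comm_ring_1. [:c:])"
  by unfold_locales (auto simp: one_pCons)

abbreviation fev :: "(nat \<Rightarrow> complex fps) \<Rightarrow> complex mpoly \<Rightarrow> complex fps" where
  "fev \<equiv> mpoly_hom fps_const"

abbreviation pev :: "(nat \<Rightarrow> complex poly) \<Rightarrow> complex mpoly \<Rightarrow> complex poly" where
  "pev \<equiv> mpoly_hom (\<lambda>c. [:c:])"

global_interpretation fev: comm_ring_hom "fev \<xi>" for \<xi>
  by (rule comm_ring_hom_mpoly_hom[OF fps_const_hom])

global_interpretation pev: comm_ring_hom "pev \<xi>" for \<xi>
  by (rule comm_ring_hom_mpoly_hom[OF pconst_hom])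

lemma fev_mconst [simp]: "fev \<xi> (mconst c) = fps_const c"
  by (simp add: mpoly_hom_mconst)

lemma fev_mvar [simp]: "fev \<xi> (mvar i) = \<xi> i"
  by (simp add: mpoly_hom_mvar fps_const_hom)

lemma pev_mconst [simp]: "pev \<xi> (mconst c) = [:c:]"
  by (simp add: mpoly_hom_mconst)

lemma pev_mvar [simp]: "pev \<xi> (mvar i) = \<xi> i"
  by (simp add: mpoly_hom_mvar pconst_hom)

lemma poly_pev: "p \<in> poly_over A n \<Longrightarrow> poly (pev \<eta> p) t = mpoly_eval (\<lambda>i. poly (\<eta> i) t) p"
  by (induction rule: poly_over.induct) (auto simp: pev.hom_add pev.hom_mult eval.hom_add eval.hom_mult)

lemma fev_fps_of_poly: "p \<in> poly_over A n \<Longrightarrow> fev (\<lambda>i. fps_of_poly (\<eta> i)) p = fps_of_poly (pev \<eta> p)"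
  by (induction rule: poly_over.induct)
    (auto simp: pev.hom_add pev.hom_mult fev.hom_add fev.hom_mult fps_of_poly_add fps_of_poly_mult fps_of_poly_const)

lemma fev_nth_0: "p \<in> poly_over A n \<Longrightarrow> fps_nth (fev \<xi> p) 0 = mpoly_eval (\<lambda>i. fps_nth (\<xi> i) 0) p"
  by (induction rule: poly_over.induct) (auto simp: fev.hom_add fev.hom_mult eval.hom_add eval.hom_mult)

lemma fev_cong: "p \<in> poly_over A n \<Longrightarrow> (\<And>i. i < n \<Longrightarrow> x i = y i) \<Longrightarrow> fev x p = fev y p"
  by (rule mpoly_hom_cong) (auto intro: fps_const_hom)

lemma fev_closed:
  assumes A: "subring A" and "p \<in> poly_over A n" "\<And>i k. i < n \<Longrightarrow> fps_nth (\<xi> i) k \<in> A"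
  shows "fps_nth (fev \<xi> p) k \<in> A"
proof -
  interpret subring A by fact
  show ?thesis using assms(2)
    by (induction arbitrary: k rule: poly_over.induct)
      (auto simp: fev.hom_add fev.hom_mult fps_mult_nth assms(3) intro: closed)
qed

text \<open>Below order \<open>k\<close> the factors agree, so among the products forming the k-th
  coefficient only those pairing order 0 with order \<open>k\<close> can differ.\<close>

lemma fps_mult_nth_diff:
  fixes f g f' g' :: "complex fps"
  assumes "\<And>l. l < k \<Longrightarrow> fps_nth f l = fps_nth f' l" "\<And>l. l < k \<Longrightarrow> fps_nth g l = fps_nth g' l" "0 < k"
  shows "fps_nth (f * g) k - fps_nth (f' * g') k =
    fps_nth f 0 * (fps_nth g k - fps_nth g' k) + fps_nth g 0 * (fps_nth f k - fps_nth f' k)"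
proof -
  have "fps_nth (f * g) k - fps_nth (f' * g') k =
    (\<Sum>i=0..k. fps_nth f i * fps_nth g (k - i) - fps_nth f' i * fps_nth g' (k - i))"
    by (simp add: fps_mult_nth sum_subtractf)
  also have "\<dots> = (\<Sum>i=0..k. (if i = 0 then fps_nth f 0 * (fps_nth g k - fps_nth g' k) else 0)
      + (if i = k then fps_nth g 0 * (fps_nth f k - fps_nth f' k) else 0))"
    using assms by (intro sum.cong refl) (auto simp: algebra_simps)
  also have "\<dots> = fps_nth f 0 * (fps_nth g k - fps_nth g' k) + fps_nth g 0 * (fps_nth f k - fps_nth f' k)"
    by (simp add: sum.distrib)
  finally show ?thesis .
qed

text \<open>First order Taylor expansion at the leading discrepancy of two power series.\<close>

lemma fev_discrepancy:
  assumes "p \<in> poly_over A n" "\<And>i l. i < n \<Longrightarrow> l < k \<Longrightarrow> fps_nth (\<xi> i) l = fps_nth (\<eta> i) l" "0 < k"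
  shows "(\<forall>l<k. fps_nth (fev \<xi> p) l = fps_nth (fev \<eta> p) l) \<and>
    fps_nth (fev \<xi> p) k - fps_nth (fev \<eta> p) k =
      (\<Sum>j<n. mpoly_eval (\<lambda>i. fps_nth (\<xi> i) 0) (mpderiv j p) * (fps_nth (\<xi> j) k - fps_nth (\<eta> j) k))"
  using assms(1)
proof (induction rule: poly_over.induct)
  case (const c)
  then show ?case by simp
next
  case (var i)
  then show ?case using assms(2)[OF var]
    by (auto simp: if_distrib if_distribR cong: if_cong)
next
  case (add p q)
  then show ?case
    by (auto simp: fev.hom_add mpderiv_add eval.hom_add sum.distrib sum_subtractf algebra_simps)
next
  case (mult p q)
  have "fps_nth (fev \<xi> (p * q)) l = fps_nth (fev \<eta> (p * q)) l" if "l < k" for l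
    using mult.IH that by (auto simp: fev.hom_mult fps_mult_nth intro!: sum.cong)
  moreover have "fps_nth (fev \<xi> (p * q)) k - fps_nth (fev \<eta> (p * q)) k =
      (\<Sum>j<n. mpoly_eval (\<lambda>i. fps_nth (\<xi> i) 0) (mpderiv j (p * q)) * (fps_nth (\<xi> j) k - fps_nth (\<eta> j) k))"
  proof -
    let ?e = "mpoly_eval (\<lambda>i. fps_nth (\<xi> i) 0)"
    have "fps_nth (fev \<xi> (p * q)) k - fps_nth (fev \<eta> (p * q)) k =
        ?e p * (fps_nth (fev \<xi> q) k - fps_nth (fev \<eta> q) k) + ?e q * (fps_nth (fev \<xi> p) k - fps_nth (fev \<eta> p) k)"
      unfolding fev.hom_mult fev_nth_0[OF mult.hyps(1), symmetric] fev_nth_0[OF mult.hyps(2), symmetric]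
      by (rule fps_mult_nth_diff) (use mult.IH assms(3) in auto)
    also have "\<dots> = ?e p * (\<Sum>j<n. ?e (mpderiv j q) * (fps_nth (\<xi> j) k - fps_nth (\<eta> j) k))
        + ?e q * (\<Sum>j<n. ?e (mpderiv j p) * (fps_nth (\<xi> j) k - fps_nth (\<eta> j) k))"
      unfolding mult.IH(1)[THEN conjunct2] mult.IH(2)[THEN conjunct2] ..
    also have "\<dots> = (\<Sum>j<n. ?e (mpderiv j (p * q)) * (fps_nth (\<xi> j) k - fps_nth (\<eta> j) k))"
      unfolding sum_distrib_left sum.distrib[symmetric]
      by (intro sum.cong refl) (simp add: mpderiv_mult eval.hom_add eval.hom_mult algebra_simps)
    finally show ?thesis .
  qed
  ultimately show ?case by blast
qed

text \<open>Uniqueness in the formal inverse function theorem: by \<open>fev_discrepancy\<close> the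
  first nonzero difference of coefficients would lie in the kernel of the Jacobian at the starting
  point, which is invertible.\<close>

lemma fps_solution_unique:
  assumes km: "keller_over A n F N"
    and "\<And>i. i < n \<Longrightarrow> fps_nth (\<xi> i) 0 = fps_nth (\<eta> i) 0"
    and eq: "\<And>i. i < n \<Longrightarrow> fev \<xi> (F i) = fev \<eta> (F i)"
    and "i < n"
  shows "\<xi> i = \<eta> i"
proof -
  have "\<forall>i<n. fps_nth (\<xi> i) k = fps_nth (\<eta> i) k" for k
  proof (induction k rule: less_induct)
    case (less k)
    show ?case
    proof (cases "k = 0")
      case True
      then show ?thesis using assms(2) by simp
    next
      case False
      define \<delta> where "\<delta> j = fps_nth (\<xi> j) k - fps_nth (\<eta> j) k" for j
      let ?e = "mpoly_eval (\<lambda>i. fps_nth (\<xi> i) 0)"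
      have 0: "(\<Sum>j<n. ?e (mpderiv j (F i)) * \<delta> j) = 0" if "i < n" for i
        using fev_discrepancy[OF keller_overD(1)[OF km that], of k \<xi> \<eta>] less False eq[OF that] by (auto simp: \<delta>_def)
      have "\<delta> l = 0" if l: "l < n" for l
      proof -
        have "\<delta> l = (\<Sum>j<n. (if l = j then 1 else 0) * \<delta> j)" using l by (simp add: sum_delta_swap(1)[OF l])
        also have "\<dots> = (\<Sum>j<n. (\<Sum>i<n. ?e (N l i) * ?e (mpderiv j (F i))) * \<delta> j)"
          using keller_over_left_inverse[OF km l] by (intro sum.cong) auto
        also have "\<dots> = (\<Sum>i<n. ?e (N l i) * (\<Sum>j<n. ?e (mpderiv j (F i)) * \<delta> j))"
          unfolding sum_distrib_left sum_distrib_right by (subst sum.swap) (simp add: mult_ac)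
        also have "\<dots> = 0" using 0 by simp
        finally show ?thesis .
      qed
      then show ?thesis by (simp add: \<delta>_def)
    qed
  qed
  then show ?thesis using \<open>i < n\<close> by (auto simp: fps_eq_iff)
qed

subsection \<open>The derivation dual to a line\<close>

text \<open>The derivation along the vector field N c, that is DF^(-1) c; along it F moves with
  constant velocity \<open>c\<close>.\<close>

definition flow_deriv :: "nat \<Rightarrow> (nat \<Rightarrow> nat \<Rightarrow> complex mpoly) \<Rightarrow> (nat \<Rightarrow> complex) \<Rightarrow> complex mpoly \<Rightarrow> complex mpoly" where
  "flow_deriv n N c p = (\<Sum>j<n. (\<Sum>l<n. N j l * mconst (c l)) * mpderiv j p)"

text \<open>The Lie series of this field: the Taylor expansion of \<open>p\<close> along the
  integral curve from \<open>w\<close>. On the variables it is the branch of F = F(w) + t c starting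
  at \<open>w\<close>, defined without any convergence.\<close>

definition flow :: "nat \<Rightarrow> (nat \<Rightarrow> nat \<Rightarrow> complex mpoly) \<Rightarrow> (nat \<Rightarrow> complex) \<Rightarrow> (nat \<Rightarrow> complex) \<Rightarrow>
    complex mpoly \<Rightarrow> complex fps" where
  "flow n N c w p = Abs_fps (\<lambda>k. mpoly_eval w ((flow_deriv n N c ^^ k) p) / fact k)"

lemma flow_deriv_add: "flow_deriv n N c (p + q) = flow_deriv n N c p + flow_deriv n N c q"
  by (simp add: flow_deriv_def mpderiv_add distrib_left sum.distrib)

lemma flow_deriv_mult: "flow_deriv n N c (p * q) = flow_deriv n N c p * q + p * flow_deriv n N c q"
  by (simp add: flow_deriv_def mpderiv_mult distrib_left sum.distrib sum_distrib_left sum_distrib_right mult_ac)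

lemma flow_deriv_mconst [simp]: "flow_deriv n N c (mconst a) = 0"
  by (simp add: flow_deriv_def)

lemma flow_deriv_zero [simp]: "flow_deriv n N c 0 = 0"
  by (simp add: flow_deriv_def)

lemma flow_deriv_pow_zero [simp]: "(flow_deriv n N c ^^ k) 0 = 0"
  by (induction k) auto

lemma flow_deriv_pow_add: "(flow_deriv n N c ^^ k) (p + q) = (flow_deriv n N c ^^ k) p + (flow_deriv n N c ^^ k) q"
  by (induction k) (auto simp: flow_deriv_add)

lemma flow_deriv_closed:
  assumes "keller_over A n F N" "p \<in> poly_over UNIV n"
  shows "(flow_deriv n N c ^^ k) p \<in> poly_over UNIV n"
proof (induction k)
  case (Suc k)
  have "N j l \<in> poly_over UNIV n" if "j < n" "l < n" for j l
    using keller_overD(2)[OF assms(1) that] by (rule poly_over_UNIV)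
  then show ?case using Suc unfolding funpow.simps comp_def flow_deriv_def
    by (intro PU.closed mpderiv_closed subring_UNIV poly_over.const) auto
qed (use assms in simp)

lemma flow_deriv_F:
  assumes "keller_over A n F N" "i < n"
  shows "flow_deriv n N c (F i) = mconst (c i)"
proof -
  have "flow_deriv n N c (F i) = (\<Sum>l<n. (\<Sum>j<n. mpderiv j (F i) * N j l) * mconst (c l))"
    unfolding flow_deriv_def sum_distrib_left sum_distrib_right by (subst sum.swap) (simp add: mult_ac)
  also have "\<dots> = (\<Sum>l<n. (if i = l then 1 else 0) * mconst (c l))"
    using keller_overD(3)[OF assms] by (intro sum.cong) auto
  finally show ?thesis using assms(2) by (simp add: sum_delta_swap(1)[OF assms(2)])
qed

lemma fps_deriv_flow: "fps_deriv (flow n N c w p) = flow n N c w (flow_deriv n N c p)"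
  by (simp add: fps_eq_iff flow_def funpow_swap1 del: of_nat_Suc)

lemma flow_nth_0 [simp]: "fps_nth (flow n N c w p) 0 = mpoly_eval w p"
  by (simp add: flow_def)

lemma flow_add: "flow n N c w (p + q) = flow n N c w p + flow n N c w q"
  by (simp add: fps_eq_iff flow_def flow_deriv_pow_add eval.hom_add add_divide_distrib)

text \<open>Both sides have the same constant term, and the Leibniz rule expresses both derivatives
  by products of the same shape, which permits an induction on the coefficient for all
  \<open>p\<close> and \<open>q\<close> together.\<close>

lemma flow_mult: "flow n N c w (p * q) = flow n N c w p * flow n N c w q"
proof -
  have "fps_nth (flow n N c w (p * q)) k = fps_nth (flow n N c w p * flow n N c w q) k" for k
  proof (induction k arbitrary: p q)
    case 0
    then show ?case by (simp add: eval.hom_mult)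
  next
    case (Suc k)
    have "of_nat (Suc k) * fps_nth (flow n N c w (p * q)) (Suc k) = fps_nth (fps_deriv (flow n N c w (p * q))) k"
      by simp
    also have "\<dots> = fps_nth (fps_deriv (flow n N c w p * flow n N c w q)) k"
      by (simp add: fps_deriv_flow flow_deriv_mult flow_add Suc.IH)
    also have "\<dots> = of_nat (Suc k) * fps_nth (flow n N c w p * flow n N c w q) (Suc k)"
      by (simp only: fps_deriv_nth Suc_eq_plus1)
    finally show ?case by (simp del: of_nat_Suc)
  qed
  then show ?thesis by (simp add: fps_eq_iff)
qed

lemma flow_mconst [simp]: "flow n N c w (mconst a) = fps_const a"
proof (rule fps_ext)
  fix k show "fps_nth (flow n N c w (mconst a)) k = fps_nth (fps_const a) k"
    by (cases k) (simp_all add: flow_def funpow_swap1)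
qed

lemma flow_hom: "comm_ring_hom (flow n N c w)"
proof
  show "flow n N c w 0 = 0" using flow_mconst[of n N c w 0] by simp
  show "flow n N c w 1 = 1" using flow_mconst[of n N c w 1] by simp
qed (auto simp: flow_add flow_mult)

lemma flow_eq_fev: "p \<in> poly_over A n \<Longrightarrow> flow n N c w p = fev (\<lambda>i. flow n N c w (mvar i)) p"
  by (rule hom_eq_on_poly_over[OF flow_hom comm_ring_hom_mpoly_hom[OF fps_const_hom]]) auto

lemma flow_F:
  assumes "keller_over A n F N" "i < n"
  shows "flow n N c w (F i) = fps_const (mpoly_eval w (F i)) + fps_const (c i) * fps_X"
proof (rule fps_ext)
  fix k
  show "fps_nth (flow n N c w (F i)) k = fps_nth (fps_const (mpoly_eval w (F i)) + fps_const (c i) * fps_X) k"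
  proof (cases k)
    case (Suc k')
    then have "fps_nth (flow n N c w (F i)) k =
        mpoly_eval w ((flow_deriv n N c ^^ k') (flow_deriv n N c (F i))) / fact k"
      by (simp add: flow_def funpow_swap1)
    then show ?thesis using Suc flow_deriv_F[OF assms, of c]
      by (cases k') (simp_all add: funpow_swap1)
  qed simp
qed

text \<open>The factorials in the Lie series hide integrality. It comes from the equation F = F(w) +
  t c instead: given the earlier coefficients, the k-th ones solve a linear system with matrix
  DF(w), whose inverse N(w) is integral.\<close>

lemma flow_integral:
  assumes km: "keller_over \<int> n F N" and w: "\<And>i. i < n \<Longrightarrow> w i \<in> \<int>" and c: "\<And>i. i < n \<Longrightarrow> c i \<in> \<int>" and "i < n"
  shows "fps_nth (flow n N c w (mvar i)) k \<in> \<int>"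
proof -
  define \<xi> where "\<xi> i = flow n N c w (mvar i)" for i
  have \<xi>0: "fps_nth (\<xi> i) 0 = w i" for i by (simp add: \<xi>_def)
  have "\<forall>i<n. fps_nth (\<xi> i) k \<in> \<int>" for k
  proof (induction k rule: less_induct)
    case (less k)
    show ?case
    proof (cases "k = 0")
      case True
      then show ?thesis using w \<xi>0 by simp
    next
      case False
      \<comment> \<open>The truncation below order \<open>k\<close>. The difference \<open>z\<close>
        isolates the contribution of the k-th coefficients, and both of its terms are
        integral.\<close>
      define \<eta> where "\<eta> i = Abs_fps (\<lambda>l. if l < k then fps_nth (\<xi> i) l else 0)" for i
      define z where "z i = fps_nth (fev \<xi> (F i)) k - fps_nth (fev \<eta> (F i)) k" for i
      have zI: "z i \<in> \<int>" if i: "i < n" for i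
      proof -
        have "fev \<xi> (F i) = fps_const (mpoly_eval w (F i)) + fps_const (c i) * fps_X"
          using flow_eq_fev[OF keller_overD(1)[OF km i], of N c w] flow_F[OF km i, of c w] by (simp add: \<xi>_def[abs_def])
        then have "fps_nth (fev \<xi> (F i)) k \<in> \<int>"
          using False c[OF i] by (auto simp: fps_X_nth)
        moreover have "fps_nth (fev \<eta> (F i)) k \<in> \<int>"
          by (rule fev_closed[OF subring_Ints keller_overD(1)[OF km i]]) (use less in \<open>auto simp: \<eta>_def\<close>)
        ultimately show ?thesis by (simp add: z_def)
      qed
      have w0: "mpoly_eval (\<lambda>i. fps_nth (\<xi> i) 0) p = mpoly_eval w p" for p by (simp add: \<xi>0)
      have z: "z i = (\<Sum>j<n. mpoly_eval w (mpderiv j (F i)) * fps_nth (\<xi> j) k)" if "i < n" for i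
        using fev_discrepancy[OF keller_overD(1)[OF km that], of k \<xi> \<eta>] False
        by (simp add: z_def \<eta>_def w0)
      have "fps_nth (\<xi> l) k \<in> \<int>" if l: "l < n" for l
      proof -
        have "fps_nth (\<xi> l) k = (\<Sum>j<n. (if l = j then 1 else 0) * fps_nth (\<xi> j) k)"
          using l by (simp add: sum_delta_swap(1)[OF l])
        also have "\<dots> = (\<Sum>j<n. (\<Sum>i<n. mpoly_eval w (N l i) * mpoly_eval w (mpderiv j (F i))) * fps_nth (\<xi> j) k)"
          using keller_over_left_inverse[OF km l] by (intro sum.cong) auto
        also have "\<dots> = (\<Sum>i<n. mpoly_eval w (N l i) * z i)"
          unfolding sum_distrib_left sum_distrib_right
          by (subst sum.swap) (simp add: mult_ac z sum_distrib_left)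
        also have "\<dots> \<in> \<int>"
          using zI eval_closed[OF subring_Ints keller_overD(2)[OF km l], of _ w] w
          by (intro subring.sum_closed[OF subring_Ints] Ints_mult) auto
        finally show ?thesis .
      qed
      then show ?thesis by blast
    qed
  qed
  then show ?thesis using \<open>i < n\<close> by (simp add: \<xi>_def)
qed

subsection \<open>Estimates\<close>

definition norm1 :: "complex mpoly \<Rightarrow> real" where
  "norm1 p = (\<Sum>m\<in>keys p. norm (lookup p m))"

lemma norm1_superset:
  assumes "finite S" "keys p \<subseteq> S"
  shows "norm1 p = (\<Sum>m\<in>S. norm (lookup p m))"
  unfolding norm1_def using assms by (intro sum.mono_neutral_left) (auto simp: in_keys_iff)

lemma norm1_nonneg [simp]: "0 \<le> norm1 p"
  by (simp add: norm1_def sum_nonneg)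

lemma norm1_single [simp]: "norm1 (single m c) = norm c"
  by (subst norm1_superset[of "{m}"]) auto

lemma norm1_add: "norm1 (p + q) \<le> norm1 p + norm1 q"
proof -
  let ?S = "keys p \<union> keys q"
  have "norm1 (p + q) = (\<Sum>m\<in>?S. norm (lookup (p + q) m))"
    by (rule norm1_superset) (use keys_add[of p q] in auto)
  also have "\<dots> \<le> (\<Sum>m\<in>?S. norm (lookup p m) + norm (lookup q m))"
    by (intro sum_mono) (simp add: lookup_add norm_triangle_ineq)
  also have "\<dots> = norm1 p + norm1 q"
    unfolding sum.distrib by (subst (1 2) norm1_superset[of ?S]) auto
  finally show ?thesis .
qed

lemma norm1_sum: "norm1 (sum f S) \<le> (\<Sum>s\<in>S. norm1 (f s))"
proof (induction S rule: infinite_finite_induct)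
  case (insert x F)
  then show ?case using norm1_add[of "f x" "sum f F"] by simp
qed (simp_all add: norm1_def)

lemma norm1_mult: "norm1 (p * q) \<le> norm1 p * norm1 q"
proof -
  have "norm1 (p * q) = norm1 (\<Sum>a\<in>keys p. \<Sum>b\<in>keys q.
      single (a + b) (lookup p a * lookup q b))"
    by (subst poly_mapping_expand[of p], subst poly_mapping_expand[of q]) (simp only: sum_product mult_single)
  also have "\<dots> \<le> (\<Sum>a\<in>keys p. \<Sum>b\<in>keys q.
      norm1 (single (a + b) (lookup p a * lookup q b)))"
    by (rule order_trans[OF norm1_sum]) (intro sum_mono norm1_sum)
  also have "\<dots> = norm1 p * norm1 q"
    unfolding norm1_single norm_mult by (simp only: norm1_def sum_product)
  finally show ?thesis .
qed

lemma norm1_mpderiv: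
  assumes "tdeg_le d p"
  shows "norm1 (mpderiv i p) \<le> real d * norm1 p"
proof -
  have "norm1 (mpderiv i p) \<le> (\<Sum>m\<in>keys p. norm (of_nat (lookup m i) * lookup p m))"
    unfolding mpderiv_def by (rule order_trans[OF norm1_sum]) simp
  also have "\<dots> \<le> (\<Sum>m\<in>keys p. real d * norm (lookup p m))"
  proof (intro sum_mono)
    fix m assume m: "m \<in> keys p"
    have "lookup m i \<le> mdeg m"
      by (cases "i \<in> keys m") (auto simp: in_keys_iff intro: member_le_sum)
    then have "lookup m i \<le> d" using assms m by (force simp: tdeg_le_def)
    then show "norm (of_nat (lookup m i) * lookup p m) \<le> real d * norm (lookup p m)"
      by (auto simp: norm_mult intro: mult_right_mono)
  qed
  finally show ?thesis by (simp add: norm1_def sum_distrib_left)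
qed

lemma tdeg_le_mpderiv:
  assumes "tdeg_le d p"
  shows "tdeg_le d (mpderiv i p)"
  unfolding mpderiv_def
proof (rule tdeg_le_sum)
  fix m assume m: "m \<in> keys p"
  have "keys (m - single i 1) \<subseteq> keys m"
    by (auto simp: in_keys_iff lookup_minus)
  then have "mdeg (m - single i 1) = sum (lookup (m - single i 1)) (keys m)"
    by (intro mdeg_superset) auto
  also have "\<dots> \<le> mdeg m" by (intro sum_mono) (simp add: lookup_minus)
  also have "\<dots> \<le> d" using assms m by (auto simp: tdeg_le_def)
  finally show "tdeg_le d (single (m - single i 1)
      (of_nat (lookup m i) * lookup p m))" by (auto simp: tdeg_le_def)
qed

lemma norm_eval_le:
  assumes "p \<in> poly_over UNIV n" "tdeg_le d p" "1 \<le> M" "\<And>i. i < n \<Longrightarrow> norm (w i) \<le> M"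
  shows "norm (mpoly_eval w p) \<le> norm1 p * M ^ d"
proof -
  have "norm (mpoly_eval w p) \<le> (\<Sum>m\<in>keys p. norm (lookup p m * mmon w m))"
    unfolding mpoly_eval_hom mpoly_hom_def by (rule norm_sum)
  also have "\<dots> \<le> (\<Sum>m\<in>keys p. norm (lookup p m) * M ^ d)"
  proof (intro sum_mono)
    fix m assume m: "m \<in> keys p"
    have k: "i < n" if "i \<in> keys m" for i
      using assms(1) m that by (auto simp: polys_def simp flip: polys_eq_poly_over)
    have "norm (mmon w m) = (\<Prod>i\<in>keys m. norm (w i) ^ lookup m i)"
      by (simp add: mmon_def norm_power flip: prod_norm)
    also have "\<dots> \<le> (\<Prod>i\<in>keys m. M ^ lookup m i)"
      using k assms(4) by (intro prod_mono) (auto intro: power_mono)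
    also have "\<dots> = M ^ mdeg m" by (simp add: power_sum)
    also have "\<dots> \<le> M ^ d" using assms(2,3) m by (intro power_increasing) (auto simp: tdeg_le_def)
    finally show "norm (lookup p m * mmon w m) \<le> norm (lookup p m) * M ^ d"
      by (simp add: norm_mult mult_left_mono)
  qed
  finally show ?thesis by (simp add: norm1_def sum_distrib_right)
qed

text \<open>The field raises the degree by at most \<open>\<delta>\<close> and multiplies the norm
  by at most \<open>K0\<close> times the degree. The degree after \<open>k\<close> steps is linear
  in \<open>k\<close>, so these factors multiply to a factorial times a power, and the factorial
  cancels in the Taylor coefficients.\<close>

lemma flow_deriv_bound:
  obtains K \<delta> where "0 \<le> K" "\<And>k i. tdeg_le (1 + k * \<delta>) ((flow_deriv n N c ^^ k) (mvar i)) \<and>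
    norm1 ((flow_deriv n N c ^^ k) (mvar i)) \<le> fact k * K ^ k"
proof -
  define V where "V j = (\<Sum>l<n. N j l * mconst (c l))" for j
  have "\<forall>j. \<exists>d. tdeg_le d (V j)" using tdeg_le_exists by blast
  then obtain dd where dd: "\<And>j. tdeg_le (dd j) (V j)" by metis
  define \<delta> where "\<delta> = (\<Sum>j<n. dd j)"
  have \<delta>: "tdeg_le \<delta> (V j)" if "j < n" for j
    unfolding \<delta>_def by (rule tdeg_le_mono[OF dd]) (use that in \<open>auto intro: member_le_sum\<close>)
  define K0 where "K0 = (\<Sum>j<n. norm1 (V j))"
  have K0: "0 \<le> K0" by (simp add: K0_def sum_nonneg)
  define K where "K = (1 + real \<delta>) * K0"
  have K: "0 \<le> K" using K0 by (simp add: K_def)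
  have step: "tdeg_le (\<delta> + d) (flow_deriv n N c p)" "norm1 (flow_deriv n N c p) \<le> real d * K0 * norm1 p"
    if p: "tdeg_le d p" for d p
  proof -
    have e: "flow_deriv n N c p = (\<Sum>j<n. V j * mpderiv j p)" by (simp add: flow_deriv_def V_def)
    show "tdeg_le (\<delta> + d) (flow_deriv n N c p)"
      unfolding e using \<delta> p by (intro tdeg_le_sum tdeg_le_mult tdeg_le_mpderiv) auto
    have "norm1 (flow_deriv n N c p) \<le> (\<Sum>j<n. norm1 (V j) * (real d * norm1 p))"
      unfolding e using norm1_mpderiv[OF p]
      by (intro order_trans[OF norm1_sum] sum_mono order_trans[OF norm1_mult] mult_left_mono) auto
    then show "norm1 (flow_deriv n N c p) \<le> real d * K0 * norm1 p"
      by (simp add: K0_def sum_distrib_left sum_distrib_right mult_ac)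
  qed
  have "tdeg_le (1 + k * \<delta>) ((flow_deriv n N c ^^ k) (mvar i)) \<and>
      norm1 ((flow_deriv n N c ^^ k) (mvar i)) \<le> fact k * K ^ k" for k i
  proof (induction k)
    case 0
    have "norm1 (mvar i) = 1" by (simp only: mvar_def norm1_single norm_one)
    then show ?case by (simp add: tdeg_le_mvar)
  next
    case (Suc k)
    let ?p = "(flow_deriv n N c ^^ k) (mvar i)"
    have "norm1 (flow_deriv n N c ?p) \<le> real (1 + k * \<delta>) * K0 * norm1 ?p"
      using step(2) Suc by blast
    also have "\<dots> \<le> real (1 + k * \<delta>) * K0 * (fact k * K ^ k)"
      using Suc K0 by (intro mult_left_mono) auto
    also have "\<dots> \<le> (real (Suc k) * (1 + real \<delta>)) * K0 * (fact k * K ^ k)"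
      using K0 K by (intro mult_right_mono) (auto simp: algebra_simps)
    also have "\<dots> = fact (Suc k) * K ^ Suc k" by (simp add: K_def mult_ac)
    finally have "norm1 (flow_deriv n N c ?p) \<le> fact (Suc k) * K ^ Suc k" .
    moreover have "tdeg_le (1 + Suc k * \<delta>) (flow_deriv n N c ?p)"
      using step(1)[of "1 + k * \<delta>" ?p] Suc by (simp add: add_ac)
    ultimately show ?case by simp
  qed
  with K that show ?thesis by blast
qed


subsection \<open>Analytic continuation\<close>

lemma fps_conv_radius_ge_bounded:
  fixes f :: "complex fps"
  assumes "0 \<le> r" "\<And>k. norm (fps_nth f k) * r ^ k \<le> B"
  shows "ereal r \<le> fps_conv_radius f"
  unfolding fps_conv_radius_def
proof (rule conv_radius_geI_ex')
  fix s :: real assume s: "0 < s" "ereal s < ereal r"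
  then have "summable (\<lambda>k. norm (fps_nth f k) * s ^ k)"
    using assms by (intro Abel_lemma[of s r]) auto
  then show "summable (\<lambda>k. fps_nth f k * of_real s ^ k)"
    using s by (intro summable_norm_cancel[of "\<lambda>k. fps_nth f k * of_real s ^ k"]) (simp add: norm_mult norm_power)
qed

text \<open>The bound is given on the open disc only, so Cauchy's inequality is applied on smaller
  circles and the radius passes to the limit.\<close>

lemma fps_Cauchy_estimate:
  fixes f :: "complex fps"
  assumes r: "0 < r" "ereal r \<le> fps_conv_radius f"
    and B: "\<And>s. norm s < r \<Longrightarrow> norm (eval_fps f s) \<le> B"
  shows "norm (fps_nth f k) * r ^ k \<le> B"
proof -
  have *: "norm (fps_nth f k) * s ^ k \<le> B" if s: "0 < s" "s < r" for s
  proof -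
    have sub: "cball 0 s \<subseteq> eball (0::complex) (fps_conv_radius f)"
    proof
      fix x :: complex assume "x \<in> cball 0 s"
      then have "ereal (norm x) < ereal r" using s by simp
      from order.strict_trans2[OF this r(2)] show "x \<in> eball 0 (fps_conv_radius f)" by simp
    qed
    have "norm ((deriv ^^ k) (eval_fps f) 0) \<le> fact k * B / s ^ k"
    proof (rule Cauchy_inequality)
      show "eval_fps f holomorphic_on ball 0 s"
        using sub by (intro holomorphic_on_eval_fps) (auto simp: subset_iff)
      show "continuous_on (cball 0 s) (eval_fps f)"
        using sub by (intro holomorphic_on_imp_continuous_on holomorphic_on_eval_fps)
      show "norm (eval_fps f x) \<le> B" if "norm (0 - x) = s" for x
        using that s B by simp
    qed (rule s)
    moreover have "fps_conv_radius f > 0"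
      using r by (metis ereal_less(2) order.strict_trans2)
    then have "norm ((deriv ^^ k) (eval_fps f) 0) = fact k * norm (fps_nth f k)"
      by (simp add: fps_nth_conv_deriv norm_divide)
    ultimately have "fact k * norm (fps_nth f k) \<le> fact k * (B / s ^ k)" by simp
    then have "norm (fps_nth f k) \<le> B / s ^ k" by (simp only: mult_le_cancel_left_pos fact_gt_zero)
    then show ?thesis using s by (simp add: pos_le_divide_eq)
  qed
  have "((\<lambda>s. norm (fps_nth f k) * s ^ k) \<longlongrightarrow> norm (fps_nth f k) * r ^ k) (at_left r)"
    by (intro tendsto_intros)
  moreover have "eventually (\<lambda>s. norm (fps_nth f k) * s ^ k \<le> B) (at_left r)"
    using eventually_at_left_real[OF r(1)] by eventually_elim (use * in auto)
  ultimately show ?thesis by (rule tendsto_upperbound) simp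
qed

lemma flow_eval:
  assumes km: "keller_over A n F N" and r: "\<And>i. i < n \<Longrightarrow> ereal r \<le> fps_conv_radius (flow n N c w (mvar i))"
    and p: "p \<in> poly_over UNIV n"
  shows "ereal r \<le> fps_conv_radius (flow n N c w p) \<and> (\<forall>s. norm s < r \<longrightarrow>
    eval_fps (flow n N c w p) s = mpoly_eval (\<lambda>i. eval_fps (flow n N c w (mvar i)) s) p)"
  using p
proof (induction rule: poly_over.induct)
  case (const a)
  then show ?case by simp
next
  case (var i)
  then show ?case using r by simp
next
  case (add p q)
  have "ereal (norm s) < fps_conv_radius (flow n N c w p)" "ereal (norm s) < fps_conv_radius (flow n N c w q)"
    if "norm s < r" for s :: complex
    using add that by (meson ereal_less_eq less_ereal.simps(1) order.strict_trans2)+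
  then show ?case using add
    by (auto simp: flow_add eval_fps_add eval.hom_add intro: fps_conv_radius_add_ge)
next
  case (mult p q)
  have "ereal (norm s) < fps_conv_radius (flow n N c w p)" "ereal (norm s) < fps_conv_radius (flow n N c w q)"
    if "norm s < r" for s :: complex
    using mult that by (meson ereal_less_eq less_ereal.simps(1) order.strict_trans2)+
  then show ?case using mult
    by (auto simp: flow_mult eval_fps_mult eval.hom_mult intro: fps_conv_radius_mult_ge)
qed

lemma eval_fps_linear: "eval_fps (fps_const a + fps_const b * fps_X) s = a + b * (s :: complex)"
proof -
  have "\<infinity> \<le> fps_conv_radius (fps_const b * fps_X)"
    by (rule fps_conv_radius_mult_ge) simp_all
  then show ?thesis by (simp add: eval_fps_add eval_fps_mult)
qed

lemma geometric_half_le: "(\<Sum>j\<le>k. (1 / 2 :: real) ^ j) \<le> 2"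
proof -
  have "(\<Sum>j\<le>k. (1 / 2 :: real) ^ j) = 2 - (1 / 2) ^ k"
    by (induction k) auto
  then show ?thesis by simp
qed

text \<open>If all points over the disc of radius 2 around \<open>y\<close> are bounded by \<open>M\<close>, then the local
  inverse branches have a common radius of convergence there; in terms of the Taylor coefficients at
  the centre, a bound on \<open>norm (\<xi> k) * r ^ k\<close> improves to one on \<open>norm (\<xi> k) * (r + u) ^ k\<close>.\<close>

lemma flow_radius:
  assumes km: "keller_over A n F N" and M: "1 \<le> M"
    and proper: "\<And>t z. norm (t - y) < 2 \<Longrightarrow> (\<And>i. i < n \<Longrightarrow> mpoly_eval z (F i) = c i * t) \<Longrightarrow> \<forall>i<n. norm (z i) \<le> M"
    and w: "\<And>i. i < n \<Longrightarrow> mpoly_eval w (F i) = c i * y"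
  obtains \<rho> B where "1 < \<rho>" "\<And>i k. i < n \<Longrightarrow> norm (fps_nth (flow n N c w (mvar i)) k) * \<rho> ^ k \<le> B"
proof -
  let ?D = "\<lambda>k i. (flow_deriv n N c ^^ k) (mvar i)"
  obtain K \<delta> where K: "0 \<le> K" and D: "\<And>k i. tdeg_le (1 + k * \<delta>) (?D k i) \<and> norm1 (?D k i) \<le> fact k * K ^ k"
    using flow_deriv_bound by metis
  \<comment> \<open>At points bounded by \<open>M\<close> the k-th Taylor coefficient of a branch is
    at most \<open>M * C ^ k\<close>; below, \<open>u\<close> is half of the resulting radius
    \<open>1 / C\<close>.\<close>
  define C where "C = K * M ^ \<delta> + 1"
  have C: "0 < C" "K * M ^ \<delta> \<le> C" using K M by (auto simp: C_def intro!: add_nonneg_pos)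
  define u where "u = 1 / (2 * C)"
  have u: "0 < u" "C * u = 1 / 2" using C by (auto simp: u_def)
  define \<xi> where "\<xi> i = flow n N c w (mvar i)" for i
  have Dcl: "?D k i \<in> poly_over UNIV n" if "i < n" for k i
    using that by (intro flow_deriv_closed[OF km] poly_over.var)
  have ev: "norm (mpoly_eval z (?D k i)) \<le> fact k * (M * C ^ k)"
    if z: "\<forall>i<n. norm (z i) \<le> M" and i: "i < n" for z k i
  proof -
    have "norm (mpoly_eval z (?D k i)) \<le> norm1 (?D k i) * M ^ (1 + k * \<delta>)"
      using D z M by (intro norm_eval_le[OF Dcl[OF i]]) auto
    also have "\<dots> \<le> (fact k * K ^ k) * M ^ (1 + k * \<delta>)"
      using D[where k = k and i = i] M by (intro mult_right_mono) auto
    also have "\<dots> = fact k * M * (K * M ^ \<delta>) ^ k"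
      by (simp add: power_mult_distrib power_add mult.commute[of k \<delta>] power_mult)
    also have "\<dots> \<le> fact k * M * C ^ k"
      using C K M by (intro mult_left_mono power_mono) auto
    finally show ?thesis by (simp add: mult.assoc)
  qed
  \<comment> \<open>The series of \<open>?D j i\<close> is the j-th derivative of the
    branch.\<close>
  have nth: "fps_nth (flow n N c w (?D j i)) l = of_real (fact (l + j) / fact l) * fps_nth (\<xi> i) (l + j)" for i j l
    by (simp add: flow_def \<xi>_def funpow_add)
  have wM: "\<forall>i<n. norm (w i) \<le> M" using proper[of y w] w by simp
  have step: "norm (fps_nth (\<xi> i) k) * (r + u) ^ k \<le> 2 * M"
    if r: "0 \<le> r" "r \<le> 2" and Q: "\<And>i k. i < n \<Longrightarrow> norm (fps_nth (\<xi> i) k) * r ^ k \<le> 2 * M" and i: "i < n" for r i k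
  proof -
    have rad: "ereal r \<le> fps_conv_radius (\<xi> i)" if "i < n" for i
      using fps_conv_radius_ge_bounded[OF r(1) Q[OF that]] .
    note fe = flow_eval[OF km, where c = c and w = w, OF rad[unfolded \<xi>_def]]
    \<comment> \<open>Inside radius \<open>r\<close> the branch still lies over the disc of radius 2
      about \<open>y\<close>, so properness bounds it by \<open>M\<close>.\<close>
    have sM: "\<forall>i<n. norm (eval_fps (\<xi> i) s) \<le> M" if s: "norm s < r" for s
    proof (rule proper[of "y + s"])
      show "norm (y + s - y) < 2" using s r by simp
    next
      fix i assume i: "i < n"
      have "mpoly_eval (\<lambda>i. eval_fps (\<xi> i) s) (F i) = eval_fps (flow n N c w (F i)) s"
        using fe[OF _ poly_over_UNIV[OF keller_overD(1)[OF km i]]] s by (simp add: \<xi>_def)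
      also have "\<dots> = c i * (y + s)"
        by (simp add: flow_F[OF km i] w[OF i] eval_fps_linear distrib_left)
      finally show "mpoly_eval (\<lambda>i. eval_fps (\<xi> i) s) (F i) = c i * (y + s)" .
    qed
    \<comment> \<open>Cauchy's estimate for the j-th derivative, which is a polynomial evaluated on
      the branch and therefore bounded by \<open>ev\<close>.\<close>
    have jb: "norm (fps_nth (\<xi> i) (l + j)) * real ((l + j) choose j) * r ^ l \<le> M * C ^ j" for l j
    proof -
      have "norm (fps_nth (flow n N c w (?D j i)) l) * r ^ l \<le> fact j * (M * C ^ j)"
      proof (cases "r = 0")
        case True
        then show ?thesis
          using ev[OF wM i] C M by (cases l) auto
      next
        case False
        show ?thesis
        proof (rule fps_Cauchy_estimate)
          show "0 < r" using False r by simp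
          show "ereal r \<le> fps_conv_radius (flow n N c w (?D j i))" using fe[OF _ Dcl[OF i]] by blast
          fix s :: complex assume s: "norm s < r"
          then show "norm (eval_fps (flow n N c w (?D j i)) s) \<le> fact j * (M * C ^ j)"
            using fe[OF _ Dcl[OF i]] ev[OF sM[OF s] i] by (simp add: \<xi>_def)
        qed
      qed
      moreover have "real ((l + j) choose j) * fact j = fact (l + j) / fact l"
        by (simp add: binomial_fact)
      moreover from this have "fact j * (norm (fps_nth (\<xi> i) (l + j)) * real ((l + j) choose j) * r ^ l)
          = norm (fps_nth (flow n N c w (?D j i)) l) * r ^ l"
        (is "?a = ?b")
      proof -
        have "?a = (real ((l + j) choose j) * fact j) * (norm (fps_nth (\<xi> i) (l + j)) * r ^ l)"
          by (simp only: mult_ac)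
        also have "\<dots> = (fact (l + j) / fact l) * (norm (fps_nth (\<xi> i) (l + j)) * r ^ l)"
          by (simp only: \<open>real ((l + j) choose j) * fact j = fact (l + j) / fact l\<close>)
        also have "\<dots> = ?b" unfolding nth norm_mult by (simp add: norm_divide)
        finally show ?thesis .
      qed
      ultimately have "fact j * (norm (fps_nth (\<xi> i) (l + j)) * real ((l + j) choose j) * r ^ l) \<le> fact j * (M * C ^ j)"
        by linarith
      then show ?thesis by (simp add: mult_le_cancel_left)
    qed
    have "norm (fps_nth (\<xi> i) k) * (r + u) ^ k = (\<Sum>j\<le>k. norm (fps_nth (\<xi> i) k) * real (k choose j) * r ^ (k - j) * u ^ j)"
      by (subst add.commute, subst binomial_ring) (simp add: sum_distrib_left mult_ac)
    also have "\<dots> \<le> (\<Sum>j\<le>k. M * C ^ j * u ^ j)"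
    proof (intro sum_mono mult_right_mono)
      fix j assume "j \<in> {..k}"
      then show "norm (fps_nth (\<xi> i) k) * real (k choose j) * r ^ (k - j) \<le> M * C ^ j"
        using jb[of "k - j" j] by simp
    qed (use u in simp)
    \<comment> \<open>Since \<open>C * u = 1 / 2\<close>, the sum is at most 2; the bound
      \<open>2 * M\<close> thus reproduces itself and the step can be iterated.\<close>
    also have "\<dots> = M * (\<Sum>j\<le>k. (1 / 2) ^ j)"
      by (simp add: sum_distrib_left mult.assoc u(2) flip: power_mult_distrib)
    also have "\<dots> \<le> M * 2" using M geometric_half_le by (intro mult_left_mono) auto
    finally show ?thesis by simp
  qed
  have Q: "\<forall>i<n. \<forall>k. norm (fps_nth (\<xi> i) k) * (real a * u) ^ k \<le> 2 * M" if "real a * u \<le> 2 + u" for a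
    using that
  proof (induction a)
    case 0
    have "norm (fps_nth (\<xi> i) k) * (0::real) ^ k \<le> 2 * M" if "i < n" for i k
      using wM M that by (cases k) (force simp: \<xi>_def)+
    then show ?case by simp
  next
    case (Suc a)
    then have "real a * u \<le> 2" by (simp add: distrib_right)
    then have "\<forall>i<n. \<forall>k. norm (fps_nth (\<xi> i) k) * (real a * u + u) ^ k \<le> 2 * M"
      using step[of "real a * u"] Suc u by auto
    then show ?case by (simp add: distrib_right add.commute)
  qed
  \<comment> \<open>\<open>real a * u\<close> is the first multiple of \<open>u\<close> beyond 1; it
    is at most \<open>1 + u\<close>, within the range of \<open>Q\<close>.\<close>
  define a where "a = nat \<lfloor>1 / u\<rfloor> + 1"
  have "real a = of_int \<lfloor>1 / u\<rfloor> + 1" using u by (simp add: a_def)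
  then have "1 / u < real a" "real a \<le> 1 / u + 1" by linarith+
  then have "1 < real a * u" "real a * u \<le> 1 + u"
    using u by (auto simp: field_simps)
  with Q[of a] show ?thesis by (intro that[of "real a * u" "2 * M"]) (auto simp: \<xi>_def)
qed

section \<open>Integral points on the curve over a line\<close>

lemma Ints_norm_less_1_imp_zero:
  fixes x :: complex
  assumes "x \<in> \<int>" "norm x < 1"
  shows "x = 0"
proof -
  obtain z where "x = of_int z" using assms(1) by (rule Ints_cases)
  with assms(2) show ?thesis by simp
qed

lemma flow_polynomial:
  assumes km: "keller_over \<int> n F N" and M: "1 \<le> M"
    and proper: "\<And>t z. norm (t - y) < 2 \<Longrightarrow> (\<And>i. i < n \<Longrightarrow> mpoly_eval z (F i) = c i * t) \<Longrightarrow> \<forall>i<n. norm (z i) \<le> M"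
    and w: "\<And>i. i < n \<Longrightarrow> mpoly_eval w (F i) = c i * y" "\<And>i. i < n \<Longrightarrow> w i \<in> \<int>"
    and c: "\<And>i. i < n \<Longrightarrow> c i \<in> \<int>"
  obtains \<pi> where "\<And>i k. i < n \<Longrightarrow> coeff (\<pi> i) k \<in> \<int>" "\<And>i. i < n \<Longrightarrow> poly (\<pi> i) 0 = w i"
    "\<And>i. i < n \<Longrightarrow> pev \<pi> (F i) = [:c i * y, c i:]"
proof -
  obtain \<rho> B where \<rho>: "1 < \<rho>" and B: "\<And>i k. i < n \<Longrightarrow> norm (fps_nth (flow n N c w (mvar i)) k) * \<rho> ^ k \<le> B"
  proof (rule flow_radius[OF km M, of y c w], goal_cases)
    case (1 t z)
    from 1(2,3) show ?case by (rule proper)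
  next
    case (2 i)
    from 2(2) show ?case by (rule w(1))
  next
    case (3 \<rho> B)
    show ?case by (rule 3(1)) (use 3(2,3) in auto)
  qed
  define \<xi> where "\<xi> i = flow n N c w (mvar i)" for i
  \<comment> \<open>From order \<open>k0\<close> on, the integral coefficients are smaller than 1 in
    absolute value.\<close>
  obtain k0 where k0: "B < \<rho> ^ k0" using real_arch_pow[OF \<rho>] by blast
  have 0: "fps_nth (\<xi> i) k = 0" if "i < n" "k0 \<le> k" for i k
  proof (rule Ints_norm_less_1_imp_zero)
    show "fps_nth (\<xi> i) k \<in> \<int>" unfolding \<xi>_def by (rule flow_integral[OF km w(2) c that(1)])
    have "norm (fps_nth (\<xi> i) k) * \<rho> ^ k < \<rho> ^ k0" using B[OF that(1), of k] k0 by (simp add: \<xi>_def)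
    also have "\<dots> \<le> 1 * \<rho> ^ k" using \<rho> that(2) by (simp add: power_increasing)
    finally show "norm (fps_nth (\<xi> i) k) < 1"
      using \<rho> by (simp add: mult_less_cancel_right_pos)
  qed
  define \<pi> where "\<pi> i = (\<Sum>k<k0. monom (fps_nth (\<xi> i) k) k)" for i
  have cf: "coeff (\<pi> i) k = fps_nth (\<xi> i) k" if "i < n" for i k
    using 0[OF that] by (auto simp: \<pi>_def coeff_sum not_less)
  have fp: "fps_of_poly (\<pi> i) = \<xi> i" if "i < n" for i
    using cf[OF that] by (simp add: fps_eq_iff)
  show ?thesis
  proof (rule that[of \<pi>])
    show "coeff (\<pi> i) k \<in> \<int>" if "i < n" for i k
      unfolding cf[OF that] \<xi>_def by (rule flow_integral[OF km w(2) c that])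
    show "poly (\<pi> i) 0 = w i" if "i < n" for i
      by (simp add: poly_0_coeff_0 cf[OF that] \<xi>_def)
    fix i assume i: "i < n"
    have "fps_of_poly (pev \<pi> (F i)) = fev (\<lambda>i. fps_of_poly (\<pi> i)) (F i)"
      using fev_fps_of_poly[OF keller_overD(1)[OF km i]] by simp
    also have "\<dots> = flow n N c w (F i)"
      unfolding flow_eq_fev[OF keller_overD(1)[OF km i]]
      by (rule fev_cong[OF keller_overD(1)[OF km i]]) (simp add: fp \<xi>_def)
    also have "\<dots> = fps_of_poly [:c i * y, c i:]"
      by (simp add: flow_F[OF km i] w(1)[OF i] fps_of_poly_pCons fps_of_poly_const fps_const_mult[symmetric] del: fps_const_mult)
    finally show "pev \<pi> (F i) = [:c i * y, c i:]" by (simp add: fps_of_poly_eq_iff)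
  qed
qed

text \<open>Every term beyond the 1-jet contains two factors from \<open>v\<close>, hence the factor
  \<open>q\<close> twice.\<close>

lemma eval_taylor_Ints:
  fixes v z :: "nat \<Rightarrow> complex"
  assumes "p \<in> poly_over \<int> n" "\<And>i. i < n \<Longrightarrow> v i = q * z i" "\<And>i. i < n \<Longrightarrow> z i \<in> \<int>" "q \<in> \<int>"
  shows "\<exists>r\<in>\<int>. mpoly_eval v p = mpoly_eval (\<lambda>_. 0) p +
    (\<Sum>j<n. mpoly_eval (\<lambda>_. 0) (mpderiv j p) * v j) + q\<^sup>2 * r"
proof -
  let ?e = "mpoly_eval (\<lambda>_. 0 :: complex)"
  have zero: "?e p \<in> \<int>" if "p \<in> poly_over \<int> n" for p
    by (rule eval_closed[OF subring_Ints that]) auto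
  have lin: "\<exists>s\<in>\<int>. (\<Sum>j<n. ?e (mpderiv j p) * v j) = q * s" if "p \<in> poly_over \<int> n" for p
  proof (rule bexI[of _ "\<Sum>j<n. ?e (mpderiv j p) * z j"])
    show "(\<Sum>j<n. ?e (mpderiv j p) * z j) \<in> \<int>"
      using assms(3) zero[OF mpderiv_closed[OF subring_Ints that]]
      by (intro subring.sum_closed[OF subring_Ints] Ints_mult) auto
  qed (use assms(2) in \<open>simp add: sum_distrib_left mult_ac\<close>)
  show ?thesis using assms(1)
  proof (induction rule: poly_over.induct)
    case (const c)
    then show ?case by (intro bexI[of _ 0]) auto
  next
    case (var i)
    then show ?case by (intro bexI[of _ 0]) (auto simp: sum_delta_swap)
  next
    case (add p p')
    then obtain r r' where r: "r \<in> \<int>" "r' \<in> \<int>"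
      "mpoly_eval v p = ?e p + (\<Sum>j<n. ?e (mpderiv j p) * v j) + q\<^sup>2 * r"
      "mpoly_eval v p' = ?e p' + (\<Sum>j<n. ?e (mpderiv j p') * v j) + q\<^sup>2 * r'" by blast
    then show ?case
      by (intro bexI[of _ "r + r'"])
        (auto simp: eval.hom_add mpderiv_add distrib_right sum.distrib distrib_left)
  next
    case (mult p p')
    then obtain r r' where r: "r \<in> \<int>" "r' \<in> \<int>"
      "mpoly_eval v p = ?e p + (\<Sum>j<n. ?e (mpderiv j p) * v j) + q\<^sup>2 * r"
      "mpoly_eval v p' = ?e p' + (\<Sum>j<n. ?e (mpderiv j p') * v j) + q\<^sup>2 * r'" by blast
    obtain s s' where s: "s \<in> \<int>" "s' \<in> \<int>" "(\<Sum>j<n. ?e (mpderiv j p) * v j) = q * s"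
      "(\<Sum>j<n. ?e (mpderiv j p') * v j) = q * s'" using lin[OF mult.hyps(1)] lin[OF mult.hyps(2)] by blast
    have "(\<Sum>j<n. ?e (mpderiv j (p * p')) * v j) = ?e p' * (q * s) + ?e p * (q * s')"
      unfolding s(3)[symmetric] s(4)[symmetric] sum_distrib_left sum.distrib[symmetric]
      by (intro sum.cong refl) (simp add: mpderiv_mult eval.hom_add eval.hom_mult algebra_simps)
    moreover have "mpoly_eval v (p * p') = (?e p + q * s + q\<^sup>2 * r) * (?e p' + q * s' + q\<^sup>2 * r')"
      by (simp only: eval.hom_mult r(3,4) s(3,4))
    ultimately have "mpoly_eval v (p * p') = ?e (p * p') + (\<Sum>j<n. ?e (mpderiv j (p * p')) * v j) +
        q\<^sup>2 * (s * s' + ?e p * r' + ?e p' * r + q * s * r' + q * s' * r + q\<^sup>2 * r * r')"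
      by (simp only: eval.hom_mult) (simp add: algebra_simps power2_eq_square)
    moreover have "s * s' + ?e p * r' + ?e p' * r + q * s * r' + q * s' * r + q\<^sup>2 * r * r' \<in> \<int>"
      by (intro Ints_add Ints_mult Ints_power r s assms(4) zero mult.hyps)
    ultimately show ?case by blast
  qed
qed

lemma power_divides_imp_zero:
  fixes a m :: int
  assumes "2 \<le> m" "\<And>k. m ^ k dvd a"
  shows "a = 0"
proof (rule ccontr)
  assume "a \<noteq> 0"
  have "int (nat \<bar>a\<bar>) < 2 ^ nat \<bar>a\<bar>" by (metis of_nat_less_two_power)
  also have "\<dots> \<le> m ^ nat \<bar>a\<bar>" using assms(1) by (intro power_mono) auto
  also have "\<dots> \<le> \<bar>a\<bar>" using dvd_imp_le_int[OF \<open>a \<noteq> 0\<close> assms(2)[of "nat \<bar>a\<bar>"]] assms(1) by simp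
  finally show False by simp
qed

text \<open>Modulo \<open>q\<^sup>2\<close> a normalised map is the identity on \<open>q \<int>\<^sup>n\<close>, so a zero divisible by \<open>m\<close> is
  divisible by all powers of \<open>m\<close>.\<close>

lemma zero_by_descent:
  fixes m :: int
  assumes F: "\<And>i. i < n \<Longrightarrow> F i \<in> poly_over \<int> n" and nf: "normalized n F" and m: "2 \<le> m"
    and v: "\<And>i. i < n \<Longrightarrow> \<exists>z\<in>\<int>. v i = of_int m * z"
    and 0: "\<And>i. i < n \<Longrightarrow> mpoly_eval v (F i) = 0" and "i < n"
  shows "v i = 0"
proof -
  have "\<forall>i<n. \<exists>z. v i = of_int (m ^ Suc k * z)" for k
  proof (induction k)
    case 0
    then show ?case using v by (metis Ints_cases of_int_mult power_one_right One_nat_def)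
  next
    case (Suc k)
    then obtain z where z: "\<And>i. i < n \<Longrightarrow> v i = of_int (m ^ Suc k) * of_int (z i)"
      by (metis of_int_mult)
    show ?case
    proof (intro allI impI)
      fix i assume i: "i < n"
      have "(\<Sum>j<n. mpoly_eval (\<lambda>_. 0) (mpderiv j (F i)) * v j) = (\<Sum>j<n. (if i = j then 1 else 0) * v j)"
        using nf i by (intro sum.cong) (auto simp: normalized_def)
      also have "\<dots> = v i" using i by (simp add: sum_delta_swap(1)[OF i])
      finally have lin: "(\<Sum>j<n. mpoly_eval (\<lambda>_. 0) (mpderiv j (F i)) * v j) = v i" .
      obtain r where r: "r \<in> \<int>" "mpoly_eval v (F i) = v i + (of_int (m ^ Suc k))\<^sup>2 * r"
        using eval_taylor_Ints[where z = "\<lambda>i. of_int (z i)", OF F[OF i] z] nf i lin by (auto simp: normalized_def)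
      then obtain r' where r': "r = of_int r'" by (auto elim: Ints_cases)
      \<comment> \<open>The square of m^(k+1) is divisible by m^(k+2), so one power of
        \<open>m\<close> is gained.\<close>
      have "v i = of_int (m ^ Suc (Suc k) * (- (m ^ k * r')))"
        using r(2) 0[OF i] r' by (simp add: eq_neg_iff_add_eq_0 power2_eq_square mult_ac)
      then show "\<exists>z. v i = of_int (m ^ Suc (Suc k) * z)" by blast
    qed
  qed
  then have *: "\<exists>z. v i = of_int (m ^ Suc k * z)" for k using \<open>i < n\<close> by blast
  then obtain a :: int where a: "v i = of_int a" by blast
  have "m ^ k dvd a" for k
  proof -
    obtain z where "a = m ^ Suc k * z" using *[of k] a by (metis of_int_eq_iff)
    then show ?thesis by simp
  qed
  then have "a = 0" by (rule power_divides_imp_zero[OF m])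
  then show ?thesis by (simp add: a)
qed

definition has_line :: "nat \<Rightarrow> (nat \<Rightarrow> complex mpoly) \<Rightarrow> (nat \<Rightarrow> complex) \<Rightarrow> bool" where
  "has_line n F c \<longleftrightarrow> (\<exists>\<eta>. \<forall>i<n. poly (\<eta> i) 0 = 0 \<and> pev \<eta> (F i) = [:0, c i:])"

text \<open>The radius 2 leaves room for the continuation to pass radius 1. The bound
  \<open>M\<close> may depend on the centre.\<close>

definition proper_line :: "nat \<Rightarrow> (nat \<Rightarrow> complex mpoly) \<Rightarrow> (nat \<Rightarrow> complex) \<Rightarrow> bool" where
  "proper_line n F c \<longleftrightarrow> (\<exists>Y. \<forall>y. Y \<le> norm y \<longrightarrow> (\<exists>M\<ge>1. \<forall>t z. norm (t - y) < 2 \<longrightarrow>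
     (\<forall>i<n. mpoly_eval z (F i) = c i * t) \<longrightarrow> (\<forall>i<n. norm (z i) \<le> M)))"

lemma no_integral_points:
  assumes km: "keller_over \<int> n F N" and nf: "normalized n F" and c: "\<And>i. i < n \<Longrightarrow> c i \<in> \<int>"
    and proper: "proper_line n F c" and no_line: "\<not> has_line n F c"
  shows "\<exists>m0 :: int. \<forall>m w y. m0 \<le> m \<longrightarrow> y \<in> \<int> \<longrightarrow> (\<forall>i<n. w i \<in> \<int>) \<longrightarrow>
    (\<forall>i<n. mpoly_eval (\<lambda>i. of_int m * w i) (F i) = c i * (of_int m * y)) \<longrightarrow> (\<forall>i<n. w i = 0)"
proof -
  obtain Y where Y: "\<And>y. Y \<le> norm y \<Longrightarrow> \<exists>M\<ge>1. \<forall>t z. norm (t - y) < 2 \<longrightarrow>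
     (\<forall>i<n. mpoly_eval z (F i) = c i * t) \<longrightarrow> (\<forall>i<n. norm (z i) \<le> M)"
    using proper unfolding proper_line_def by blast
  show ?thesis
  \<comment> \<open>The bound 2 serves the descent; the other one gives \<open>m * y\<close> norm at
    least \<open>Y\<close> whenever the integer \<open>y\<close> is nonzero.\<close>
  proof (rule exI[of _ "max 2 \<lceil>Y\<rceil>"], intro allI impI)
    fix m :: int and w :: "nat \<Rightarrow> complex" and y :: complex and j
    assume m: "max 2 \<lceil>Y\<rceil> \<le> m" and y: "y \<in> \<int>" and w': "\<forall>i<n. w i \<in> \<int>"
      and F': "\<forall>i<n. mpoly_eval (\<lambda>i. of_int m * w i) (F i) = c i * (of_int m * y)" and j: "j < n"
    note w = w'[rule_format] and F = F'[rule_format]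
    note Fcl = keller_overD(1)[OF km]
    from m have m2: "2 \<le> m" by simp
    have "y = 0"
    proof (rule ccontr)
      assume "y \<noteq> 0"
      then have "1 \<le> norm y" using Ints_norm_less_1_imp_zero[OF y] by fastforce
      then have "real_of_int m * 1 \<le> norm (of_int m * y)"
        using m2 by (simp add: norm_mult)
      moreover have "Y \<le> real_of_int m" using m by linarith
      ultimately have "Y \<le> norm (of_int m * y)" by linarith
      then obtain M where M: "1 \<le> M" "\<And>t z. norm (t - of_int m * y) < 2 \<Longrightarrow>
         (\<And>i. i < n \<Longrightarrow> mpoly_eval z (F i) = c i * t) \<Longrightarrow> (\<forall>i<n. norm (z i) \<le> M)"
        using Y by meson
      obtain \<pi> where \<pi>: "\<And>i k. i < n \<Longrightarrow> coeff (\<pi> i) k \<in> \<int>" "\<And>i. i < n \<Longrightarrow> poly (\<pi> i) 0 = of_int m * w i"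
        "\<And>i. i < n \<Longrightarrow> pev \<pi> (F i) = [:c i * (of_int m * y), c i:]"
      proof (rule flow_polynomial[OF km M(1), where y = "of_int m * y" and c = c and w = "\<lambda>i. of_int m * w i"])
      qed (use M(2) F w c in auto)
      \<comment> \<open>Reparametrised by the position on the line, so that the curve lies over 0 at
        parameter 0.\<close>
      define \<eta> where "\<eta> i = pcompose (\<pi> i) [:- (of_int m * y), 1:]" for i
      have \<eta>F: "pev \<eta> (F i) = [:0, c i:]" if "i < n" for i
      proof -
        have "poly (pev \<eta> (F i)) t = poly [:0, c i:] t" for t
        proof -
          have "poly (pev \<eta> (F i)) t = poly (pev \<pi> (F i)) (t - of_int m * y)"
            by (simp add: poly_pev[OF Fcl[OF that]] \<eta>_def poly_pcompose)
          then show ?thesis by (simp add: \<pi>(3)[OF that] algebra_simps)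
        qed
        then show ?thesis by (simp flip: poly_eq_poly_eq_iff add: fun_eq_iff)
      qed
      have "poly (\<eta> i) 0 = 0" if "i < n" for i
      proof (rule zero_by_descent[where v = "\<lambda>i. poly (\<eta> i) 0", OF Fcl nf m2])
        fix i assume i: "i < n"
        have "poly (pev \<eta> (F i)) 0 = 0" by (simp add: \<eta>F[OF i])
        then show "mpoly_eval (\<lambda>i. poly (\<eta> i) 0) (F i) = 0" by (simp add: poly_pev[OF Fcl[OF i]])
        obtain a q where aq: "\<pi> i = pCons a q" by (cases "\<pi> i")
        have "coeff q k \<in> \<int>" for k using \<pi>(1)[OF i, of "Suc k"] by (simp add: aq)
        then have "poly q (- (of_int m * y)) \<in> \<int>"
          using y unfolding poly_altdef by (intro subring.sum_closed[OF subring_Ints] Ints_mult Ints_power) auto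
        \<comment> \<open>The constant coefficient of \<open>\<pi> i\<close> is m w_i, and the other
          terms are evaluated at -m y with integral coefficients, so \<open>m\<close> divides the
          whole point.\<close>
        moreover have "poly (\<eta> i) 0 = of_int m * (w i - y * poly q (- (of_int m * y)))"
          using \<pi>(2)[OF i] by (simp add: \<eta>_def poly_pcompose aq algebra_simps)
        ultimately show "\<exists>z\<in>\<int>. poly (\<eta> i) 0 = of_int m * z"
          using w[OF i] y by (metis Ints_diff Ints_mult)
      qed (use that in auto)
      with \<eta>F no_line show False unfolding has_line_def by blast
    qed
    have "of_int m * w j = 0"
      by (rule zero_by_descent[where v = "\<lambda>i. of_int m * w i", OF Fcl nf m2 _ _ j])
        (use w F \<open>y = 0\<close> in auto)
    then show "w j = 0" using m2 by simp
  qed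
qed

section \<open>The choice of the line\<close>

text \<open>Gaussian elimination: an equation with a nonzero coefficient is solved for one unknown
  \<open>s0\<close>, leaving one equation and one unknown fewer.\<close>

lemma homogeneous_system_solvable:
  fixes a :: "'s \<Rightarrow> 'm \<Rightarrow> complex"
  assumes "finite M" "finite S" "card M < card S"
  shows "\<exists>\<rho>. (\<exists>s\<in>S. \<rho> s \<noteq> 0) \<and> (\<forall>m\<in>M. (\<Sum>s\<in>S. \<rho> s * a s m) = 0)"
  using assms
proof (induction M arbitrary: S a rule: finite_induct)
  case empty
  then obtain s where "s \<in> S" by (metis card.empty all_not_in_conv less_irrefl)
  then show ?case by (intro exI[of _ "\<lambda>_. 1"]) auto
next
  case (insert m M)
  show ?case
  proof (cases "\<forall>s\<in>S. a s m = 0")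
    case True
    then show ?thesis using insert.IH[of S a] insert.prems insert.hyps by auto
  next
    case False
    then obtain s0 where s0: "s0 \<in> S" "a s0 m \<noteq> 0" by blast
    let ?S = "S - {s0}"
    have "card M < card ?S" using insert s0 by (simp add: card_Diff_singleton)
    then obtain \<rho> where \<rho>: "\<exists>s\<in>?S. \<rho> s \<noteq> 0"
      "\<forall>k\<in>M. (\<Sum>s\<in>?S. \<rho> s * (a s k - a s m / a s0 m * a s0 k)) = 0"
      using insert.IH[of ?S "\<lambda>s k. a s k - a s m / a s0 m * a s0 k"] insert.prems(1) by blast
    define \<rho>' where "\<rho>' s = (if s = s0 then - (\<Sum>s\<in>?S. \<rho> s * a s m / a s0 m) else \<rho> s)" for s
    have split: "(\<Sum>s\<in>S. \<rho>' s * a s k) = (\<Sum>s\<in>?S. \<rho> s * (a s k - a s m / a s0 m * a s0 k))" for k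
    proof -
      have "(\<Sum>s\<in>S. \<rho>' s * a s k) = \<rho>' s0 * a s0 k + (\<Sum>s\<in>?S. \<rho>' s * a s k)"
        using s0 insert.prems by (intro sum.remove) auto
      also have "(\<Sum>s\<in>?S. \<rho>' s * a s k) = (\<Sum>s\<in>?S. \<rho> s * a s k)"
        by (intro sum.cong) (auto simp: \<rho>'_def)
      finally show ?thesis
        by (simp add: \<rho>'_def right_diff_distrib sum_subtractf sum_distrib_right mult.assoc)
    qed
    have "(\<Sum>s\<in>S. \<rho>' s * a s m) = 0" unfolding split using s0 by simp
    then have "\<forall>k\<in>insert m M. (\<Sum>s\<in>S. \<rho>' s * a s k) = 0" using \<rho>(2) split by auto
    moreover have "\<exists>s\<in>S. \<rho>' s \<noteq> 0" using \<rho>(1) by (auto simp: \<rho>'_def)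
    ultimately show ?thesis by blast
  qed
qed

section \<open>Monomials of bounded degree and algebraic relations\<close>

definition monom_of :: "nat \<Rightarrow> (nat \<Rightarrow> nat) \<Rightarrow> (nat \<Rightarrow>\<^sub>0 nat)" where
  "monom_of n b = (\<Sum>i<n. single i (b i))"

lemma lookup_monom_of: "lookup (monom_of n b) i = (if i < n then b i else 0)"
  by (simp add: monom_of_def lookup_sum lookup_single when_def)

lemma keys_monom_of: "keys (monom_of n b) \<subseteq> {..<n}"
  by (auto simp: in_keys_iff lookup_monom_of split: if_splits)

lemma finite_monomials_bounded:
  "finite {m. keys m \<subseteq> {..<n} \<and> mdeg m \<le> d}"
  "card {m. keys m \<subseteq> {..<n} \<and> mdeg m \<le> d} \<le> (d + 1) ^ n"
proof -
  let ?M = "{m. keys m \<subseteq> {..<n} \<and> mdeg m \<le> d}"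
  let ?B = "PiE {..<n} (\<lambda>_. {..d})"
  have sub: "?M \<subseteq> monom_of n ` ?B"
  proof
    fix m assume m: "m \<in> ?M"
    have le: "lookup m i \<le> mdeg m" for i
      by (cases "i \<in> keys m") (auto simp: in_keys_iff intro: member_le_sum)
    have "m = monom_of n (restrict (lookup m) {..<n})"
    proof (rule poly_mapping_eqI)
      fix i
      have "lookup m i = 0" if "\<not> i < n"
      proof -
        have "i \<notin> keys m" using m that by auto
        then show ?thesis by (simp add: in_keys_iff)
      qed
      then show "lookup m i = lookup (monom_of n (restrict (lookup m) {..<n})) i"
        by (simp add: lookup_monom_of)
    qed
    moreover have "restrict (lookup m) {..<n} \<in> ?B"
      using m order_trans[OF le] by auto
    ultimately show "m \<in> monom_of n ` ?B" by blast
  qed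
  have fin: "finite ?B" by (intro finite_PiE) auto
  show "finite ?M" by (rule finite_subset[OF sub]) (intro finite_imageI fin)
  have "card ?M \<le> card (monom_of n ` ?B)" by (intro card_mono sub finite_imageI fin)
  also have "\<dots> \<le> card ?B" by (rule card_image_le[OF fin])
  also have "\<dots> = (d + 1) ^ n" by (simp add: card_PiE)
  finally show "card ?M \<le> (d + 1) ^ n" .
qed

lemma tdeg_le_power: "tdeg_le d p \<Longrightarrow> tdeg_le (k * d) (p ^ k)"
proof (induction k)
  case (Suc k)
  then show ?case using tdeg_le_mult[of d p "k * d" "p ^ k"] by simp
qed (simp add: tdeg_le_def keys_one)

lemma tdeg_le_prod: "finite S \<Longrightarrow> (\<And>i. i \<in> S \<Longrightarrow> tdeg_le (d i) (f i)) \<Longrightarrow> tdeg_le (sum d S) (prod f S)"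
  by (induction S rule: finite_induct) (auto simp: tdeg_le_def[of 0] intro: tdeg_le_mult)

text \<open>There are more products \<open>g ^ a * F ^ b\<close> with exponents at most \<open>E\<close> than monomials of the
  degree they reach.\<close>

lemma algebraic_relation:
  fixes F :: "nat \<Rightarrow> complex mpoly"
  assumes F: "\<And>i. i < n \<Longrightarrow> F i \<in> poly_over UNIV n" and g: "g \<in> poly_over UNIV n"
  obtains e r where "\<And>a. r a \<in> poly_over UNIV n" "r e \<noteq> 0"
    "\<And>x. (\<Sum>a\<le>e. mpoly_eval (\<lambda>i. mpoly_eval x (F i)) (r a) * mpoly_eval x g ^ a) = 0"
proof -
  have "\<forall>i. \<exists>d. tdeg_le d (F i)" using tdeg_le_exists by blast
  then obtain dd where dd: "\<And>i. tdeg_le (dd i) (F i)" by metis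
  obtain dg where dg: "tdeg_le dg g" using tdeg_le_exists by blast
  define d where "d = dg + (\<Sum>i<n. dd i)"
  have dF: "tdeg_le d (F i)" if "i < n" for i
    unfolding d_def by (rule tdeg_le_mono[OF dd]) (use that in \<open>auto intro: member_le_sum trans_le_add2\<close>)
  have dg: "tdeg_le d g" unfolding d_def by (rule tdeg_le_mono[OF dg]) simp
  \<comment> \<open>There are (E+1)^(n+1) products, of degree at most \<open>D\<close>, against at
    most (D+1)^n <= (1+(n+1)d)^n (E+1)^n monomials. \<open>E\<close> is chosen as the first factor,
    which is smaller than E+1.\<close>
  define E where "E = (1 + (n + 1) * d) ^ n"
  define D where "D = (n + 1) * (E * d)"
  define B where "B = PiE {..<n} (\<lambda>_. {..E})"
  define S where "S = {..E} \<times> B"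
  define M where "M = {m. keys m \<subseteq> {..<n} \<and> mdeg m \<le> D}"
  define P where "P = (\<lambda>(a, b). g ^ a * (\<Prod>i<n. F i ^ b i))"
  have finB: "finite B" unfolding B_def by (intro finite_PiE) auto
  have finS: "finite S" by (simp add: S_def finB)
  have finM: "finite M" unfolding M_def by (rule finite_monomials_bounded)
  have "card M \<le> (D + 1) ^ n" unfolding M_def by (rule finite_monomials_bounded)
  also have "\<dots> \<le> ((1 + (n + 1) * d) * (E + 1)) ^ n"
    by (intro power_mono) (auto simp: D_def algebra_simps)
  also have "\<dots> = E * (E + 1) ^ n" unfolding power_mult_distrib E_def ..
  also have "\<dots> < (E + 1) * (E + 1) ^ n" by simp
  also have "\<dots> = card S" by (simp add: S_def B_def card_PiE card_cartesian_product)
  finally have "card M < card S" .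
  from homogeneous_system_solvable[OF finM finS this, of "\<lambda>s. lookup (P s)"]
  obtain \<rho> s0 where \<rho>: "s0 \<in> S" "\<rho> s0 \<noteq> 0" "\<And>m. m \<in> M \<Longrightarrow> (\<Sum>s\<in>S. \<rho> s * lookup (P s) m) = 0"
    by blast
  have Pcl: "P s \<in> poly_over UNIV n" for s
    unfolding P_def by (cases s) (auto intro!: PU.closed F g)
  have Pdeg: "tdeg_le D (P s)" if sS: "s \<in> S" for s
  proof -
    obtain a b where s: "s = (a, b)" "a \<le> E" "b \<in> B" using sS by (auto simp: S_def)
    have "tdeg_le (a * d + (\<Sum>i<n. b i * d)) (P s)"
      unfolding P_def s using dg dF by (auto intro!: tdeg_le_mult tdeg_le_power tdeg_le_prod)
    moreover have "(\<Sum>i<n. b i * d) \<le> (\<Sum>i<n. E * d)"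
      using s(3) by (intro sum_mono mult_right_mono) (auto simp: B_def)
    with mult_le_mono1[OF s(2), of d] have "a * d + (\<Sum>i<n. b i * d) \<le> E * d + (\<Sum>i<n. E * d)"
      by (rule add_mono)
    then have "a * d + (\<Sum>i<n. b i * d) \<le> D" by (simp add: D_def)
    ultimately show ?thesis by (rule tdeg_le_mono)
  qed
  have rel: "(\<Sum>s\<in>S. mconst (\<rho> s) * P s) = 0"
  proof (rule poly_mapping_eqI)
    fix m
    have l: "lookup (\<Sum>s\<in>S. mconst (\<rho> s) * P s) m = (\<Sum>s\<in>S. \<rho> s * lookup (P s) m)"
      by (simp only: lookup_sum lookup_mconst_mult)
    show "lookup (\<Sum>s\<in>S. mconst (\<rho> s) * P s) m = lookup 0 m"
    proof (cases "m \<in> M")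
      case True
      then show ?thesis unfolding l using \<rho>(3) by simp
    next
      case False
      have "lookup (P s) m = 0" if "s \<in> S" for s
      proof (rule ccontr)
        assume "lookup (P s) m \<noteq> 0"
        then have "m \<in> keys (P s)" by (simp add: in_keys_iff)
        then have "m \<in> M" using Pdeg[OF that] Pcl[of s]
          by (auto simp: M_def tdeg_le_def polys_def simp flip: polys_eq_poly_over)
        with False show False by simp
      qed
      then show ?thesis unfolding l by simp
    qed
  qed
  define r where "r a = (if a \<le> E then \<Sum>b\<in>B. single (monom_of n b) (\<rho> (a, b)) else 0)" for a
  have rcl: "r a \<in> poly_over UNIV n" for a
    unfolding r_def using keys_monom_of by (auto intro!: PU.closed single_in_poly_over subring_UNIV)
  obtain a0 b0 where s0: "s0 = (a0, b0)" "a0 \<le> E" "b0 \<in> B" using \<rho>(1) by (auto simp: S_def)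
  have injB: "b = b'" if "b \<in> B" "b' \<in> B" "monom_of n b = monom_of n b'" for b b'
  proof (rule PiE_ext[of b "{..<n}" "\<lambda>_. {..E}"])
    fix i assume "i \<in> {..<n}"
    then show "b i = b' i" using arg_cong[OF that(3), of "\<lambda>m. lookup m i"] by (simp add: lookup_monom_of)
  qed (use that in \<open>auto simp: B_def\<close>)
  have "lookup (r a0) (monom_of n b0) = (\<Sum>b\<in>B. if b = b0 then \<rho> s0 else 0)"
    using s0 injB by (auto simp: r_def lookup_sum lookup_single when_def intro!: sum.cong)
  also have "\<dots> = \<rho> s0" using s0 finB by simp
  finally have "r a0 \<noteq> 0" using \<rho>(2) by auto
  \<comment> \<open>The largest exponent that occurs, so that \<open>r e\<close> is the leading
    coefficient; \<open>e = 0\<close> is still possible here.\<close>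
  define e where "e = Max {a. a \<le> E \<and> r a \<noteq> 0}"
  have e: "e \<le> E" "r e \<noteq> 0" "\<And>a. r a \<noteq> 0 \<Longrightarrow> a \<le> e"
  proof -
    have fin: "finite {a. a \<le> E \<and> r a \<noteq> 0}" by simp
    have "e \<in> {a. a \<le> E \<and> r a \<noteq> 0}" unfolding e_def
      using \<open>r a0 \<noteq> 0\<close> s0(2) by (intro Max_in fin) auto
    then show "e \<le> E" "r e \<noteq> 0" by auto
    show "a \<le> e" if "r a \<noteq> 0" for a
      unfolding e_def using that by (intro Max_ge fin) (auto simp: r_def split: if_splits)
  qed
  show ?thesis
  proof (rule that[of r e, OF rcl e(2)])
    fix x
    let ?z = "\<lambda>i. mpoly_eval x (F i)"
    have mm: "mmon ?z (monom_of n b) = (\<Prod>i<n. ?z i ^ b i)" for b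
      by (subst mmon_superset[OF _ keys_monom_of]) (simp_all add: lookup_monom_of)
    have "(\<Sum>a\<le>e. mpoly_eval ?z (r a) * mpoly_eval x g ^ a) = (\<Sum>a\<le>E. mpoly_eval ?z (r a) * mpoly_eval x g ^ a)"
    proof (intro sum.mono_neutral_left ballI)
      fix a assume "a \<in> {..E} - {..e}"
      then have "r a = 0" using e(3)[of a] by auto
      then show "mpoly_eval ?z (r a) * mpoly_eval x g ^ a = 0" by simp
    qed (use e(1) in auto)
    also have "\<dots> = (\<Sum>a\<le>E. \<Sum>b\<in>B. mpoly_eval x (mconst (\<rho> (a, b)) * P (a, b)))"
    proof (intro sum.cong refl)
      fix a assume "a \<in> {..E}"
      moreover have "mpoly_eval ?z (single m c) = c * mmon ?z m" for m c
        unfolding mpoly_eval_hom by (simp add: mpoly_hom_single)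
      ultimately show "mpoly_eval ?z (r a) * mpoly_eval x g ^ a = (\<Sum>b\<in>B. mpoly_eval x (mconst (\<rho> (a, b)) * P (a, b)))"
        by (simp add: r_def eval.hom_sum mm P_def eval.hom_mult eval.hom_power eval.hom_prod
            sum_distrib_left mult_ac)
    qed
    also have "\<dots> = mpoly_eval x (\<Sum>s\<in>S. mconst (\<rho> s) * P s)"
      unfolding S_def eval.hom_sum by (simp add: sum.cartesian_product case_prod_unfold)
    also have "\<dots> = 0" by (simp add: rel)
    finally show "(\<Sum>a\<le>e. mpoly_eval ?z (r a) * mpoly_eval x g ^ a) = 0" .
  qed
qed

text \<open>Algebraic independence of the components: along the branch through the origin F equals t
  c, so the relation becomes r(t c) = 0, and t = 1 gives r(c) = 0.\<close>

lemma keller_over_dominant: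
  assumes km: "keller_over A n F N" and F0: "\<And>i. i < n \<Longrightarrow> mpoly_eval (\<lambda>_. 0) (F i) = 0"
    and r: "r \<in> poly_over UNIV n" and z: "\<And>x. mpoly_eval (\<lambda>i. mpoly_eval x (F i)) r = 0"
  shows "r = 0"
proof (rule mpoly_eqI_eval[OF r PU.zero_closed])
  fix c :: "nat \<Rightarrow> complex"
  let ?\<xi> = "flow n N c (\<lambda>_. 0)"
  interpret \<xi>: comm_ring_hom ?\<xi> by (rule flow_hom)
  have FU: "F i \<in> poly_over UNIV n" if "i < n" for i using keller_overD(1)[OF km that] by (rule poly_over_UNIV)
  have "mpoly_subst F r = 0"
    by (rule mpoly_eqI_eval[OF subst_closed[OF r FU] PU.zero_closed]) (auto simp: eval_subst z)
  then have "?\<xi> (mpoly_subst F r) = 0" by simp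
  moreover have "?\<xi> (mpoly_subst F r) = fev (\<lambda>i. ?\<xi> (F i)) r"
  proof -
    have "comm_ring_hom (\<lambda>p. ?\<xi> (mpoly_subst F p))"
      by unfold_locales (auto simp: subst.hom_add subst.hom_mult \<xi>.hom_add \<xi>.hom_mult)
    then show ?thesis
      by (rule hom_eq_on_poly_over[OF _ comm_ring_hom_mpoly_hom[OF fps_const_hom] r]) auto
  qed
  moreover have "fev (\<lambda>i. ?\<xi> (F i)) r = fev (\<lambda>i. fps_of_poly [:0, c i:]) r"
    by (rule fev_cong[OF r]) (simp add: flow_F[OF km] F0 fps_of_poly_pCons fps_of_poly_const)
  ultimately have "fps_of_poly (pev (\<lambda>i. [:0, c i:]) r) = fps_of_poly 0"
    by (simp only: fev_fps_of_poly[OF r] fps_of_poly_0)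
  then have "pev (\<lambda>i. [:0, c i:]) r = 0" by (simp only: fps_of_poly_eq_iff)
  then have "poly (pev (\<lambda>i. [:0, c i:]) r) 1 = 0" by simp
  then show "mpoly_eval c r = mpoly_eval c 0" by (simp add: poly_pev[OF r])
qed

text \<open>The field is linear in \<open>c\<close>, so each application of the derivation brings in
  one more factor linear in \<open>c\<close>.\<close>

lemma flow_nth_polynomial:
  assumes km: "keller_over A n F N" and p: "p \<in> poly_over UNIV n"
  shows "\<exists>g\<in>poly_over UNIV n. \<forall>c. fps_nth (flow n N c (\<lambda>_. 0) p) k = mpoly_eval c g"
proof -
  have "\<exists>g\<in>poly_over UNIV n. \<forall>c. mpoly_eval (\<lambda>_. 0) ((flow_deriv n N c ^^ k) p) = mpoly_eval c g"
    using p
  proof (induction k arbitrary: p)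
    case 0
    show ?case by (intro bexI[of _ "mconst (mpoly_eval (\<lambda>_. 0) p)"]) (auto intro: poly_over.const)
  next
    case (Suc k)
    define q where "q l = (\<Sum>j<n. N j l * mpderiv j p)" for l
    have NU: "N j l \<in> poly_over UNIV n" if "j < n" "l < n" for j l
      using keller_overD(2)[OF km that] by (rule poly_over_UNIV)
    have q: "q l \<in> poly_over UNIV n" if "l < n" for l
      unfolding q_def using that Suc.prems by (intro PU.closed NU mpderiv_closed subring_UNIV) auto
    have e: "flow_deriv n N c p = (\<Sum>l<n. mconst (c l) * q l)" for c
      unfolding flow_deriv_def q_def sum_distrib_left sum_distrib_right
      by (subst sum.swap) (simp add: mult_ac)
    have lin: "(flow_deriv n N c ^^ k) (mconst a * p) = mconst a * (flow_deriv n N c ^^ k) p" for a c p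
      by (induction k) (auto simp: flow_deriv_mult)
    have lins: "(flow_deriv n N c ^^ k) (sum f S) = (\<Sum>s\<in>S. (flow_deriv n N c ^^ k) (f s))" for f c and S :: "nat set"
      by (induction S rule: infinite_finite_induct) (auto simp: flow_deriv_pow_add)
    have "\<forall>l. \<exists>g. l < n \<longrightarrow> g \<in> poly_over UNIV n \<and> (\<forall>c. mpoly_eval (\<lambda>_. 0) ((flow_deriv n N c ^^ k) (q l)) = mpoly_eval c g)"
      using Suc.IH[OF q] by blast
    then obtain g where g: "\<And>l. l < n \<Longrightarrow> g l \<in> poly_over UNIV n"
      "\<And>l c. l < n \<Longrightarrow> mpoly_eval (\<lambda>_. 0) ((flow_deriv n N c ^^ k) (q l)) = mpoly_eval c (g l)" by metis
    show ?case
    proof (intro bexI[of _ "\<Sum>l<n. mvar l * g l"] allI)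
      show "(\<Sum>l<n. mvar l * g l) \<in> poly_over UNIV n"
        using g(1) by (auto intro!: PU.sum_closed PU.mult_closed poly_over.var)
      fix c
      have "mpoly_eval (\<lambda>_. 0) ((flow_deriv n N c ^^ Suc k) p) = mpoly_eval (\<lambda>_. 0) ((flow_deriv n N c ^^ k) (\<Sum>l<n. mconst (c l) * q l))"
        by (simp add: funpow_swap1 flip: e)
      also have "\<dots> = (\<Sum>l<n. c l * mpoly_eval c (g l))"
        unfolding lins lin by (simp add: eval.hom_sum eval.hom_mult g(2))
      finally show "mpoly_eval (\<lambda>_. 0) ((flow_deriv n N c ^^ Suc k) p) = mpoly_eval c (\<Sum>l<n. mvar l * g l)"
        by (simp add: eval.hom_sum eval.hom_mult)
    qed
  qed
  then obtain g where g: "g \<in> poly_over UNIV n" "\<And>c. mpoly_eval (\<lambda>_. 0) ((flow_deriv n N c ^^ k) p) = mpoly_eval c g"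
    by blast
  show ?thesis
  proof (intro bexI[of _ "mconst (1 / fact k) * g"] allI)
    show "mconst (1 / fact k) * g \<in> poly_over UNIV n" by (intro PU.mult_closed poly_over.const g) simp
  qed (simp add: flow_def g(2) eval.hom_mult)
qed

lemma degree_pev_line:
  assumes "tdeg_le d p"
  shows "degree (pev (\<lambda>i. [:0, c i:]) p) \<le> d"
  unfolding mpoly_hom_def
proof (rule degree_sum_le)
  fix m assume m: "m \<in> keys p"
  have "degree (mmon (\<lambda>i. [:0, c i:]) m) \<le> (\<Sum>i\<in>keys m. lookup m i)"
    unfolding mmon_def
    by (rule order_trans[OF degree_prod_sum_le]) (auto intro!: sum_mono order_trans[OF degree_power_le])
  also have "\<dots> \<le> d" using assms m by (auto simp: tdeg_le_def)
  finally show "degree ([:lookup p m:] * mmon (\<lambda>i. [:0, c i:]) m) \<le> d"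
    by (intro order_trans[OF degree_mult_le]) simp
qed simp

text \<open>If \<open>\<eta>\<close> had degree above \<open>d\<close>, the top term would have
  larger degree than the sum of all others.\<close>

lemma degree_root_bound:
  fixes \<rho> :: "nat \<Rightarrow> complex poly"
  assumes "\<And>a. a \<le> e \<Longrightarrow> degree (\<rho> a) \<le> d" "\<rho> e \<noteq> 0" "0 < e" "(\<Sum>a\<le>e. \<rho> a * \<eta> ^ a) = 0"
  shows "degree \<eta> \<le> d"
proof (rule ccontr)
  let ?D = "degree \<eta>"
  assume *: "\<not> ?D \<le> d"
  then have "\<eta> \<noteq> 0" by auto
  obtain e' where e': "e = Suc e'" using assms(3) gr0_implies_Suc by blast
  have "\<rho> e * \<eta> ^ e = - (\<Sum>a\<le>e'. \<rho> a * \<eta> ^ a)"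
    using assms(4) by (simp add: e' eq_neg_iff_add_eq_0 add.commute)
  then have "degree (\<rho> e * \<eta> ^ e) = degree (\<Sum>a\<le>e'. \<rho> a * \<eta> ^ a)" by simp
  also have "\<dots> \<le> d + e' * ?D"
  proof (rule degree_sum_le)
    fix a assume "a \<in> {..e'}"
    have "degree (\<rho> a * \<eta> ^ a) \<le> degree (\<rho> a) + ?D * a"
      by (intro order_trans[OF degree_mult_le] add_left_mono degree_power_le)
    also have "\<dots> \<le> d + e' * ?D" using assms(1)[of a] \<open>a \<in> {..e'}\<close>
      by (intro add_mono) (auto simp: mult.commute[of e'] e')
    finally show "degree (\<rho> a * \<eta> ^ a) \<le> d + e' * ?D" .
  qed simp
  also have "\<dots> < ?D + e' * ?D" using * by simp
  also have "\<dots> \<le> degree (\<rho> e * \<eta> ^ e)"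
    using assms(2) \<open>\<eta> \<noteq> 0\<close> by (simp add: degree_mult_eq degree_power_eq e')
  finally show False by simp
qed


text \<open>A form of Cauchy's bound for the roots of a polynomial.\<close>

lemma root_bound:
  fixes \<alpha> :: "nat \<Rightarrow> complex"
  assumes "(\<Sum>a\<le>e. \<alpha> a * z ^ a) = 0" "\<alpha> e \<noteq> 0" "0 < e"
  shows "norm z \<le> 1 + (\<Sum>a<e. norm (\<alpha> a) / norm (\<alpha> e))"
proof (cases "norm z \<le> 1")
  case True
  moreover have "0 \<le> (\<Sum>a<e. norm (\<alpha> a) / norm (\<alpha> e))" by (intro sum_nonneg) auto
  ultimately show ?thesis by linarith
next
  case False
  obtain e' where e': "e = Suc e'" using assms(3) gr0_implies_Suc by blast
  have "\<alpha> e * z ^ e = - (\<Sum>a<e. \<alpha> a * z ^ a)"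
    using assms(1) by (simp add: eq_neg_iff_add_eq_0 add.commute flip: lessThan_Suc_atMost)
  then have "norm (\<alpha> e) * norm z ^ e = norm (\<Sum>a<e. \<alpha> a * z ^ a)"
    by (metis norm_minus_cancel norm_mult norm_power)
  also have "\<dots> \<le> (\<Sum>a<e. norm (\<alpha> a) * norm z ^ e')"
  proof (rule order_trans[OF norm_sum], intro sum_mono)
    fix a assume "a \<in> {..<e}"
    then have "norm z ^ a \<le> norm z ^ e'" using False by (intro power_increasing) (auto simp: e')
    then show "norm (\<alpha> a * z ^ a) \<le> norm (\<alpha> a) * norm z ^ e'"
      by (simp add: norm_mult norm_power mult_left_mono)
  qed
  finally have "norm (\<alpha> e) * norm z ^ e \<le> (\<Sum>a<e. norm (\<alpha> a)) * norm z ^ e'"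
    by (simp only: sum_distrib_right)
  moreover have "norm z ^ e = norm z * norm z ^ e'" by (simp add: e')
  ultimately have "(norm (\<alpha> e) * norm z) * norm z ^ e' \<le> (\<Sum>a<e. norm (\<alpha> a)) * norm z ^ e'"
    by (simp only: mult.assoc)
  moreover have "0 < norm z ^ e'" using False by (intro zero_less_power) linarith
  ultimately have "norm (\<alpha> e) * norm z \<le> (\<Sum>a<e. norm (\<alpha> a))" by simp
  then have "norm z \<le> (\<Sum>a<e. norm (\<alpha> a)) / norm (\<alpha> e)"
    using assms(2) by (simp add: pos_le_divide_eq mult.commute)
  then show ?thesis by (simp add: sum_divide_distrib)
qed

text \<open>Over the line each coordinate is a root of a polynomial whose coefficients are
  polynomials in \<open>t\<close>. The leading one vanishes for finitely many \<open>t\<close> only,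
  and away from these the roots are bounded by the coefficients.\<close>

lemma proper_line_if_leading_nonzero:
  assumes R: "\<And>i a. i < n \<Longrightarrow> R i a \<in> poly_over UNIV n" and E: "\<And>i. i < n \<Longrightarrow> 0 < E i"
    and rel: "\<And>i x. i < n \<Longrightarrow> (\<Sum>a\<le>E i. mpoly_eval (\<lambda>j. mpoly_eval x (F j)) (R i a) * x i ^ a) = 0"
    and lead: "\<And>i. i < n \<Longrightarrow> mpoly_eval c (R i (E i)) \<noteq> 0"
  shows "proper_line n F c"
proof -
  define \<rho> where "\<rho> i a = pev (\<lambda>j. [:0, c j:]) (R i a)" for i a
  have \<rho>: "poly (\<rho> i a) t = mpoly_eval (\<lambda>j. c j * t) (R i a)" if "i < n" for i a t
    unfolding \<rho>_def by (simp add: poly_pev[OF R[OF that]] mult.commute)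
  have "\<rho> i (E i) \<noteq> 0" if "i < n" for i
    using \<rho>[OF that, of "E i" 1] lead[OF that] by auto
  then have "finite (\<Union>i<n. {t. poly (\<rho> i (E i)) t = 0})"
    by (auto intro: poly_roots_finite)
  then have "bounded (\<Union>i<n. {t. poly (\<rho> i (E i)) t = 0})" by (rule finite_imp_bounded)
  then obtain Y0 where Y0: "\<And>i t. i < n \<Longrightarrow> poly (\<rho> i (E i)) t = 0 \<Longrightarrow> norm t \<le> Y0"
    unfolding bounded_iff by blast
  show ?thesis
    unfolding proper_line_def
  \<comment> \<open>A disc of radius 2 about such a \<open>y\<close> misses the exceptional
    \<open>t\<close>, all of norm at most \<open>Y0\<close>.\<close>
  proof (rule exI[of _ "Y0 + 3"], intro allI impI)
    fix y :: complex assume y: "Y0 + 3 \<le> norm y"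
    have nz: "poly (\<rho> i (E i)) t \<noteq> 0" if "i < n" "t \<in> cball y 2" for i t
    proof
      assume "poly (\<rho> i (E i)) t = 0"
      then have "norm t \<le> Y0" by (rule Y0[OF that(1)])
      moreover have "norm y \<le> norm t + norm (y - t)" by (metis add.commute diff_add_cancel norm_triangle_ineq)
      ultimately show False using that(2) y by (simp add: dist_norm)
    qed
    define h where "h i t = 1 + (\<Sum>a<E i. norm (poly (\<rho> i a) t) / norm (poly (\<rho> i (E i)) t))" for i t
    have "\<exists>M. \<forall>t\<in>cball y 2. norm (h i t) \<le> M" if "i < n" for i
    proof -
      have "continuous_on (cball y 2) (h i)"
        unfolding h_def using nz[OF that] by (intro continuous_intros) auto
      then have "bounded (h i ` cball y 2)" by (intro compact_imp_bounded compact_continuous_image) auto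
      then show ?thesis by (auto simp: bounded_iff)
    qed
    then have "\<forall>i. \<exists>M. i < n \<longrightarrow> (\<forall>t\<in>cball y 2. norm (h i t) \<le> M)" by blast
    then obtain M where M: "\<And>i t. i < n \<Longrightarrow> t \<in> cball y 2 \<Longrightarrow> norm (h i t) \<le> M i" by metis
    define K where "K = 1 + (\<Sum>i<n. \<bar>M i\<bar>)"
    show "\<exists>M\<ge>1. \<forall>t z. norm (t - y) < 2 \<longrightarrow> (\<forall>i<n. mpoly_eval z (F i) = c i * t) \<longrightarrow> (\<forall>i<n. norm (z i) \<le> M)"
    proof (rule exI[of _ K], intro conjI allI impI)
      show "1 \<le> K" by (simp add: K_def sum_nonneg)
      fix t z i assume t: "norm (t - y) < 2" and z: "\<forall>i<n. mpoly_eval z (F i) = c i * t" and i: "i < n"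
      have tc: "t \<in> cball y 2" using t by (simp add: dist_norm norm_minus_commute)
      have "mpoly_eval (\<lambda>j. mpoly_eval z (F j)) (R i a) = poly (\<rho> i a) t" for a
        unfolding \<rho>[OF i] by (rule eval_cong[OF R[OF i]]) (use z in simp)
      then have "(\<Sum>a\<le>E i. poly (\<rho> i a) t * z i ^ a) = 0" using rel[OF i, of z] by simp
      then have "norm (z i) \<le> h i t"
        unfolding h_def by (rule root_bound) (use nz[OF i tc] E[OF i] in auto)
      also have "\<dots> \<le> \<bar>M i\<bar>" using M[OF i tc] by simp
      also have "\<dots> \<le> (\<Sum>i<n. \<bar>M i\<bar>)" using i by (intro member_le_sum) auto
      finally show "norm (z i) \<le> K" by (simp add: K_def)
    qed
  qed
qed

lemma flow_F_at_0:
  assumes "keller_over A n F N" "i < n" "mpoly_eval (\<lambda>_. 0) (F i) = 0"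
  shows "flow n N c (\<lambda>_. 0) (F i) = fps_of_poly [:0, c i:]"
  using flow_F[OF assms(1,2), of c "\<lambda>_. 0"] assms(3)
  by (simp add: fps_of_poly_pCons fps_of_poly_const)

text \<open>If every admissible integral \<open>c\<close> had a polynomial branch, the algebraic
  relations would bound its degree uniformly in \<open>c\<close>. The Taylor coefficients beyond
  that bound are polynomials in \<open>c\<close> vanishing at all integral points off a
  hypersurface, hence zero, and the others would assemble into a polynomial inverse.\<close>

theorem choose_line:
  assumes km: "keller_over A n F N" and F0: "\<And>i. i < n \<Longrightarrow> mpoly_eval (\<lambda>_. 0) (F i) = 0" and nr: "\<not> right_invertible n F"
  obtains c where "\<And>i. c i \<in> \<int>" "proper_line n F c" "\<not> has_line n F c"
proof (rule ccontr)
  assume "\<not> thesis"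
  with that have contra: "has_line n F c" if "\<And>i. c i \<in> \<int>" "proper_line n F c" for c
    using that by blast
  note Fcl = keller_overD(1)[OF km]
  have FU: "F i \<in> poly_over UNIV n" if "i < n" for i using Fcl[OF that] by (rule poly_over_UNIV)
  have "\<forall>i. \<exists>e r. i < n \<longrightarrow> (\<forall>a. r a \<in> poly_over UNIV n) \<and> r e \<noteq> 0 \<and>
      (\<forall>x. (\<Sum>a\<le>e. mpoly_eval (\<lambda>j. mpoly_eval x (F j)) (r a) * x i ^ a) = 0)"
  proof
    fix i
    show "\<exists>e r. i < n \<longrightarrow> (\<forall>a. r a \<in> poly_over UNIV n) \<and> r e \<noteq> 0 \<and>
      (\<forall>x. (\<Sum>a\<le>e. mpoly_eval (\<lambda>j. mpoly_eval x (F j)) (r a) * x i ^ a) = 0)"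
    proof (cases "i < n")
      case True
      from algebraic_relation[of n F "mvar i", OF FU poly_over.var[OF True]]
      obtain r e where "\<And>a. r a \<in> poly_over UNIV n" "r e \<noteq> 0"
        "\<And>x. (\<Sum>a\<le>e. mpoly_eval (\<lambda>i. mpoly_eval x (F i)) (r a) * mpoly_eval x (mvar i) ^ a) = 0" by metis
      then show ?thesis by (intro exI[of _ e] exI[of _ r]) simp
    qed simp
  qed
  from choice[OF this] obtain E where "\<forall>i. \<exists>r. i < n \<longrightarrow> (\<forall>a. r a \<in> poly_over UNIV n) \<and> r (E i) \<noteq> 0 \<and>
      (\<forall>x. (\<Sum>a\<le>E i. mpoly_eval (\<lambda>j. mpoly_eval x (F j)) (r a) * x i ^ a) = 0)" by blast
  from choice[OF this] obtain R where "\<forall>i. i < n \<longrightarrow> (\<forall>a. R i a \<in> poly_over UNIV n) \<and> R i (E i) \<noteq> 0 \<and>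
      (\<forall>x. (\<Sum>a\<le>E i. mpoly_eval (\<lambda>j. mpoly_eval x (F j)) (R i a) * x i ^ a) = 0)" by blast
  then have R: "\<And>i a. i < n \<Longrightarrow> R i a \<in> poly_over UNIV n" "\<And>i. i < n \<Longrightarrow> R i (E i) \<noteq> 0"
    "\<And>i x. i < n \<Longrightarrow> (\<Sum>a\<le>E i. mpoly_eval (\<lambda>j. mpoly_eval x (F j)) (R i a) * x i ^ a) = 0"
    by blast+
  \<comment> \<open>A relation of degree 0 in the coordinate would be an algebraic relation among
    the components of F alone.\<close>
  have E: "0 < E i" if i: "i < n" for i
  proof (rule ccontr)
    assume "\<not> 0 < E i"
    then have "E i = 0" by simp
    then have "R i (E i) = 0"
      using R(3)[OF i] by (intro keller_over_dominant[OF km F0 R(1)[OF i]]) auto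
    with R(2)[OF i] show False by simp
  qed
  have "\<forall>i a. \<exists>d. tdeg_le d (R i a)" using tdeg_le_exists by blast
  then obtain dd where dd: "\<And>i a. tdeg_le (dd i a) (R i a)" by metis
  define B where "B = (\<Sum>i<n. \<Sum>a\<le>E i. dd i a)"
  have B: "tdeg_le B (R i a)" if "i < n" "a \<le> E i" for i a
  proof (rule tdeg_le_mono[OF dd])
    have "dd i a \<le> (\<Sum>a\<le>E i. dd i a)" using that by (intro member_le_sum) auto
    also have "\<dots> \<le> B" unfolding B_def using that by (intro member_le_sum[of i "{..<n}" "\<lambda>i. \<Sum>a\<le>E i. dd i a"]) auto
    finally show "dd i a \<le> B" .
  qed
  have vanish: "fps_nth (flow n N c (\<lambda>_. 0) (mvar i)) k = 0"
    if cI: "\<And>i. c i \<in> \<int>" and lead: "\<And>i. i < n \<Longrightarrow> mpoly_eval c (R i (E i)) \<noteq> 0" and i: "i < n" and k: "B < k" for c i k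
  proof -
    have "proper_line n F c" by (rule proper_line_if_leading_nonzero[OF R(1) E R(3) lead])
    with cI have "has_line n F c" by (rule contra)
    then obtain \<eta> where \<eta>: "\<And>i. i < n \<Longrightarrow> poly (\<eta> i) 0 = 0" "\<And>i. i < n \<Longrightarrow> pev \<eta> (F i) = [:0, c i:]"
      unfolding has_line_def by blast
    have "fps_of_poly (\<eta> i) = flow n N c (\<lambda>_. 0) (mvar i)"
    proof (rule fps_solution_unique[OF km _ _ i])
      fix j assume j: "j < n"
      show "fps_nth (fps_of_poly (\<eta> j)) 0 = fps_nth (flow n N c (\<lambda>_. 0) (mvar j)) 0"
        using \<eta>(1)[OF j] by (simp add: poly_0_coeff_0)
      show "fev (\<lambda>i. fps_of_poly (\<eta> i)) (F j) = fev (\<lambda>i. flow n N c (\<lambda>_. 0) (mvar i)) (F j)"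
        using flow_eq_fev[OF Fcl[OF j], of N c "\<lambda>_. 0"] flow_F_at_0[OF km j F0[OF j], of c]
        by (simp add: fev_fps_of_poly[OF Fcl[OF j]] \<eta>(2)[OF j])
    qed
    then have nth: "fps_nth (flow n N c (\<lambda>_. 0) (mvar i)) k = coeff (\<eta> i) k"
      by (metis fps_of_poly_nth)
    define \<rho> where "\<rho> a = pev (\<lambda>j. [:0, c j:]) (R i a)" for a
    have "degree (\<eta> i) \<le> B"
    proof (rule degree_root_bound[of "E i" \<rho>])
      show "degree (\<rho> a) \<le> B" if "a \<le> E i" for a
        unfolding \<rho>_def by (rule degree_pev_line[OF B[OF i that]])
      have "poly (\<rho> (E i)) 1 \<noteq> 0" using lead[OF i] by (simp add: \<rho>_def poly_pev[OF R(1)[OF i]])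
      then show "\<rho> (E i) \<noteq> 0" by auto
      show "0 < E i" by (rule E[OF i])
      have "poly (\<Sum>a\<le>E i. \<rho> a * \<eta> i ^ a) t = poly 0 t" for t
      proof -
        have "mpoly_eval (\<lambda>j. mpoly_eval (\<lambda>l. poly (\<eta> l) t) (F j)) (R i a) = poly (\<rho> a) t" for a
          unfolding \<rho>_def poly_pev[OF R(1)[OF i]]
        proof (rule eval_cong[OF R(1)[OF i]])
          fix j assume j: "j < n"
          show "mpoly_eval (\<lambda>l. poly (\<eta> l) t) (F j) = poly [:0, c j:] t"
            using \<eta>(2)[OF j] by (metis poly_pev[OF Fcl[OF j]])
        qed
        then show ?thesis using R(3)[OF i, of "\<lambda>l. poly (\<eta> l) t"] by (simp add: poly_sum)
      qed
      then show "(\<Sum>a\<le>E i. \<rho> a * \<eta> i ^ a) = 0" by (simp only: fun_eq_iff flip: poly_eq_poly_eq_iff) simp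
    qed
    then show ?thesis using k by (simp add: nth coeff_eq_0)
  qed
  have "\<forall>i k. \<exists>g. i < n \<longrightarrow> g \<in> poly_over UNIV n \<and> (\<forall>c. fps_nth (flow n N c (\<lambda>_. 0) (mvar i)) k = mpoly_eval c g)"
    using flow_nth_polynomial[OF km poly_over.var] by blast
  then obtain g where g: "\<And>i k. i < n \<Longrightarrow> g i k \<in> poly_over UNIV n"
    "\<And>i k c. i < n \<Longrightarrow> fps_nth (flow n N c (\<lambda>_. 0) (mvar i)) k = mpoly_eval c (g i k)" by metis
  \<comment> \<open>Multiplication by \<open>q\<close> makes the exceptional directions harmless:
    \<open>q\<close> vanishes at them.\<close>
  define q where "q = (\<Prod>i<n. R i (E i))"
  have q0: "q \<noteq> 0" using R(2) by (simp add: q_def)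
  have qcl: "q \<in> poly_over UNIV n" unfolding q_def using R(1) by (intro PU.prod_closed) auto
  have g0: "g i k = 0" if "i < n" "B < k" for i k
  proof -
    have "q * g i k = 0"
    proof (rule mpoly_eqI_eval[OF PU.mult_closed[OF qcl g(1)[OF that(1)]] PU.zero_closed])
      fix c :: "nat \<Rightarrow> complex" assume c: "\<And>i. c i \<in> \<int>"
      show "mpoly_eval c (q * g i k) = mpoly_eval c 0"
      proof (cases "\<forall>i<n. mpoly_eval c (R i (E i)) \<noteq> 0")
        case True
        then show ?thesis using vanish[OF c _ that] g(2)[OF that(1), of c k] by (simp add: eval.hom_mult)
      next
        case False
        then have "mpoly_eval c q = 0" by (auto simp: q_def eval.hom_prod)
        then show ?thesis by (simp add: eval.hom_mult)
      qed
    qed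
    with q0 show ?thesis by simp
  qed
  have "right_invertible n F"
    unfolding right_invertible_def
  \<comment> \<open>The inverse sends \<open>y\<close> to the point at parameter 1 on the branch in
    direction \<open>y\<close>.\<close>
  proof (intro exI[of _ "\<lambda>i. \<Sum>k\<le>B. g i k"] conjI allI impI)
    fix j assume "j < n"
    then show "(\<Sum>k\<le>B. g j k) \<in> poly_over UNIV n" using g(1) by (intro PU.sum_closed)
  next
    fix y :: "nat \<Rightarrow> complex" and i assume i: "i < n"
    define \<pi> where "\<pi> i = (\<Sum>k\<le>B. monom (mpoly_eval y (g i k)) k)" for i
    have fp: "fps_of_poly (\<pi> j) = flow n N y (\<lambda>_. 0) (mvar j)" if "j < n" for j
      using g0[OF that] g(2)[OF that] by (auto simp: fps_eq_iff \<pi>_def coeff_sum)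
    have "fps_of_poly (pev \<pi> (F i)) = fev (\<lambda>i. fps_of_poly (\<pi> i)) (F i)"
      by (rule fev_fps_of_poly[OF Fcl[OF i], symmetric])
    also have "\<dots> = flow n N y (\<lambda>_. 0) (F i)"
      unfolding flow_eq_fev[OF Fcl[OF i]] by (rule fev_cong[OF Fcl[OF i]]) (rule fp)
    also have "\<dots> = fps_of_poly [:0, y i:]" by (rule flow_F_at_0[OF km i F0[OF i]])
    finally have "pev \<pi> (F i) = [:0, y i:]" by (simp only: fps_of_poly_eq_iff)
    then have "poly (pev \<pi> (F i)) 1 = y i" by simp
    then show "mpoly_eval (\<lambda>j. mpoly_eval y (\<Sum>k\<le>B. g j k)) (F i) = y i"
      by (simp add: poly_pev[OF Fcl[OF i]] \<pi>_def poly_sum poly_monom eval.hom_sum)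
  qed
  with nr show False by simp
qed


section \<open>Failure of the Jacobian conjecture over the complex numbers\<close>

text \<open>The segment from G(0) to \<open>x\<close> and its image under G o F start at the same
  point and have the same image under F. By uniqueness of power series solutions they coincide, in
  particular at the end \<open>x\<close>.\<close>

lemma right_invertible_left_inverse:
  assumes km: "keller_over A n F N" and G: "\<And>j. j < n \<Longrightarrow> G j \<in> poly_over UNIV n"
    and right: "\<And>y i. i < n \<Longrightarrow> mpoly_eval (\<lambda>j. mpoly_eval y (G j)) (F i) = y i"
    and i: "i < n"
  shows "mpoly_eval (\<lambda>j. mpoly_eval x (F j)) (G i) = x i"
proof -
  note Fcl = keller_overD(1)[OF km]
  define w where "w j = mpoly_eval (\<lambda>_. 0) (G j)" for j
  define \<xi> where "\<xi> i = [:w i, x i - w i:]" for i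
  define \<theta> where "\<theta> i = pev \<xi> (F i)" for i
  define \<eta> where "\<eta> i = pev \<theta> (G i)" for i
  have \<theta>t: "poly (\<theta> j) t = mpoly_eval (\<lambda>i. poly (\<xi> i) t) (F j)" if "j < n" for j t
    by (simp add: \<theta>_def poly_pev[OF Fcl[OF that]])
  have \<eta>t: "poly (\<eta> j) t = mpoly_eval (\<lambda>i. poly (\<theta> i) t) (G j)" if "j < n" for j t
    by (simp add: \<eta>_def poly_pev[OF G[OF that]])
  have "fps_of_poly (\<eta> i) = fps_of_poly (\<xi> i)"
  proof (rule fps_solution_unique[OF km _ _ i])
    fix j assume j: "j < n"
    have "poly (\<theta> l) 0 = 0" if "l < n" for l
      using right[OF that, of "\<lambda>_. 0"] by (simp add: \<theta>t[OF that] \<xi>_def w_def[abs_def])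
    then have "poly (\<eta> j) 0 = w j"
      unfolding \<eta>t[OF j] w_def by (intro eval_cong[OF G[OF j]]) auto
    then show "fps_nth (fps_of_poly (\<eta> j)) 0 = fps_nth (fps_of_poly (\<xi> j)) 0"
      by (simp add: \<xi>_def poly_0_coeff_0)
    have "poly (pev \<eta> (F j)) t = poly (pev \<xi> (F j)) t" for t
    proof -
      have "poly (pev \<eta> (F j)) t = mpoly_eval (\<lambda>l. mpoly_eval (\<lambda>i. poly (\<theta> i) t) (G l)) (F j)"
        unfolding poly_pev[OF Fcl[OF j]] by (rule eval_cong[OF Fcl[OF j]]) (rule \<eta>t)
      also have "\<dots> = poly (\<theta> j) t" by (rule right[OF j])
      finally show ?thesis by (simp add: \<theta>_def)
    qed
    then have "pev \<eta> (F j) = pev \<xi> (F j)" by (simp only: fun_eq_iff flip: poly_eq_poly_eq_iff) simp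
    then show "fev (\<lambda>i. fps_of_poly (\<eta> i)) (F j) = fev (\<lambda>i. fps_of_poly (\<xi> i)) (F j)"
      by (simp add: fev_fps_of_poly[OF Fcl[OF j]])
  qed
  then have "\<eta> i = \<xi> i" by (simp only: fps_of_poly_eq_iff)
  then have "poly (\<eta> i) 1 = x i" by (simp add: \<xi>_def)
  moreover have "mpoly_eval (\<lambda>i. poly (\<theta> i) 1) (G i) = mpoly_eval (\<lambda>j. mpoly_eval x (F j)) (G i)"
  proof (rule eval_cong[OF G[OF i]])
    fix j assume j: "j < n"
    show "poly (\<theta> j) 1 = mpoly_eval x (F j)"
      unfolding \<theta>t[OF j] by (rule eval_cong[OF Fcl[OF j]]) (simp add: \<xi>_def)
  qed
  ultimately show ?thesis by (simp add: \<eta>t[OF i])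
qed

lemma poly_over_UNIV_exists: "\<exists>n. p \<in> poly_over UNIV n"
proof -
  have "finite (\<Union>m\<in>keys p. keys m)" by auto
  then obtain n where n: "(\<Union>m\<in>keys p. keys m) \<subseteq> {..<n}"
    using finite_nat_bounded by blast
  have "p \<in> polys n" unfolding polys_def
  proof (intro CollectI ballI)
    fix m assume "m \<in> keys p"
    with n show "keys m \<subseteq> {..<n}" by blast
  qed
  then show ?thesis by (auto simp: polys_eq_poly_over)
qed

lemma counterexample_UNIV_if_not_JC:
  assumes "\<not> jacobian_conjecture TYPE(complex) n"
  shows "counterexample_over UNIV"
proof -
  from assms obtain F :: "complex mpoly vec" where F: "keller_map n F" "\<not> has_poly_inverse n F"
    unfolding jacobian_conjecture_def by blast
  define f where "f i = F $ i" for i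
  have dim: "F \<in> carrier_vec n" and fcl: "\<And>i. i < n \<Longrightarrow> f i \<in> poly_over UNIV n"
    and det1: "det (jacobian_mat n F) = 1"
    using F(1) by (auto simp: keller_map_def poly_maps_def f_def polys_eq_poly_over)
  let ?J = "jacobian_mat n F"
  have J: "?J \<in> carrier_mat n n" by (simp add: jacobian_mat_def)
  \<comment> \<open>Setting the other variables to 0 puts the adjugate entries into the polynomials
    in \<open>n\<close> variables without analysing determinants; the derivatives of
    \<open>f\<close> are unaffected.\<close>
  define \<tau> where "\<tau> i = (if i < n then mvar i else 0 :: complex mpoly)" for i
  define N where "N j l = mpoly_subst \<tau> (adj_mat ?J $$ (j, l))" for j l
  have \<tau>_fix: "mpoly_subst \<tau> p = p" if "p \<in> poly_over UNIV n" for p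
    by (rule subst_mvar_id[OF that]) (simp add: \<tau>_def)
  have km: "keller_over UNIV n f N"
    unfolding keller_over_def
  proof (intro conjI allI impI)
    fix i l assume il: "i < n" "l < n"
    show "f i \<in> poly_over UNIV n" by (rule fcl[OF il(1)])
    obtain k where k: "adj_mat ?J $$ (i, l) \<in> poly_over UNIV k" using poly_over_UNIV_exists by blast
    show "N i l \<in> poly_over UNIV n"
      unfolding N_def by (rule subst_closed[OF k]) (auto simp: \<tau>_def intro: poly_over.var PU.zero_closed)
    have "1 \<cdot>\<^sub>m 1\<^sub>m n = (1\<^sub>m n :: complex mpoly mat)" by (intro eq_matI) auto
    then have "?J * adj_mat ?J = 1\<^sub>m n" using adj_mat(2)[OF J] det1 by simp
    then have "(?J * adj_mat ?J) $$ (i, l) = (if i = l then 1 else 0)" using il by simp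
    moreover have "(?J * adj_mat ?J) $$ (i, l) = (\<Sum>j<n. mpderiv j (f i) * adj_mat ?J $$ (j, l))"
      using il adj_mat(1)[OF J] by (simp add: scalar_prod_def jacobian_mat_def f_def lessThan_atLeast0)
    ultimately have "mpoly_subst \<tau> (\<Sum>j<n. mpderiv j (f i) * adj_mat ?J $$ (j, l)) = (if i = l then 1 else 0)"
      by simp
    then show "(\<Sum>j<n. mpderiv j (f i) * N j l) = (if i = l then 1 else 0)"
      by (simp add: subst.hom_sum subst.hom_mult N_def \<tau>_fix[OF mpderiv_closed[OF subring_UNIV fcl[OF il(1)]]])
  qed
  moreover have "has_poly_inverse n F" if "right_invertible n f"
  proof -
    from that obtain G where G: "\<And>j. j < n \<Longrightarrow> G j \<in> poly_over UNIV n"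
      "\<And>y i. i < n \<Longrightarrow> mpoly_eval (\<lambda>j. mpoly_eval y (G j)) (f i) = y i"
      unfolding right_invertible_def by blast
    have 1: "mpoly_subst (\<lambda>i. vec n G $ i) (f i) = mvar i" if i: "i < n" for i
    proof -
      have "mpoly_subst (\<lambda>i. vec n G $ i) (f i) = mpoly_subst G (f i)"
        by (rule subst_cong[OF fcl[OF i]]) simp
      also have "\<dots> = mvar i"
        by (rule mpoly_eqI_eval[OF subst_closed[OF fcl[OF i] G(1)] poly_over.var[OF i]])
          (simp_all add: eval_subst G(2)[OF i])
      finally show ?thesis .
    qed
    have 2: "mpoly_subst (\<lambda>i. F $ i) (G i) = mvar i" if i: "i < n" for i
      by (rule mpoly_eqI_eval[OF subst_closed[OF G(1)[OF i] fcl[unfolded f_def]] poly_over.var[OF i]])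
        (simp_all add: eval_subst right_invertible_left_inverse[OF km G i] flip: f_def)
    show ?thesis
      unfolding has_poly_inverse_def
    proof (intro bexI[of _ "vec n G"] conjI)
      show "vec n G \<in> poly_maps n" using G(1) by (auto simp: poly_maps_def polys_eq_poly_over)
      show "compose_map F (vec n G) = var_map n"
        using 1 dim by (intro eq_vecI) (auto simp: compose_map_def var_map_def f_def)
      show "compose_map (vec n G) F = var_map n"
        using 2 by (intro eq_vecI) (auto simp: compose_map_def var_map_def)
    qed
  qed
  ultimately show ?thesis using F(2) unfolding counterexample_over_def by blast
qed

section \<open>Powers of linear forms\<close>

definition lin_form :: "nat \<Rightarrow> (nat \<Rightarrow> int) \<Rightarrow> complex mpoly" where
  "lin_form n a = (\<Sum>j<n. mconst (of_int (a j)) * mvar j)"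

definition power_sum :: "nat \<Rightarrow> (int \<times> (nat \<Rightarrow> int) \<times> nat) list \<Rightarrow> complex mpoly" where
  "power_sum n xs = (\<Sum>(b, a, d)\<leftarrow>xs. mconst (of_int b) * lin_form n a ^ d)"

definition power_sums :: "nat \<Rightarrow> complex mpoly set" where
  "power_sums n = {power_sum n xs |xs. \<forall>(b, a, d)\<in>set xs. d \<in> {2, 3}}"

lemma power_sums_add: "p \<in> power_sums n \<Longrightarrow> q \<in> power_sums n \<Longrightarrow> p + q \<in> power_sums n"
proof -
  assume "p \<in> power_sums n" "q \<in> power_sums n"
  then obtain xs ys where "p = power_sum n xs" "q = power_sum n ys"
    "\<forall>(b, a, d)\<in>set xs. d \<in> {2, 3}" "\<forall>(b, a, d)\<in>set ys. d \<in> {2, 3}"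
    unfolding power_sums_def by blast
  then show ?thesis unfolding power_sums_def by (intro CollectI exI[of _ "xs @ ys"]) (auto simp: power_sum_def)
qed

lemma power_sums_zero: "0 \<in> power_sums n"
  unfolding power_sums_def by (intro CollectI exI[of _ "[]"]) (auto simp: power_sum_def)

lemma power_sums_sum: "(\<And>i. i \<in> S \<Longrightarrow> f i \<in> power_sums n) \<Longrightarrow> sum f S \<in> power_sums n"
  by (induction S rule: infinite_finite_induct) (auto intro: power_sums_zero power_sums_add)

lemma power_sums_smult:
  assumes "p \<in> power_sums n" "\<kappa> \<in> \<int>"
  shows "mconst \<kappa> * p \<in> power_sums n"
proof -
  obtain k where k: "\<kappa> = of_int k" using assms(2) by (rule Ints_cases)
  obtain xs where xs: "p = power_sum n xs" "\<forall>(b, a, d)\<in>set xs. d \<in> {2, 3}"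
    using assms(1) unfolding power_sums_def by blast
  have "mconst \<kappa> * power_sum n ys = power_sum n (map (\<lambda>(b, a, d). (k * b, a, d)) ys)" for ys
    by (induction ys) (auto simp: power_sum_def k distrib_left mconst.hom_mult mult.assoc)
  then show ?thesis
    using xs unfolding power_sums_def
    by (intro CollectI exI[of _ "map (\<lambda>(b, a, d). (k * b, a, d)) xs"]) auto
qed

lemma power_sums_power: "d \<in> {2, 3} \<Longrightarrow> lin_form n a ^ d \<in> power_sums n"
  unfolding power_sums_def by (intro CollectI exI[of _ "[(1, a, d)]"]) (auto simp: power_sum_def)

lemma lin_form_add: "lin_form n a + lin_form n b = lin_form n (\<lambda>j. a j + b j)"
  by (simp add: lin_form_def mconst.hom_add distrib_right sum.distrib)

lemma lin_form_unit: "i < n \<Longrightarrow> lin_form n (\<lambda>j. if j = i then 1 else 0) = mvar i"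
proof -
  assume "i < n"
  have "lin_form n (\<lambda>j. if j = i then 1 else 0) = (\<Sum>j<n. if j = i then mvar i else 0)"
    unfolding lin_form_def by (intro sum.cong) auto
  with \<open>i < n\<close> show ?thesis by simp
qed

text \<open>Polarisation; together with the cubic case this is the origin of the factor 6.\<close>

lemma power_sums_mult2:
  assumes "i < n" "j < n"
  shows "2 * (mvar i * mvar j) \<in> power_sums n"
proof -
  define x where "x = (\<lambda>k. if k = i then 1 else 0 :: int)"
  define y where "y = (\<lambda>k. if k = j then 1 else 0 :: int)"
  have xy: "mvar i = lin_form n x" "mvar j = lin_form n y"
    unfolding x_def y_def using assms lin_form_unit by metis+
  have m: "- p \<in> power_sums n" if "p \<in> power_sums n" for p
    using power_sums_smult[OF that, of "-1"] by (simp add: mconst.hom_uminus)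
  have "2 * (mvar i * mvar j) = (mvar i + mvar j)\<^sup>2 + - ((mvar i)\<^sup>2) + - ((mvar j)\<^sup>2 :: complex mpoly)"
    by (simp add: power2_eq_square algebra_simps)
  also have "\<dots> \<in> power_sums n"
    unfolding xy lin_form_add by (intro power_sums_add m power_sums_power) auto
  finally show ?thesis .
qed

lemma power_sums_mult3:
  assumes "i < n" "j < n" "k < n"
  shows "6 * (mvar i * mvar j * mvar k) \<in> power_sums n"
proof -
  define x where "x = (\<lambda>l. if l = i then 1 else 0 :: int)"
  define y where "y = (\<lambda>k. if k = j then 1 else 0 :: int)"
  define z where "z = (\<lambda>l. if l = k then 1 else 0 :: int)"
  have xyz: "mvar i = lin_form n x" "mvar j = lin_form n y" "mvar k = lin_form n z"
    unfolding x_def y_def z_def using assms lin_form_unit by metis+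
  have m: "- p \<in> power_sums n" if "p \<in> power_sums n" for p
    using power_sums_smult[OF that, of "-1"] by (simp add: mconst.hom_uminus)
  have "6 * (a * b * c) = (a + b + c) ^ 3 + - ((a + b) ^ 3) + - ((a + c) ^ 3) + - ((b + c) ^ 3)
      + a ^ 3 + b ^ 3 + c ^ 3" for a b c :: "complex mpoly"
    by (simp add: power3_eq_cube algebra_simps)
  then have "6 * (mvar i * mvar j * mvar k) = (mvar i + mvar j + mvar k) ^ 3 + - ((mvar i + mvar j) ^ 3)
      + - ((mvar i + mvar k) ^ 3) + - ((mvar j + mvar k) ^ 3)
      + mvar i ^ 3 + mvar j ^ 3 + (mvar k :: complex mpoly) ^ 3" .
  also have "\<dots> \<in> power_sums n"
    unfolding xyz lin_form_add by (intro power_sums_add m power_sums_power) auto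
  finally show ?thesis .
qed

lemma mconst_numeral [simp]: "mconst (numeral k) = numeral k"
  by (simp add: mconst_def)

lemma power_sums_monomial:
  assumes "mdeg m \<in> {2, 3}" "keys m \<subseteq> {..<n}" "\<kappa> \<in> \<int>"
  shows "single m (6 * \<kappa>) \<in> power_sums n"
proof -
  obtain a b where ab: "m = a + b" "mdeg a = 1" using monomial_split[of 1 m] assms(1) by auto
  then obtain i where i: "a = single i 1" using mdeg_1_imp by blast
  have keys: "keys a \<subseteq> {..<n}" "keys b \<subseteq> {..<n}"
    using assms(2) ab(1) by (auto simp: in_keys_iff lookup_add subset_iff)
  have i_n: "i < n" using keys(1) i by simp
  have mdb: "mdeg m = 1 + mdeg b" using ab mdeg_add[of a b] by simp
  have e: "single m (6 * \<kappa>) = mconst \<kappa> * (6 * (mvar i * mmon mvar b))"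
    by (simp add: ab(1) i mmon_add mconst.hom_mult mult_ac flip: mmon_mvar_single)
  show ?thesis
  proof (cases "mdeg m = 2")
    case True
    then have "mdeg b = 1" using mdb by simp
    then obtain j where j: "b = single j 1" using mdeg_1_imp by blast
    have "single m (6 * \<kappa>) = mconst (3 * \<kappa>) * (2 * (mvar i * mvar j))"
      unfolding e by (simp add: j mconst.hom_mult)
    moreover have "3 * \<kappa> \<in> \<int>" using assms(3) by (intro Ints_mult) auto
    moreover have "j < n" using keys(2) j by simp
    ultimately show ?thesis using i_n by (simp only: power_sums_smult power_sums_mult2)
  next
    case False
    then have "mdeg b = 2" using mdb assms(1) by auto
    then obtain b1 b2 where b: "b = b1 + b2" "mdeg b1 = 1" using monomial_split[of 1 b] by auto
    then have "mdeg b2 = 1" using \<open>mdeg b = 2\<close> mdeg_add[of b1 b2] by simp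
    then obtain j k where jk: "b1 = single j 1" "b2 = single k 1"
      using mdeg_1_imp b(2) by metis
    have "j \<in> keys b" "k \<in> keys b"
      by (auto simp: b(1) jk in_keys_iff lookup_add)
    then have "j < n" "k < n" using keys(2) by auto
    then show ?thesis
      unfolding e using i_n assms(3) power_sums_smult[OF power_sums_mult3[of i n j k], of \<kappa>]
      by (simp add: b(1) jk mmon_add mult.assoc)
  qed
qed


lemma single_one_eq_iff: "single i (Suc 0) = single j (Suc 0) \<longleftrightarrow> i = j"
proof
  assume "single i (Suc 0) = single j (Suc 0)"
  then have "keys (single i (Suc 0)) = keys (single j (Suc 0))"
    by simp
  then show "i = j" by simp
qed simp

text \<open>In degree k + 2 the conjugated map has its coefficients multiplied by s^(k+1), which
  contains the factor 6 required by polarisation.\<close>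

lemma power_sums_dilate:
  assumes km: "keller_over \<int> n F N" and nf: "normalized n F" and deg: "tdeg_le 3 (F i)" and i: "i < n"
    and s: "s = 6 * of_int \<mu>" "\<mu> \<noteq> 0"
  shows "mconst (inverse s) * dilation s (F i) - mvar i \<in> power_sums n"
proof -
  let ?H = "mconst (inverse s) * dilation s (F i) - mvar i"
  have s0: "s \<noteq> 0" using s by simp
  have lk: "lookup ?H m = inverse s * (s ^ mdeg m * lookup (F i) m) - lookup (mvar i) m" for m
    by (simp only: lookup_minus lookup_mconst_mult lookup_dilation)
  have "single m (lookup ?H m) \<in> power_sums n" if m: "m \<in> keys ?H" for m
  proof -
    have nz: "lookup ?H m \<noteq> 0" using m by (simp add: in_keys_iff)
    have "mdeg m \<noteq> 0"
    proof
      assume "mdeg m = 0"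
      then have "m = 0" by (rule mdeg_0_imp)
      then have "lookup (F i) m = 0" "lookup (mvar i :: complex mpoly) m = 0"
        using nf i by (auto simp: normalized_def eval_0 mvar_def lookup_single when_def dest: arg_cong[of _ _ keys])
      with nz lk show False by simp
    qed
    moreover have "mdeg m \<noteq> 1"
    proof
      assume 1: "mdeg m = 1"
      then obtain j where j: "m = single j 1" by (rule mdeg_1_imp)
      have "lookup (F i) m = (if i = j then 1 else 0)"
      proof (cases "j < n")
        case True
        then show ?thesis using nf i by (simp add: normalized_def eval_0_mpderiv j)
      next
        case False
        then have "m \<notin> keys (F i)"
          using keller_overD(1)[OF km i] by (auto simp: j polys_def poly_over_iff[OF subring_Ints])
        then show ?thesis using False i by (auto simp: in_keys_iff)
      qed
      moreover have "lookup (mvar i :: complex mpoly) m = (if i = j then 1 else 0)"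
        by (simp add: mvar_def j lookup_single when_def single_one_eq_iff)
      ultimately have "lookup ?H m = 0" unfolding lk 1 using s0 by simp
      with nz show False by simp
    qed
    ultimately obtain k where k: "mdeg m = Suc (Suc k)" by (metis One_nat_def not0_implies_Suc)
    have "m \<noteq> single i 1" using \<open>mdeg m \<noteq> 1\<close> mdeg_single by metis
    then have mv: "lookup (mvar i :: complex mpoly) m = 0"
      by (simp add: mvar_def lookup_single when_def)
    with nz have "m \<in> keys (F i)" unfolding lk by (auto simp: in_keys_iff)
    then have md: "mdeg m \<le> 3" and keys: "keys m \<subseteq> {..<n}"
      using deg keller_overD(1)[OF km i] by (auto simp: tdeg_le_def polys_def poly_over_iff[OF subring_Ints])
    have eq: "lookup ?H m = 6 * (of_int \<mu> * s ^ k * lookup (F i) m)"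
      unfolding lk mv k using s0 by (simp add: field_simps) (simp add: s(1))
    have int: "of_int \<mu> * s ^ k * lookup (F i) m \<in> \<int>"
      using poly_over_coeff[OF subring_Ints keller_overD(1)[OF km i]] unfolding s(1)
      by (intro Ints_mult Ints_power) auto
    have "mdeg m \<in> {2, 3}" using md k by auto
    then show ?thesis unfolding eq by (rule power_sums_monomial[OF _ keys int])
  qed
  then show ?thesis by (subst poly_mapping_expand[of ?H]) (rule power_sums_sum)
qed

lemma sum_list_concat_upt:
  "sum_list (map t (concat (map f [0..<n]))) = (\<Sum>k<n. sum_list (map t (f k)) :: 'a::comm_monoid_add)"
  by (induction n) auto

text \<open>The powers of all components are put into one list; each contributes only to the
  component it stems from, so a column of \<open>B\<close> has at most one nonzero entry.\<close>

lemma power_sums_family: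
  assumes "\<And>i. i < n \<Longrightarrow> h i \<in> power_sums n"
  shows "\<exists>(r :: nat) B C d. (\<forall>j<r. d j \<in> {2, 3}) \<and>
    (\<forall>i<n. h i = (\<Sum>j<r. mconst (of_int (B i j)) * lin_form n (C j) ^ d j))"
proof -
  have "\<forall>i. \<exists>xs. i < n \<longrightarrow> h i = power_sum n xs \<and> (\<forall>(b, a, d)\<in>set xs. d \<in> {2, 3})"
    using assms unfolding power_sums_def by blast
  then obtain xs where xs: "\<And>i. i < n \<Longrightarrow> h i = power_sum n (xs i)"
    "\<And>i. i < n \<Longrightarrow> \<forall>(b, a, d)\<in>set (xs i). d \<in> {2, 3}" by metis
  define L where "L = concat (map (\<lambda>i. map (Pair i) (xs i)) [0..<n])"
  define B where "B i j = (if fst (L ! j) = i then fst (snd (L ! j)) else 0)" for i j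
  define C where "C j = fst (snd (snd (L ! j)))" for j
  define d where "d j = snd (snd (snd (L ! j)))" for j
  show ?thesis
  proof (rule exI[of _ "length L"], rule exI[of _ B], rule exI[of _ C], rule exI[of _ d], intro conjI allI impI)
    fix j assume "j < length L"
    then have "L ! j \<in> set L" by simp
    then obtain i x where "i < n" "x \<in> set (xs i)" "L ! j = (i, x)" by (auto simp: L_def)
    then show "d j \<in> {2, 3}" using xs(2)[of i] by (cases x) (auto simp: d_def)
  next
    fix i assume i: "i < n"
    define t where "t x = mconst (of_int (if fst x = i then fst (snd x) else 0)) *
      lin_form n (fst (snd (snd x))) ^ snd (snd (snd x))" for x :: "nat \<times> int \<times> (nat \<Rightarrow> int) \<times> nat"
    have "(\<Sum>j<length L. mconst (of_int (B i j)) * lin_form n (C j) ^ d j) = sum_list (map t L)"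
      by (simp add: sum_list_sum_nth t_def B_def C_def d_def lessThan_atLeast0)
    also have "\<dots> = (\<Sum>k<n. sum_list (map t (map (Pair k) (xs k))))"
      unfolding L_def by (rule sum_list_concat_upt)
    also have "\<dots> = (\<Sum>k<n. if k = i then power_sum n (xs i) else 0)"
    proof (intro sum.cong refl)
      fix k
      show "sum_list (map t (map (Pair k) (xs k))) = (if k = i then power_sum n (xs i) else 0)"
        by (auto simp: t_def power_sum_def comp_def case_prod_unfold)
    qed
    also have "\<dots> = h i" using i xs(1) by simp
    finally show "h i = (\<Sum>j<length L. mconst (of_int (B i j)) * lin_form n (C j) ^ d j)" by simp
  qed
qed

section \<open>Pairing\<close>

text \<open>With \<open>F = X + B \<lambda>(X)\<^sup>d\<close>, \<open>\<lambda> = C X\<close>, the map \<open>(u, y) \<mapsto> (u + \<lambda>(c y + B u)\<^sup>d, y)\<close> has Jacobian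
  determinant \<open>det DF (c y + B u)\<close>, and its zeros with free last coordinate are the points of the curve
  \<open>F(w) = c y\<close>. The inverse Jacobian is the one given by the Woodbury identity.\<close>

lemma pairing_inverse_jacobian:
  fixes B C :: "nat \<Rightarrow> nat \<Rightarrow> complex" and c :: "nat \<Rightarrow> complex"
  assumes km: "keller_over A n F N"
    and F: "\<And>i. i < n \<Longrightarrow> F i = mvar i + (\<Sum>j<r. mconst (B i j) * (\<Sum>l<n. mconst (C j l) * mvar l) ^ Suc (e j))"
  defines "\<omega> \<equiv> \<lambda>i. mconst (c i) * mvar r + (\<Sum>j<r. mconst (B i j) * mvar j)"
  defines "\<Lambda> \<equiv> \<lambda>j. \<Sum>l<n. mconst (C j l) * \<omega> l"
  obtains N' where "\<And>p k. p < Suc r \<Longrightarrow> k < Suc r \<Longrightarrow>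
    (\<Sum>q<Suc r. mpderiv q (if p < r then mvar p + \<Lambda> p ^ Suc (e p) else mvar r) * N' q k) = (if p = k then 1 else 0)"
proof -
  let ?\<sigma> = "mpoly_subst \<omega>"
  \<comment> \<open>\<open>D\<close> is the diagonal factor from differentiating the powers,
    \<open>\<beta>\<close> the Jacobian [B | c] of \<open>\<omega>\<close>, and \<open>W\<close>
    stands for DF(\<omega>)^(-1) \<beta>. Then \<open>N'\<close> is the identity minus D C W in the
    first \<open>r\<close> rows.\<close>
  define D where "D j = of_nat (Suc (e j)) * \<Lambda> j ^ e j" for j
  define \<beta> where "\<beta> i k = (if k < r then mconst (B i k) else mconst (c i))" for i k
  define W where "W l k = (\<Sum>p<n. ?\<sigma> (N l p) * \<beta> p k)" for l k
  define N' where "N' q k = (if q < r then (if q = k then 1 else 0) - D q * (\<Sum>l<n. mconst (C q l) * W l k)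
    else if k = r then 1 else 0)" for q k
  define lf where "lf j = (\<Sum>l<n. mconst (C j l) * mvar l)" for j
  have dlin: "mpderiv l (lf j) = mconst (C j l)" if "l < n" for l j
  proof -
    have "mpderiv l (lf j) = (\<Sum>l'<n. if l' = l then mconst (C j l) else 0)"
      unfolding lf_def mpderiv_sum by (intro sum.cong) auto
    with that show ?thesis by simp
  qed
  have \<sigma>lin: "?\<sigma> (lf j) = \<Lambda> j" for j
    by (simp add: subst.hom_sum subst.hom_mult \<Lambda>_def lf_def)
  have a: "?\<sigma> (mpderiv l (F i)) = (if i = l then 1 else 0) + (\<Sum>j<r. mconst (B i j) * D j * mconst (C j l))"
    if "i < n" "l < n" for i l
  proof -
    have "mpderiv l (F i) = (if i = l then 1 else 0) + (\<Sum>j<r. mconst (B i j) * (of_nat (Suc (e j)) * lf j ^ e j * mconst (C j l)))"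
      by (simp only: F[OF that(1)] lf_def[symmetric] mpderiv_add mpderiv_sum mpderiv_mconst_mult mpderiv_power
          dlin[OF that(2)] mpderiv_mvar) auto
    then have "?\<sigma> (mpderiv l (F i)) = ?\<sigma> (if i = l then 1 else 0) +
        (\<Sum>j<r. mconst (B i j) * (of_nat (Suc (e j)) * \<Lambda> j ^ e j * mconst (C j l)))"
      by (simp only: subst.hom_add subst.hom_sum subst.hom_mult subst_mconst subst.hom_power subst.hom_of_nat \<sigma>lin)
    then show ?thesis by (simp add: D_def mult.assoc del: of_nat_Suc)
  qed
  have b: "(\<Sum>l<n. ?\<sigma> (mpderiv l (F i)) * W l k) = \<beta> i k" if i: "i < n" for i k
  proof -
    have "(\<Sum>l<n. ?\<sigma> (mpderiv l (F i)) * W l k) = (\<Sum>p<n. ?\<sigma> (\<Sum>l<n. mpderiv l (F i) * N l p) * \<beta> p k)"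
      unfolding W_def subst.hom_sum subst.hom_mult sum_distrib_left sum_distrib_right
      by (subst sum.swap) (simp add: mult.assoc)
    also have "\<dots> = (\<Sum>p<n. (if i = p then 1 else 0) * \<beta> p k)"
      using keller_overD(3)[OF km i] by (intro sum.cong) auto
    finally show ?thesis using i by (simp add: sum_delta_swap(1)[OF i])
  qed
  \<comment> \<open>This is \<beta> N' = W, because B D C = DF(\<omega>) - 1 by \<open>a\<close> and
    DF(\<omega>) W = \<beta> by \<open>b\<close>.\<close>
  have c: "(\<Sum>j<r. mconst (B i j) * N' j k) + mconst (c i) * N' r k = W i k" if i: "i < n" and k: "k < Suc r" for i k
  proof -
    have "(\<Sum>j<r. mconst (B i j) * N' j k) = (\<Sum>j<r. mconst (B i j) * (if j = k then 1 else 0))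
        - (\<Sum>j<r. mconst (B i j) * D j * (\<Sum>l<n. mconst (C j l) * W l k))"
      by (simp add: N'_def right_diff_distrib sum_subtractf mult.assoc)
    also have "(\<Sum>j<r. mconst (B i j) * (if j = k then 1 else 0)) = (if k < r then mconst (B i k) else 0)"
      by (auto simp: sum_delta_swap if_distrib cong: if_cong)
    also have "(\<Sum>j<r. mconst (B i j) * D j * (\<Sum>l<n. mconst (C j l) * W l k))
      = (\<Sum>l<n. (\<Sum>j<r. mconst (B i j) * D j * mconst (C j l)) * W l k)"
      unfolding sum_distrib_left sum_distrib_right by (subst sum.swap) (simp add: mult.assoc)
    also have "\<dots> = (\<Sum>l<n. ?\<sigma> (mpderiv l (F i)) * W l k - (if i = l then 1 else 0) * W l k)"
      using a[OF i] by (intro sum.cong refl) (simp add: left_diff_distrib[symmetric])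
    also have "\<dots> = \<beta> i k - W i k"
      using i by (simp add: sum_subtractf b[OF i] sum_delta_swap(1)[OF i])
    finally show ?thesis using k by (auto simp: N'_def \<beta>_def)
  qed
  have d\<omega>: "mpderiv q (\<omega> l) = (if q = r then mconst (c l) else mconst (B l q))" if "q < Suc r" for q l
  proof -
    have "mpderiv q (\<Sum>j<r. mconst (B l j) * mvar j) = (\<Sum>j<r. if j = q then mconst (B l q) else 0)"
      unfolding mpderiv_sum by (intro sum.cong) auto
    with that show ?thesis by (auto simp: \<omega>_def mpderiv_add)
  qed
  \<comment> \<open>The Jacobian of \<open>\<Lambda>\<close> is C \<beta>, so its product with
    \<open>N'\<close> is C W by \<open>c\<close>; multiplied by \<open>D\<close> this cancels the
    term subtracted in \<open>N'\<close>.\<close>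
  have d: "(\<Sum>q<Suc r. mpderiv q (\<Lambda> p) * N' q k) = (\<Sum>l<n. mconst (C p l) * W l k)" if "k < Suc r" for p k
  proof -
    have "(\<Sum>q<Suc r. mpderiv q (\<Lambda> p) * N' q k) = (\<Sum>q<Suc r. \<Sum>l<n. mconst (C p l) * (mpderiv q (\<omega> l) * N' q k))"
      by (simp add: \<Lambda>_def mpderiv_sum sum_distrib_right mult.assoc del: sum.lessThan_Suc)
    also have "\<dots> = (\<Sum>l<n. mconst (C p l) * (\<Sum>q<Suc r. mpderiv q (\<omega> l) * N' q k))"
      by (subst sum.swap) (simp only: sum_distrib_left)
    also have "\<dots> = (\<Sum>l<n. mconst (C p l) * W l k)"
    proof (intro sum.cong refl)
      fix l assume "l \<in> {..<n}"
      then have "W l k = (\<Sum>j<r. mconst (B l j) * N' j k) + mconst (c l) * N' r k" using c[OF _ that] by simp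
      also have "\<dots> = (\<Sum>q<Suc r. mpderiv q (\<omega> l) * N' q k)" using d\<omega> by simp
      finally show "mconst (C p l) * (\<Sum>q<Suc r. mpderiv q (\<omega> l) * N' q k) = mconst (C p l) * W l k" by simp
    qed
    finally show ?thesis .
  qed
  show ?thesis
  proof (rule that)
    fix p k assume pk: "p < Suc r" "k < Suc r"
    have delta: "(\<Sum>q<Suc r. mpderiv q (mvar p) * N' q k) = N' p k"
    proof -
      have "(\<Sum>q<Suc r. mpderiv q (mvar p) * N' q k) = (\<Sum>q<Suc r. if q = p then N' p k else 0)"
        by (intro sum.cong) auto
      with pk(1) show ?thesis by (simp del: sum.lessThan_Suc)
    qed
    show "(\<Sum>q<Suc r. mpderiv q (if p < r then mvar p + \<Lambda> p ^ Suc (e p) else mvar r) * N' q k) = (if p = k then 1 else 0)"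
    proof (cases "p < r")
      case True
      have "(\<Sum>q<Suc r. mpderiv q (mvar p + \<Lambda> p ^ Suc (e p)) * N' q k) =
          (\<Sum>q<Suc r. mpderiv q (mvar p) * N' q k) + D p * (\<Sum>q<Suc r. mpderiv q (\<Lambda> p) * N' q k)"
        unfolding sum_distrib_left sum.distrib[symmetric]
        by (intro sum.cong refl) (simp only: mpderiv_add mpderiv_power D_def distrib_right mult.assoc)
      then show ?thesis using True by (simp only: delta d[OF pk(2)] if_True) (simp add: N'_def)
    next
      case False
      then have "p = r" using pk by simp
      then show ?thesis using delta by (auto simp: N'_def simp del: sum.lessThan_Suc)
    qed
  qed
qed

text \<open>Restricted to a line through the origin, a unit becomes a unit among univariate
  polynomials, hence constant.\<close>

lemma unit_mpoly_constant:
  fixes p q :: "complex mpoly"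
  assumes "p * q = 1"
  shows "p = mconst (mpoly_eval (\<lambda>_. 0) p)"
proof -
  obtain n where p: "p \<in> poly_over UNIV n" using poly_over_UNIV_exists by blast
  show ?thesis
  proof (rule mpoly_eqI_eval[OF p poly_over.const])
    fix x :: "nat \<Rightarrow> complex"
    let ?\<xi> = "\<lambda>i. [:0, x i:]"
    have "pev ?\<xi> p * pev ?\<xi> q = 1"
      using arg_cong[OF assms, of "pev ?\<xi>"] by (simp add: pev.hom_mult)
    then have "pev ?\<xi> p dvd 1" by (metis dvdI)
    then obtain a where a: "pev ?\<xi> p = [:a:]" by (auto simp: is_unit_poly_iff)
    have "mpoly_eval x p = poly (pev ?\<xi> p) 1" by (simp add: poly_pev[OF p])
    also have "\<dots> = poly (pev ?\<xi> p) 0" by (simp add: a)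
    also have "\<dots> = mpoly_eval (\<lambda>_. 0) p" by (simp add: poly_pev[OF p])
    finally show "mpoly_eval x p = mpoly_eval x (mconst (mpoly_eval (\<lambda>_. 0) p))" by simp
  qed simp
qed

text \<open>The explicit inverse makes the determinant a unit, hence a constant, so its value at the
  origin decides.\<close>

lemma det_one_if_inverse:
  fixes J M :: "complex mpoly mat"
  assumes J: "J \<in> carrier_mat n n" and M: "M \<in> carrier_mat n n" and inv: "J * M = 1\<^sub>m n"
    and J0: "map_mat (mpoly_eval (\<lambda>_. 0)) J = 1\<^sub>m n"
  shows "det J = 1"
proof -
  have "det J * det M = 1" using det_mult[OF J M] inv by simp
  then have "det J = mconst (mpoly_eval (\<lambda>_. 0) (det J))" by (rule unit_mpoly_constant)
  also have "mpoly_eval (\<lambda>_. 0) (det J) = 1" using J0 by (simp flip: eval.hom_det)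
  finally show ?thesis by simp
qed

section \<open>Integral polynomials as complex polynomials\<close>

definition int_to_complex :: "int mpoly \<Rightarrow> complex mpoly" where
  "int_to_complex = mpoly_hom (\<lambda>c. mconst (of_int c)) mvar"

global_interpretation int_to_complex: comm_ring_hom int_to_complex
  unfolding int_to_complex_def
  by (rule comm_ring_hom_mpoly_hom) (unfold_locales, auto simp: mconst.hom_add mconst.hom_mult)

lemma int_to_complex_single: "int_to_complex (single m c) = single m (of_int c)"
  by (simp add: int_to_complex_def mpoly_hom_single mmon_mvar_single)

lemma int_to_complex_mvar [simp]: "int_to_complex (mvar i) = mvar i"
  by (simp add: mvar_def int_to_complex_single)

lemma int_to_complex_mconst [simp]: "int_to_complex (mconst c) = mconst (of_int c)"
  by (simp add: mconst_def int_to_complex_single)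

lemma lookup_int_to_complex: "lookup (int_to_complex p) m = of_int (lookup p m)"
proof (induction p rule: mpoly_single_induct)
  case (single m' c)
  show ?case by (simp add: int_to_complex_single lookup_single when_def)
qed (simp add: int_to_complex.hom_add lookup_add)

lemma int_to_complex_inj: "int_to_complex p = int_to_complex q \<Longrightarrow> p = q"
  by (rule poly_mapping_eqI) (metis lookup_int_to_complex of_int_eq_iff)

lemma mpderiv_int_to_complex: "mpderiv i (int_to_complex p) = int_to_complex (mpderiv i p)"
proof (induction p rule: mpoly_single_induct)
  case (single m c)
  show ?case by (simp add: int_to_complex_single mpderiv_single)
qed (simp add: int_to_complex.hom_add mpderiv_add)


section \<open>Integral points of quadratic-cubic Keller maps\<close>

theorem counterexample_Ints_contradiction:
  assumes hyp: "\<And>(n::nat) (F :: int mpoly vec).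
      n > 1 \<Longrightarrow> keller_map n F \<Longrightarrow> quadratic_cubic_linear_form n F \<Longrightarrow>
      \<exists>x \<in> carrier_vec n. x \<noteq> 0\<^sub>v n \<and>
        (\<Sum>i<n - 1. (mpoly_eval (\<lambda>j. x $ j) (F $ i))\<^sup>2) = 0"
    and "counterexample_over \<int>"
  shows False
proof -
  obtain n F N where km: "keller_over \<int> n F N" and nr: "\<not> right_invertible n F" and nf: "normalized n F" and deg: "\<And>i. i < n \<Longrightarrow> tdeg_le 3 (F i)"
    using counterexample_cubic[OF subring_Ints assms(2)] by blast
  have F0: "mpoly_eval (\<lambda>_. 0) (F i) = 0" if "i < n" for i using nf that by (simp add: normalized_def)
  obtain c where cI: "\<And>i. c i \<in> \<int>" and proper: "proper_line n F c" and no_line: "\<not> has_line n F c"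
    using choose_line[OF km F0 nr] by blast
  obtain m0 :: int where m0: "\<forall>m w y. m0 \<le> m \<longrightarrow> y \<in> \<int> \<longrightarrow> (\<forall>i<n. w i \<in> \<int>) \<longrightarrow>
    (\<forall>i<n. mpoly_eval (\<lambda>i. of_int m * w i) (F i) = c i * (of_int m * y)) \<longrightarrow> (\<forall>i<n. w i = 0)"
    using no_integral_points[OF km nf cI proper no_line] ..
  have "\<forall>i. \<exists>z. c i = of_int z" using cI unfolding Ints_def by blast
  from choice[OF this] obtain ci where ci: "\<And>i. c i = of_int (ci i)" by blast
  \<comment> \<open>For c = 0 the zero curve would satisfy \<open>has_line\<close>. A nonzero
    direction is needed at the end to infer y = 0 from c y = 0.\<close>
  have c0: "\<exists>i<n. c i \<noteq> 0"
  proof (rule ccontr)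
    assume *: "\<not> (\<exists>i<n. c i \<noteq> 0)"
    have "pev (\<lambda>_. 0) (F i) = [:0, c i:]" if i: "i < n" for i
    proof -
      have "poly (pev (\<lambda>_. 0) (F i)) t = poly [:0, c i:] t" for t
        using * i by (simp add: poly_pev[OF keller_overD(1)[OF km i]] F0)
      then show ?thesis by (simp only: fun_eq_iff flip: poly_eq_poly_eq_iff) simp
    qed
    then have "has_line n F c" unfolding has_line_def by (intro exI[of _ "\<lambda>_. 0"]) simp
    with no_line show False by simp
  qed
  \<comment> \<open>This makes \<open>m\<close> a multiple of 6, for polarisation, and at least
    \<open>m0\<close>, for the absence of integral points.\<close>
  define \<mu> where "\<mu> = max 1 \<bar>m0\<bar>"
  define m where "m = 6 * \<mu>"
  have m: "m0 \<le> m" "m \<noteq> 0" "\<mu> \<noteq> 0" by (auto simp: m_def \<mu>_def)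
  define s :: complex where "s = of_int m"
  have s: "s \<noteq> 0" "s \<in> \<int>" "s = 6 * of_int \<mu>" using m by (auto simp: s_def m_def)
  define Fm where "Fm i = mconst (inverse s) * dilation s (F i)" for i
  have sF: "s * lookup (F i) k \<in> \<int>" if "i < n" for i k
    by (rule Ints_mult[OF s(2) poly_over_coeff[OF subring_Ints keller_overD(1)[OF km that]]])
  have sN: "s * lookup (N j l) k \<in> \<int>" if "j < n" "l < n" for j l k
    by (rule Ints_mult[OF s(2) poly_over_coeff[OF subring_Ints keller_overD(2)[OF km that]]])
  note dilate = keller_over_dilate[OF subring_Ints km nf s(1,2) sF sN]
  have km': "keller_over \<int> n Fm (\<lambda>j l. dilation s (N j l))"
    unfolding Fm_def by (rule dilate(1))
  have nr': "\<not> right_invertible n Fm"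
    using nr dilate(2) unfolding Fm_def by blast
  have evFm: "mpoly_eval w (Fm i) = inverse s * mpoly_eval (\<lambda>i. s * w i) (F i)" for w i
    by (simp add: Fm_def eval.hom_mult eval_dilation)
  have ps: "Fm i - mvar i \<in> power_sums n" if "i < n" for i
    unfolding Fm_def using power_sums_dilate[OF km nf deg[OF that] that s(3) m(3)] .
  have "\<exists>(r :: nat) B C d. (\<forall>j<r. d j \<in> {2, 3}) \<and>
    (\<forall>i<n. Fm i - mvar i = (\<Sum>j<r. mconst (of_int (B i j)) * lin_form n (C j) ^ d j))"
    by (rule power_sums_family) (rule ps)
  then obtain r :: nat and B C d where "\<forall>j<r. d j \<in> {2, 3}"
    and "\<forall>i<n. Fm i - mvar i = (\<Sum>j<r. mconst (of_int (B i j)) * lin_form n (C j) ^ d j)"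
    by blast
  then have d: "\<And>j. j < r \<Longrightarrow> d j \<in> {2, 3}"
    and BC: "\<And>i. i < n \<Longrightarrow> Fm i - mvar i = (\<Sum>j<r. mconst (of_int (B i j)) * lin_form n (C j) ^ d j)"
    by blast+
  have Fm: "Fm i = mvar i + (\<Sum>j<r. mconst (of_int (B i j)) * lin_form n (C j) ^ d j)" if "i < n" for i
    using BC[OF that] by (simp add: algebra_simps)
  \<comment> \<open>Without powers Fm would be the identity; so the dimension r + 1 of the paired
    map exceeds 1.\<close>
  have "r \<noteq> 0"
  proof
    assume "r = 0"
    then have "Fm i = mvar i" if "i < n" for i using Fm[OF that] by simp
    then have "right_invertible n Fm"
      unfolding right_invertible_def by (intro exI[of _ mvar]) (auto intro: poly_over.var)
    with nr' show False by simp
  qed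
  \<comment> \<open>The coefficients of the linear form \<lambda>_p(c y + B u): row \<open>p\<close>
    of C B for the variables u, and of C c for the last variable y.\<close>
  define a where "a p = vec (Suc r) (\<lambda>q. if q < r then \<Sum>l<n. C p l * B l q else \<Sum>l<n. C p l * ci l)" for p
  define P where "P = vec (Suc r) (\<lambda>p. if p < r then mvar p + linear_form (a p) ^ d p else mvar r)"
  have qc: "quadratic_cubic_linear_form (Suc r) P"
    unfolding quadratic_cubic_linear_form_def
  proof (intro conjI allI impI)
    show "P \<in> carrier_vec (Suc r)" by (simp add: P_def)
    fix p assume p: "p < Suc r"
    show "\<exists>a\<in>carrier_vec (Suc r). \<exists>d\<in>{2, 3}. P $ p = mvar p + linear_form a ^ d"
    proof (cases "p < r")
      case True
      then show ?thesis using d[OF True] p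
        by (intro bexI[of _ "a p"] bexI[of _ "d p"]) (auto simp: P_def a_def)
    next
      case False
      \<comment> \<open>The free coordinate has the required form too, with the zero linear
        form.\<close>
      have "linear_form (0\<^sub>v (Suc r)) = (0 :: int mpoly)" by (simp add: linear_form_def)
      then show ?thesis using False p
        by (intro bexI[of _ "0\<^sub>v (Suc r)"] bexI[of _ 2]) (auto simp: P_def less_Suc_eq)
    qed
  qed
  define \<omega> where "\<omega> i = mconst (c i) * mvar r + (\<Sum>j<r. mconst (of_int (B i j)) * mvar j)" for i
  define \<Lambda> where "\<Lambda> j = (\<Sum>l<n. mconst (of_int (C j l)) * \<omega> l)" for j
  define \<Psi> where "\<Psi> p = (if p < r then mvar p + \<Lambda> p ^ d p else mvar r)" for p
  have lf: "int_to_complex (linear_form (a p)) = \<Lambda> p" for p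
  proof -
    have "\<Lambda> p = (\<Sum>l<n. mconst (of_int (C p l)) * (mconst (c l) * mvar r)) +
        (\<Sum>l<n. \<Sum>j<r. mconst (of_int (C p l)) * (mconst (of_int (B l j)) * mvar j))"
      by (simp add: \<Lambda>_def \<omega>_def distrib_left sum.distrib sum_distrib_left)
    also have "\<dots> = mconst (of_int (\<Sum>l<n. C p l * ci l)) * mvar r + (\<Sum>j<r. mconst (of_int (\<Sum>l<n. C p l * B l j)) * mvar j)"
      by (subst sum.swap) (simp add: ci mconst.hom_sum mconst.hom_mult sum_distrib_right mult.assoc)
    also have "\<dots> = int_to_complex (linear_form (a p))"
      by (simp add: linear_form_def a_def int_to_complex.hom_add int_to_complex.hom_sum int_to_complex.hom_mult add.commute)
    finally show ?thesis by simp
  qed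
  have P\<Psi>: "int_to_complex (P $ p) = \<Psi> p" if "p < Suc r" for p
    using that by (auto simp: P_def \<Psi>_def int_to_complex.hom_add int_to_complex.hom_power lf)
  have dS: "Suc (d j - 1) = d j" if "j < r" for j using d[OF that] by auto
  obtain N' where N': "\<And>p k. p < Suc r \<Longrightarrow> k < Suc r \<Longrightarrow>
      (\<Sum>q<Suc r. mpderiv q (\<Psi> p) * N' q k) = (if p = k then 1 else 0)"
  proof -
    have "Fm i = mvar i + (\<Sum>j<r. mconst (of_int (B i j)) * (\<Sum>l<n. mconst (of_int (C j l)) * mvar l) ^ Suc (d j - 1))"
      if "i < n" for i
      unfolding Fm[OF that] lin_form_def by (intro arg_cong2[where f = "(+)"] sum.cong refl) (simp only: dS lessThan_iff)
    from pairing_inverse_jacobian[OF km' this, of c]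
    obtain N' where *: "\<And>p k. p < Suc r \<Longrightarrow> k < Suc r \<Longrightarrow>
      (\<Sum>q<Suc r. mpderiv q (if p < r then mvar p + \<Lambda> p ^ Suc (d p - 1) else mvar r) * N' q k) = (if p = k then 1 else 0)"
      unfolding \<Lambda>_def \<omega>_def by blast
    have "(if p < r then mvar p + \<Lambda> p ^ Suc (d p - 1) else mvar r) = \<Psi> p" for p
      using dS[of p] by (cases "p < r") (simp_all only: \<Psi>_def if_True if_False)
    from *[unfolded this] show ?thesis by (rule that)
  qed
  have keller: "keller_map (Suc r) P"
  proof -
    define J where "J = map_mat int_to_complex (jacobian_mat (Suc r) P)"
    have Jc: "J \<in> carrier_mat (Suc r) (Suc r)" by (simp add: J_def jacobian_mat_def)
    have Jpq: "J $$ (p, q) = mpderiv q (\<Psi> p)" if "p < Suc r" "q < Suc r" for p q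
      using that P\<Psi>[OF that(1)] by (simp add: J_def jacobian_mat_def flip: mpderiv_int_to_complex)
    have "det J = 1"
    proof (rule det_one_if_inverse[OF Jc, of "mat (Suc r) (Suc r) (\<lambda>(q, k). N' q k)"])
      show "J * mat (Suc r) (Suc r) (\<lambda>(q, k). N' q k) = 1\<^sub>m (Suc r)"
      proof (rule eq_matI)
        fix p k assume pk: "p < dim_row (1\<^sub>m (Suc r))" "k < dim_col (1\<^sub>m (Suc r))"
        then have "(J * mat (Suc r) (Suc r) (\<lambda>(q, k). N' q k)) $$ (p, k) = (\<Sum>q<Suc r. J $$ (p, q) * N' q k)"
          using Jc by (simp add: scalar_prod_def lessThan_atLeast0 del: sum.op_ivl_Suc)
        also have "\<dots> = (\<Sum>q<Suc r. mpderiv q (\<Psi> p) * N' q k)"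
          using pk by (intro sum.cong) (auto simp: Jpq)
        also have "\<dots> = 1\<^sub>m (Suc r) $$ (p, k)" using pk N' by (simp del: sum.lessThan_Suc)
        finally show "(J * mat (Suc r) (Suc r) (\<lambda>(q, k). N' q k)) $$ (p, k) = 1\<^sub>m (Suc r) $$ (p, k)" .
      qed (use Jc in auto)
      show "map_mat (mpoly_eval (\<lambda>_. 0)) J = 1\<^sub>m (Suc r)"
      proof (rule eq_matI)
        fix p q assume pq: "p < dim_row (1\<^sub>m (Suc r))" "q < dim_col (1\<^sub>m (Suc r))"
        have L0: "mpoly_eval (\<lambda>_. 0) (\<Lambda> p) = 0"
          by (simp add: \<Lambda>_def \<omega>_def eval.hom_sum eval.hom_mult eval.hom_add)
        have "mpoly_eval (\<lambda>_. 0) (mpderiv q (\<Psi> p)) = (if p = q then 1 else 0)"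
        proof (cases "p < r")
          case True
          \<comment> \<open>The exponent is at least 2, so the derivative of the power vanishes at
            the origin.\<close>
          then obtain k where k: "d p = Suc (Suc k)" using d[OF True] by (auto simp: numeral_2_eq_2 numeral_3_eq_3)
          show ?thesis using True
            by (simp add: \<Psi>_def k mpderiv_add mpderiv_power[of q "\<Lambda> p" "Suc k", simplified] eval.hom_add eval.hom_mult L0)
        next
          case False
          then show ?thesis using pq by (auto simp: \<Psi>_def)
        qed
        then show "map_mat (mpoly_eval (\<lambda>_. 0)) J $$ (p, q) = 1\<^sub>m (Suc r) $$ (p, q)"
          using pq Jc by (simp add: Jpq)
      qed (use Jc in auto)
    qed simp
    then have "int_to_complex (det (jacobian_mat (Suc r) P)) = int_to_complex 1"
      by (simp add: J_def flip: int_to_complex.hom_det)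
    then have "det (jacobian_mat (Suc r) P) = 1" by (rule int_to_complex_inj)
    moreover have "P $ p \<in> polys (Suc r)" if "p < Suc r" for p
    proof -
      interpret Q: subring "polys (Suc r) :: int mpoly set" unfolding polys_eq_poly_over by (rule PU.subring_axioms)
      have "linear_form (a p) \<in> polys (Suc r)"
        unfolding linear_form_def by (intro Q.sum_closed Q.mult_closed polys_intros) (simp add: a_def)
      then show ?thesis using that
        by (auto simp: P_def intro!: Q.add_closed Q.power_closed polys_intros)
    qed
    ultimately show ?thesis by (auto simp: keller_map_def poly_maps_def P_def)
  qed
  obtain x where x: "x \<in> carrier_vec (Suc r)" "x \<noteq> 0\<^sub>v (Suc r)"
    "(\<Sum>i<r. (mpoly_eval (\<lambda>j. x $ j) (P $ i))\<^sup>2) = 0"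
    using hyp[OF _ keller qc] \<open>r \<noteq> 0\<close> by auto
  define y where "y = x $ r"
  \<comment> \<open>\<open>w\<close> is the image of the solution under \<open>\<omega>\<close>; it
    will satisfy F(m w) = m y c.\<close>
  define w where "w l = ci l * y + (\<Sum>j<r. B l j * x $ j)" for l
  have root: "x $ p = - ((\<Sum>l<n. C p l * w l) ^ d p)" if p: "p < r" for p
  proof -
    have "(mpoly_eval (\<lambda>j. x $ j) (P $ p))\<^sup>2 = 0"
      using x(3) p by (subst (asm) sum_nonneg_eq_0_iff) auto
    then have "x $ p + (mpoly_eval (\<lambda>j. x $ j) (linear_form (a p))) ^ d p = 0"
      using p by (simp add: P_def eval.hom_add eval.hom_power)
    moreover have "mpoly_eval (\<lambda>j. x $ j) (linear_form (a p)) = (\<Sum>l<n. C p l * w l)"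
    proof -
      have "mpoly_eval (\<lambda>j. x $ j) (linear_form (a p)) = (\<Sum>l<n. C p l * ci l) * y + (\<Sum>j<r. (\<Sum>l<n. C p l * B l j) * x $ j)"
        by (simp add: linear_form_def a_def eval.hom_sum eval.hom_mult eval.hom_add y_def)
      also have "(\<Sum>j<r. (\<Sum>l<n. C p l * B l j) * x $ j) = (\<Sum>l<n. \<Sum>j<r. C p l * (B l j * x $ j))"
        unfolding sum_distrib_right by (subst sum.swap) (simp add: mult.assoc)
      finally show ?thesis
        by (simp add: w_def distrib_left sum.distrib sum_distrib_left sum_distrib_right mult.assoc)
    qed
    ultimately show ?thesis by simp
  qed
  have "(of_int (w k) :: complex) = 0" if "k < n" for k
  proof (rule m0[rule_format, where w = "\<lambda>i. of_int (w i)" and y = "of_int y", OF m(1)])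
    fix i assume i: "i < n"
    let ?w = "\<lambda>l. of_int (w l) :: complex"
    have lw: "mpoly_eval ?w (lin_form n (C j)) = of_int (\<Sum>l<n. C j l * w l)" for j
      by (simp add: lin_form_def eval.hom_sum eval.hom_mult)
    have "mpoly_eval ?w (Fm i) = of_int (w i + (\<Sum>j<r. B i j * (\<Sum>l<n. C j l * w l) ^ d j))"
      unfolding Fm[OF i] eval.hom_add eval.hom_sum eval.hom_mult eval.hom_power lw by simp
    \<comment> \<open>By \<open>root\<close> the powers are the negatives of the x_j, so Fm(w) = w -
      B x = c y.\<close>
    also have "w i + (\<Sum>j<r. B i j * (\<Sum>l<n. C j l * w l) ^ d j) = w i + (\<Sum>j<r. B i j * (- (x $ j)))"
      using root by (intro arg_cong2[where f = "(+)"] sum.cong) auto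
    also have "\<dots> = ci i * y" by (simp add: w_def sum_negf)
    finally have "inverse s * mpoly_eval (\<lambda>i. s * ?w i) (F i) = c i * of_int y"
      by (simp add: evFm ci)
    then have "mpoly_eval (\<lambda>i. s * ?w i) (F i) = s * (c i * of_int y)"
      using s(1) by (simp add: field_simps)
    then show "mpoly_eval (\<lambda>i. of_int m * ?w i) (F i) = c i * (of_int m * of_int y)"
      by (simp add: s_def mult.left_commute)
  qed (use that in auto)
  then have w0: "w i = 0" if "i < n" for i using that by simp
  \<comment> \<open>From w = 0 the equations \<open>root\<close> give x_p = 0, and then w = c y
    forces y = 0.\<close>
  have xp: "x $ p = 0" if "p < r" for p
    using root[OF that] d[OF that] w0 by auto
  obtain i where i: "i < n" "ci i \<noteq> 0" using c0 ci by auto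
  have "ci i * y = 0" using w0[OF i(1)] xp by (simp add: w_def)
  then have "y = 0" using i by simp
  have "x = 0\<^sub>v (Suc r)"
    using x(1) xp \<open>y = 0\<close> by (intro eq_vecI) (auto simp: y_def less_Suc_eq)
  with x(2) show False by simp
qed

theorem corollary2:
  assumes "\<And>(n::nat) (F :: int mpoly vec).
      n > 1 \<Longrightarrow> keller_map n F \<Longrightarrow> quadratic_cubic_linear_form n F \<Longrightarrow>
      \<exists>x \<in> carrier_vec n. x \<noteq> 0\<^sub>v n \<and>
        (\<Sum>i<n - 1. (mpoly_eval (\<lambda>j. x $ j) (F $ i))\<^sup>2) = 0"
  shows "\<forall>n>1. jacobian_conjecture TYPE(complex) n"
proof (rule ccontr)
  assume "\<not> ?thesis"
  then obtain n where "\<not> jacobian_conjecture TYPE(complex) n" by blast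
  then have "counterexample_over UNIV" by (rule counterexample_UNIV_if_not_JC)
  then have "counterexample_over \<int>" by (rule counterexample_UNIV_imp_Ints)
  with assms show False by (rule counterexample_Ints_contradiction)
qed

end
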